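(* Let $V$ be a real vector space of finite dimension $n+1$, and let $A\in\operatorname{End}(V)$ be an endomorphism all of whose eigenvalues lie on the imaginary axis, with projective flow $\psi_A$ on $\mathbb{P}(V)$, recurrent set $\mathcal{R}(\psi_A)$, and with $s_{\max}$, $d_s$, $\mathcal{R}_s$ as defined in the context. Then for each $s\in\{1,\ldots,s_{\max}\}$ the (topological) dimension of the stable manifold $\operatorname{st}(p,\psi_A)$ of a point $p\in\mathcal{R}(\psi_A)$ is constant for $p\in\mathcal{R}_s\setminus\mathcal{R}_{s+1}$, and its value is $$D_s:=n+1-\sum_{i=s}^{s_{\max}}(i+1-s)\,d_i.$$
   Context: $\mathbb{P}(V)$ is the real projective space of $V$ (quotient of $V\setminus\{0\}$ by nonzero real scaling, with quotient topology), $\mathbb{P}x$ is the class of $x\in V\setminus\{0\}$, and for a subset $W\subset V$, $\mathbb{P}W=\{\mathbb{P}x: x\in W\setminus\{0\}\}$. The projective flow of $A$ is $\psi_A(t,\mathbb{P}x)=\mathbb{P}(e^{At}x)$. For a continuous flow $\varphi$ on a compact metric space $(X,d)$, a point $x$ is recurrent if there are $t_n\to\infty$ with $\varphi(t_n,x)\to x$; $\mathcal{R}(\varphi)$ is the set of recurrent points. The stable manifold of $x\in X$ is $\operatorname{st}(x,\varphi)=\{y\in X: d(\varphi(t,x),\varphi(t,y))\to 0\text{ as }t\to\infty\}$ (it depends only on the topology of $X$). $E_A\subset V$ denotes the sum of the real eigenspaces of $A$, i.e. of the subspaces $V\cap(E(i\alpha)\oplus E(-i\alpha))$ ($\alpha>0$)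 and $V\cap E(0)=\ker A$, where $E(\cdot)$ is the corresponding complex eigenspace in the complexification of $V$. One has $\mathcal{R}(\psi_A)=\mathbb{P}E_A$. Fix a decomposition of $V$ into real Jordan subspaces of $A$. Let $s_{\max}$ be the largest dimension of a complex Jordan subspace of $A$ (largest complex Jordan block size). For $s\in\{1,\ldots,s_{\max}\}$ let $J_s\subset V$ be the sum of all real Jordan subspaces of dimension $s$ for the real eigenvalue $0$, or of dimension $2s$ for a complex conjugate pair of nonzero imaginary eigenvalues. Thus $V=J_1\oplus\cdots\oplus J_{s_{\max}}$, and each $x\in V$ is written uniquely as $x=x_1\oplus\cdots\oplus x_{s_{\max}}$ with $x_s\in J_s$. Let $d_s$ be the dimension of the sum of all real eigenspaces contained in $J_s$, i.e. $d_s=\dim(E_A\cap J_s)$ (so $\dim J_s=s\,d_s$). For $s=1,\ldots,s_{\max}$ put $$\mathcal{R}_s:=\{\mathbb{P}x\in\mathbb{P}E_A:\ x_{s-1}=0,\ x_{s-2}=0,\ldots,x_1=0\},\qquad \mathcal{R}_{s_{\max}+1}:=\emptyset.$$ *)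

theory Defs
  imports "HOL-Analysis.Analysis"
begin

section \<open>Topological dimension\<close>

text \<open>
  \<open>dim_le\<close> is the library's small inductive (Menger--Urysohn) dimension relation, with the empty
  space having dimension -1; on the separable metrizable spaces considered here it agrees with
  the large inductive and the covering dimension.
\<close>

definition has_dimension :: "'a topology \<Rightarrow> int \<Rightarrow> bool"
  where "has_dimension X k \<longleftrightarrow> X dim_le k \<and> \<not> X dim_le (k - 1)"


section \<open>Recurrence and stable manifolds of flows\<close>

definition recurrent_points :: "'x topology \<Rightarrow> (real \<Rightarrow> 'x \<Rightarrow> 'x) \<Rightarrow> 'x set"
  where "recurrent_points X \<phi> =
    {x \<in> topspace X. \<exists>t :: nat \<Rightarrow> real. filterlim t at_top sequentially \<and>
       limitin X (\<lambda>n. \<phi> (t n) x) x sequentially}"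

definition stable_manifold :: "'x set \<Rightarrow> ('x \<Rightarrow> 'x \<Rightarrow> real) \<Rightarrow> (real \<Rightarrow> 'x \<Rightarrow> 'x) \<Rightarrow> 'x \<Rightarrow> 'x set"
  where "stable_manifold X d \<phi> x = {y \<in> X. ((\<lambda>t. d (\<phi> t x) (\<phi> t y)) \<longlongrightarrow> 0) at_top}"


section \<open>Projective space and the projective flow\<close>

definition proj :: "'a::euclidean_space \<Rightarrow> 'a set"
  where "proj x = {c *\<^sub>R x | c. c \<noteq> 0}"

definition proj_set :: "'a::euclidean_space set \<Rightarrow> 'a set set"
  where "proj_set W = proj ` (W - {0})"

definition proj_topology :: "'a::euclidean_space set topology"
  where "proj_topology = topology (\<lambda>\<U>. \<U> \<subseteq> proj_set UNIV \<and> open {x. x \<noteq> 0 \<and> proj x \<in> \<U>})"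

lemma openin_proj_topology:
  "openin proj_topology \<U> \<longleftrightarrow> \<U> \<subseteq> proj_set UNIV \<and> open {x. x \<noteq> 0 \<and> proj x \<in> \<U>}"
proof -
  have "istopology (\<lambda>\<U> :: 'a set set. \<U> \<subseteq> proj_set UNIV \<and> open {x. x \<noteq> 0 \<and> proj x \<in> \<U>})"
    unfolding istopology_def
  proof (intro conjI allI impI)
    fix S T :: "'a set set"
    assume S: "S \<subseteq> proj_set UNIV \<and> open {x. x \<noteq> 0 \<and> proj x \<in> S}"
      and T: "T \<subseteq> proj_set UNIV \<and> open {x. x \<noteq> 0 \<and> proj x \<in> T}"
    show "S \<inter> T \<subseteq> proj_set UNIV" using S by blast
    have "{x. x \<noteq> 0 \<and> proj x \<in> S \<inter> T} = {x. x \<noteq> 0 \<and> proj x \<in> S} \<inter> {x. x \<noteq> 0 \<and> proj x \<in> T}"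
      by blast
    then show "open {x. x \<noteq> 0 \<and> proj x \<in> S \<inter> T}" using S T by (simp only: open_Int)
  next
    fix K :: "'a set set set"
    assume K: "\<forall>S\<in>K. S \<subseteq> proj_set UNIV \<and> open {x. x \<noteq> 0 \<and> proj x \<in> S}"
    show "\<Union>K \<subseteq> proj_set UNIV" using K by blast
    have "{x. x \<noteq> 0 \<and> proj x \<in> \<Union>K} = (\<Union>S\<in>K. {x. x \<noteq> 0 \<and> proj x \<in> S})"
      by blast
    then show "open {x. x \<noteq> 0 \<and> proj x \<in> \<Union>K}" using K by (auto simp only: intro!: open_UN)
  qed
  then show ?thesis
    by (simp add: proj_topology_def topology_inverse')
qed

lemma topspace_proj_topology: "topspace (proj_topology :: 'a::euclidean_space set topology) = proj_set UNIV"
proof -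
  have "{x :: 'a. x \<noteq> 0 \<and> proj x \<in> proj_set UNIV} = - {0}"
    by (auto simp: proj_set_def)
  then have "openin proj_topology (proj_set UNIV :: 'a set set)"
    by (simp add: openin_proj_topology open_Compl)
  then show ?thesis
    by (meson openin_proj_topology openin_subset openin_topspace subset_antisym)
qed

lemma quotient_map_proj:
  "quotient_map (top_of_set (- {0})) (proj_topology :: 'a::euclidean_space set topology) proj"
proof -
  have "openin (top_of_set (- {0 :: 'a})) T \<longleftrightarrow> open T" if "T \<subseteq> - {0}" for T
    using that by (simp add: openin_open_eq open_Compl)
  then have *: "openin (top_of_set (- {0})) {x. x \<noteq> 0 \<and> proj x \<in> U} \<longleftrightarrow>
      open {x. x \<noteq> 0 \<and> proj x \<in> U}" for U :: "'a set set"
    by (simp add: subset_iff)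
  show ?thesis
    unfolding quotient_map_def
    by (auto simp: topspace_proj_topology openin_proj_topology * proj_set_def)
qed

definition lin_exp :: "('a::euclidean_space \<Rightarrow> 'a) \<Rightarrow> real \<Rightarrow> 'a \<Rightarrow> 'a"
  where "lin_exp A t x = (\<Sum>k. (t ^ k / fact k) *\<^sub>R (A ^^ k) x)"

definition proj_flow :: "('a::euclidean_space \<Rightarrow> 'a) \<Rightarrow> real \<Rightarrow> 'a set \<Rightarrow> 'a set"
  where "proj_flow A t p = lin_exp A t ` p"

lemma proj_flow_proj:
  assumes "linear A"
  shows "proj_flow A t (proj x) = proj (lin_exp A t x)"
proof -
  obtain B where B: "B > 0" "\<And>x. norm (A x) \<le> B * norm x"
    using linear_bounded_pos[OF assms] by blast
  have bound: "norm ((A ^^ k) x) \<le> B ^ k * norm x" for k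
  proof (induction k)
    case (Suc k)
    have "norm ((A ^^ Suc k) x) \<le> B * norm ((A ^^ k) x)" using B by simp
    also have "\<dots> \<le> B * (B ^ k * norm x)" using Suc B by simp
    finally show ?case by (simp add: mult.assoc)
  qed simp
  have summ: "summable (\<lambda>k. (t ^ k / fact k) *\<^sub>R (A ^^ k) x)"
  proof (rule summable_comparison_test)
    show "summable (\<lambda>k. norm x * ((\<bar>t\<bar> * B) ^ k / fact k))"
      using summable_exp_generic[of "\<bar>t\<bar> * B"] by (intro summable_mult) (simp add: field_simps)
    show "\<exists>N. \<forall>k\<ge>N. norm ((t ^ k / fact k) *\<^sub>R (A ^^ k) x) \<le> norm x * ((\<bar>t\<bar> * B) ^ k / fact k)"
    proof (intro exI allI impI)
      fix k
      have "norm ((t ^ k / fact k) *\<^sub>R (A ^^ k) x) = (\<bar>t\<bar> ^ k / fact k) * norm ((A ^^ k) x)"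
        by (simp add: power_abs)
      also have "\<dots> \<le> (\<bar>t\<bar> ^ k / fact k) * (B ^ k * norm x)"
        by (rule mult_left_mono[OF bound]) simp
      finally show "norm ((t ^ k / fact k) *\<^sub>R (A ^^ k) x) \<le> norm x * ((\<bar>t\<bar> * B) ^ k / fact k)"
        by (simp add: power_mult_distrib algebra_simps)
    qed
  qed
  have pow: "(A ^^ k) (c *\<^sub>R x) = c *\<^sub>R (A ^^ k) x" for k c
    by (induction k) (simp_all add: linear_scale[OF assms])
  have "lin_exp A t (c *\<^sub>R x) = c *\<^sub>R lin_exp A t x" for c
    using suminf_scaleR_right[OF summ, of c] by (simp add: lin_exp_def pow mult.commute)
  then show ?thesis
    by (simp add: proj_flow_def proj_def image_Collect) metis
qed


section \<open>Complexification, eigenspaces and Jordan subspaces\<close>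

text \<open>
  The complexification of \<open>'a\<close> is \<open>'a \<times> 'a\<close>, with \<open>(x, y)\<close> standing for \<open>x + \<i> y\<close>; the
  complex extension of \<open>A\<close> is \<open>map_prod A A\<close>, and \<open>'a\<close> is embedded by \<open>x \<mapsto> (x, 0)\<close>.
\<close>

definition cscale :: "complex \<Rightarrow> 'a::euclidean_space \<times> 'a \<Rightarrow> 'a \<times> 'a"
  where "cscale c v = (Re c *\<^sub>R fst v - Im c *\<^sub>R snd v, Re c *\<^sub>R snd v + Im c *\<^sub>R fst v)"

definition conj_vec :: "'a::euclidean_space \<times> 'a \<Rightarrow> 'a \<times> 'a"
  where "conj_vec v = (fst v, - snd v)"

definition complex_eigenspace :: "('a::euclidean_space \<Rightarrow> 'a) \<Rightarrow> complex \<Rightarrow> ('a \<times> 'a) set"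
  where "complex_eigenspace A \<mu> = {v. map_prod A A v = cscale \<mu> v}"

definition is_eigenvalue :: "('a::euclidean_space \<Rightarrow> 'a) \<Rightarrow> complex \<Rightarrow> bool"
  where "is_eigenvalue A \<mu> \<longleftrightarrow> (\<exists>v\<in>complex_eigenspace A \<mu>. v \<noteq> 0)"

text \<open>The sum \<open>E\<^sub>A\<close> of the real eigenspaces, for \<open>A\<close> with spectrum on the imaginary axis.\<close>

definition real_eigenspace_sum :: "('a::euclidean_space \<Rightarrow> 'a) \<Rightarrow> 'a set"
  where "real_eigenspace_sum A = span
    ({x. A x = 0} \<union>
     (\<Union>\<alpha>\<in>{0<..}. {x. \<exists>u\<in>complex_eigenspace A (\<i> * complex_of_real \<alpha>).
                       \<exists>w\<in>complex_eigenspace A (- \<i> * complex_of_real \<alpha>). (x, 0) = u + w}))"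

definition jordan_chain ::
    "('a::euclidean_space \<Rightarrow> 'a) \<Rightarrow> complex \<Rightarrow> nat \<Rightarrow> (nat \<Rightarrow> 'a \<times> 'a) \<Rightarrow> bool"
  where "jordan_chain A \<mu> s v \<longleftrightarrow> s \<ge> 1 \<and> v 0 \<noteq> 0 \<and>
    (\<forall>j<s. map_prod A A (v j) = cscale \<mu> (v j) + (if j = 0 then 0 else v (j - 1)))"

text \<open>A Jordan chain is linearly independent, so \<open>s\<close> is the complex dimension of \<open>J\<close>.\<close>

definition complex_jordan_subspace ::
    "('a::euclidean_space \<Rightarrow> 'a) \<Rightarrow> complex \<Rightarrow> nat \<Rightarrow> ('a \<times> 'a) set \<Rightarrow> bool"
  where "complex_jordan_subspace A \<mu> s J \<longleftrightarrow>
    (\<exists>v. jordan_chain A \<mu> s v \<and> J = {\<Sum>j<s. cscale (c j) (v j) | c. True})"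

text \<open>
  For real \<open>\<mu>\<close> a real Jordan subspace is spanned by a Jordan chain of real vectors; for non-real
  \<open>\<mu>\<close> it is the real part \<open>V \<inter> (J \<oplus> conj J)\<close> of a conjugate pair of complex Jordan subspaces.
\<close>

definition real_jordan_subspace :: "('a::euclidean_space \<Rightarrow> 'a) \<Rightarrow> complex \<Rightarrow> 'a set \<Rightarrow> bool"
  where "real_jordan_subspace A \<mu> U \<longleftrightarrow>
    (if \<mu> \<in> \<real> then \<exists>s v. jordan_chain A \<mu> s (\<lambda>j. (v j, 0)) \<and> U = span (v ` {..<s})
     else \<exists>s J. complex_jordan_subspace A \<mu> s J \<and> U = {x. \<exists>u\<in>J. \<exists>w\<in>J. (x, 0) = u + conj_vec w})"

text \<open>\<open>V\<close> is the (internal) direct sum of the family \<open>\<D>\<close> of real Jordan subspaces.\<close>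

definition real_jordan_decomposition :: "('a::euclidean_space \<Rightarrow> 'a) \<Rightarrow> 'a set set \<Rightarrow> bool"
  where "real_jordan_decomposition A \<D> \<longleftrightarrow> finite \<D> \<and>
    (\<forall>U\<in>\<D>. \<exists>\<mu>. real_jordan_subspace A \<mu> U) \<and>
    (\<forall>x. \<exists>!f. f \<in> (\<Pi>\<^sub>E U\<in>\<D>. U) \<and> x = (\<Sum>U\<in>\<D>. f U))"

definition s_max :: "('a::euclidean_space \<Rightarrow> 'a) \<Rightarrow> nat"
  where "s_max A = Max {s. \<exists>\<mu> J. complex_jordan_subspace A \<mu> s J}"

definition jordan_sum :: "('a::euclidean_space \<Rightarrow> 'a) \<Rightarrow> 'a set set \<Rightarrow> nat \<Rightarrow> 'a set"
  where "jordan_sum A \<D> s = span (\<Union>{U \<in> \<D>.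
    (real_jordan_subspace A 0 U \<and> dim U = s) \<or>
    (\<exists>\<alpha>>0. real_jordan_subspace A (\<i> * complex_of_real \<alpha>) U \<and> dim U = 2 * s)})"

text \<open>The component \<open>x\<^sub>s\<close> of \<open>x\<close> in the direct sum of the \<open>jordan_sum A \<D> s\<close>, \<open>1 \<le> s \<le> s_max A\<close>.\<close>

definition jordan_component ::
    "('a::euclidean_space \<Rightarrow> 'a) \<Rightarrow> 'a set set \<Rightarrow> 'a \<Rightarrow> nat \<Rightarrow> 'a"
  where "jordan_component A \<D> x =
    (THE y. y \<in> (\<Pi>\<^sub>E s\<in>{1..s_max A}. jordan_sum A \<D> s) \<and> x = (\<Sum>s = 1..s_max A. y s))"

definition eigen_dim :: "('a::euclidean_space \<Rightarrow> 'a) \<Rightarrow> 'a set set \<Rightarrow> nat \<Rightarrow> nat"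
  where "eigen_dim A \<D> s = dim (real_eigenspace_sum A \<inter> jordan_sum A \<D> s)"

definition recurrent_stratum :: "('a::euclidean_space \<Rightarrow> 'a) \<Rightarrow> 'a set set \<Rightarrow> nat \<Rightarrow> 'a set set"
  where "recurrent_stratum A \<D> s =
    (if s \<le> s_max A
     then proj_set {x \<in> real_eigenspace_sum A. \<forall>i\<in>{1..<s}. jordan_component A \<D> x i = 0}
     else {})"

end

theory Submission
  imports Defs
begin

text \<open>
  The Jordan decomposition splits \<open>A\<close> as \<open>S + N\<close>, where \<open>N\<close> is nilpotent and commutes with \<open>A\<close>, and \<open>S\<close>
  generates rotations because the spectrum is imaginary. With \<open>R t\<close> the flow of \<open>S\<close>,
  \<open>exp (A t) y\<close> is the sum of the terms \<open>(t ^ k / fact k) *\<^sub>R R t ((N ^^ k) y)\<close>, and every \<open>R t\<close> distorts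
  norms by at most a fixed factor \<open>C\<close>. So the line through \<open>exp (A t) y\<close> is asymptotic to the line
  through \<open>R t z\<close>, where \<open>z\<close> is the last nonzero iterate \<open>(N ^^ j) y\<close>. A vector \<open>x\<close> of \<open>E\<^sub>A\<close> lies in the
  kernel of \<open>N\<close> and moves by \<open>R t\<close> alone, hence \<open>y\<close> belongs to the stable manifold of \<open>x\<close> exactly when
  some iterate \<open>(N ^^ j) y\<close> is a nonzero multiple of \<open>x\<close> (\<open>stable_manifold_eq\<close>).
  
  If \<open>x\<close> is in the range of \<open>N ^^ k\<close> but not in that of \<open>N ^^ Suc k\<close>, only \<open>j \<le> k\<close> occurs. Writing
  \<open>x = (N ^^ k) y0\<close> and \<open>L\<close> for the kernel of \<open>N ^^ k\<close>, the stable manifold then contains the image of the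
  affine space \<open>y0 + L\<close>, on which \<open>proj\<close> is injective, and is contained in the projective space of
  \<open>span (insert y0 L)\<close>. Both have dimension \<open>dim L\<close> (\<open>has_dimension_proj_between\<close>). The stratum
  \<open>s\<close> without the stratum \<open>s + 1\<close> is the case \<open>k = s - 1\<close>, and rank-nullity applied successively to
  the powers of \<open>N\<close> evaluates \<open>dim L\<close> as the number in the theorem (\<open>dim_kernel_funpow\<close>).
  
  The two bounds on the inductive dimension are of different depth. The upper bound on a projective
  space uses neighbourhoods whose frontiers are spheres of one dimension less. For the lower
  bound, a compact set of inductive dimension at most \<open>n - 1\<close> has, for every finite open cover, an open
  shrinking of order at most \<open>n\<close>; a simplex with \<open>n + 1\<close> vertices, covered by the complements of its
  facets, violates this by Brouwer's fixed point theorem (\<open>simplex_not_dim_le\<close>).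
\<close>

section \<open>From inductive dimension to the order of open covers\<close>

text \<open>
  Covering dimension at most \<open>n - 1\<close>, phrased through shrinkings that keep the index set. Open sets are taken
  relative to \<open>K\<close>, so that the property is intrinsic, and the shift by one lets \<open>n = 0\<close> describe the
  empty set.
\<close>

definition covering_order_le :: "nat \<Rightarrow> 'a::metric_space set \<Rightarrow> bool"
  where "covering_order_le n K \<longleftrightarrow>
    (\<forall>I :: nat set. \<forall>U. finite I \<longrightarrow> (\<forall>i\<in>I. openin (top_of_set K) (U i)) \<longrightarrow> K \<subseteq> (\<Union>i\<in>I. U i) \<longrightarrow>
      (\<exists>V. (\<forall>i\<in>I. openin (top_of_set K) (V i) \<and> V i \<subseteq> U i) \<and> K \<subseteq> (\<Union>i\<in>I. V i) \<and>
           (\<forall>x\<in>K. card {i\<in>I. x \<in> V i} \<le> n)))"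

lemma covering_order_leD:
  fixes I :: "nat set"
  assumes "covering_order_le n K" "finite I" "\<And>i. i \<in> I \<Longrightarrow> openin (top_of_set K) (U i)"
    "K \<subseteq> (\<Union>i\<in>I. U i)"
  obtains V where "\<And>i. i \<in> I \<Longrightarrow> openin (top_of_set K) (V i)" "\<And>i. i \<in> I \<Longrightarrow> V i \<subseteq> U i"
    "K \<subseteq> (\<Union>i\<in>I. V i)" "\<And>x. x \<in> K \<Longrightarrow> card {i\<in>I. x \<in> V i} \<le> n"
proof -
  have "\<exists>V. (\<forall>i\<in>I. openin (top_of_set K) (V i) \<and> V i \<subseteq> U i) \<and> K \<subseteq> (\<Union>i\<in>I. V i) \<and>
           (\<forall>x\<in>K. card {i\<in>I. x \<in> V i} \<le> n)"
    using assms(1)[unfolded covering_order_le_def, rule_format, OF assms(2-4)] by blast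
  then show ?thesis using that by blast
qed

text \<open>
  A canonical way to thicken a relatively open subset \<open>W\<close> of \<open>F\<close> to an open set of the ambient space
  that creates no new intersections: a point joins when all of \<open>F\<close> within some radius, and at least
  one such point, lies in \<open>W\<close>.
\<close>

definition ball_extension :: "'a::metric_space set \<Rightarrow> 'a set \<Rightarrow> 'a set"
  where "ball_extension F W = {x. \<exists>r>0. ball x r \<inter> F \<noteq> {} \<and> ball x r \<inter> F \<subseteq> W}"

lemma open_ball_extension: "open (ball_extension F W)"
proof (rule openI)
  fix x assume "x \<in> ball_extension F W"
  then obtain r y where r: "r > 0" "ball x r \<inter> F \<subseteq> W" "y \<in> F" "dist x y < r"
    by (auto simp: ball_extension_def)
  define e where "e = (r - dist x y) / 2"
  have e: "e > 0" using r by (simp add: e_def)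
  have "ball x e \<subseteq> ball_extension F W"
  proof
    fix z assume z: "z \<in> ball x e"
    have "dist z y < r - e"
      using z dist_triangle[of z y x] by (simp add: e_def dist_commute field_simps)
    moreover have "ball z (r - e) \<subseteq> ball x r"
    proof
      fix w assume "w \<in> ball z (r - e)"
      then show "w \<in> ball x r" using z dist_triangle[of x w z] by simp
    qed
    moreover have "r - e > 0" using calculation(1) zero_le_dist[of z y] by linarith
    ultimately show "z \<in> ball_extension F W"
      using r unfolding ball_extension_def by (auto intro!: exI[of _ "r - e"])
  qed
  then show "\<exists>e>0. ball x e \<subseteq> ball_extension F W" using e by blast
qed

lemma openin_subset_ball_extension:
  assumes "openin (top_of_set F) W"
  shows "W \<subseteq> ball_extension F W"
proof
  fix x assume "x \<in> W"
  then obtain e where "e > 0" "ball x e \<inter> F \<subseteq> W" "x \<in> F"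
    using assms by (meson openin_contains_ball subsetD)
  then show "x \<in> ball_extension F W"
    by (force simp: ball_extension_def)
qed

text \<open>
  The smallest of the radii that witness membership serves all the sets at once.
\<close>

lemma ball_extension_common_point:
  assumes "finite J" "J \<noteq> {}" "\<And>i. i \<in> J \<Longrightarrow> x \<in> ball_extension F (W i)"
  shows "\<exists>y\<in>F. \<forall>i\<in>J. y \<in> W i"
proof -
  obtain r where r: "\<And>i. i \<in> J \<Longrightarrow> ball x (r i) \<inter> F \<noteq> {} \<and> ball x (r i) \<inter> F \<subseteq> W i"
    using assms(3) unfolding ball_extension_def by simp metis
  have "Min (r ` J) \<in> r ` J" using assms(1,2) by (intro Min_in) auto
  then obtain j where "j \<in> J" "r j = Min (r ` J)" by auto
  then have j: "j \<in> J" "\<And>i. i \<in> J \<Longrightarrow> r j \<le> r i"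
    using assms(1) by auto
  then obtain y where "y \<in> ball x (r j) \<inter> F" using r by blast
  moreover have "ball x (r j) \<inter> F \<subseteq> W i" if "i \<in> J" for i
    using r[OF that] j(2)[OF that] subset_ball[of "r j" "r i" x] by blast
  ultimately show ?thesis by blast
qed

text \<open>
  The order bound for a shrinking on a subspace \<open>F\<close> carries over to all of \<open>K\<close>, because thickening by
  \<open>ball_extension\<close> preserves the nerve of the family.
\<close>

lemma covering_order_le_extend:
  fixes I :: "nat set"
  assumes "covering_order_le n F" "F \<subseteq> K" "finite I" "\<And>i. i \<in> I \<Longrightarrow> openin (top_of_set K) (U i)"
    "F \<subseteq> (\<Union>i\<in>I. U i)"
  obtains V where "\<And>i. i \<in> I \<Longrightarrow> openin (top_of_set K) (V i)" "\<And>i. i \<in> I \<Longrightarrow> V i \<subseteq> U i"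
    "F \<subseteq> (\<Union>i\<in>I. V i)" "\<And>x. card {i\<in>I. x \<in> V i} \<le> n"
proof -
  have opF: "openin (top_of_set F) (U i \<inter> F)" if "i \<in> I" for i
    using assms(2) assms(4)[OF that]
    by (metis inf.absorb_iff2 inf_commute openin_subtopology_Int2 subtopology_subtopology)
  have covF: "F \<subseteq> (\<Union>i\<in>I. U i \<inter> F)" using assms(5) by auto
  obtain W where W: "\<And>i. i \<in> I \<Longrightarrow> openin (top_of_set F) (W i)" "\<And>i. i \<in> I \<Longrightarrow> W i \<subseteq> U i \<inter> F"
    "F \<subseteq> (\<Union>i\<in>I. W i)" "\<And>x. x \<in> F \<Longrightarrow> card {i\<in>I. x \<in> W i} \<le> n"
    using covering_order_leD[OF assms(1,3) opF covF] by blast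
  show ?thesis
  proof
    show "openin (top_of_set K) (U i \<inter> ball_extension F (W i))" if "i \<in> I" for i
      using assms(4)[OF that] open_ball_extension by (metis inf_commute openin_Int_open)
    show "U i \<inter> ball_extension F (W i) \<subseteq> U i" for i by simp
    show "F \<subseteq> (\<Union>i\<in>I. U i \<inter> ball_extension F (W i))"
    proof
      fix x assume "x \<in> F"
      then obtain i where "i \<in> I" "x \<in> W i" using W(3) by auto
      then show "x \<in> (\<Union>i\<in>I. U i \<inter> ball_extension F (W i))"
        using subsetD[OF W(2), of i x] subsetD[OF openin_subset_ball_extension[OF W(1)], of i x] by auto
    qed
    show "card {i \<in> I. x \<in> U i \<inter> ball_extension F (W i)} \<le> n" for x
    proof (cases "{i \<in> I. x \<in> U i \<inter> ball_extension F (W i)} = {}")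
      case False
      then obtain y where y: "y \<in> F" "\<forall>i\<in>{i \<in> I. x \<in> U i \<inter> ball_extension F (W i)}. y \<in> W i"
        using ball_extension_common_point[of "{i \<in> I. x \<in> U i \<inter> ball_extension F (W i)}" x F W]
          \<open>finite I\<close> by fastforce
      have "card {i \<in> I. x \<in> U i \<inter> ball_extension F (W i)} \<le> card {i \<in> I. y \<in> W i}"
        using y \<open>finite I\<close> by (intro card_mono) auto
      then show ?thesis using W(4)[OF y(1)] by simp
    qed (metis card.empty zero_le)
  qed
qed

text \<open>
  The finite sum theorem of covering dimension. Closed sets are treated one after the other: away from the
  current set \<open>F\<close> the cover is left alone, and on \<open>F\<close> it is replaced by a shrinking of small order.
  Later steps only shrink further, so the order achieved on earlier sets survives.
\<close>

lemma covering_order_le_Union: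
  fixes I :: "nat set"
  assumes "finite \<F>" "\<And>F. F \<in> \<F> \<Longrightarrow> closedin (top_of_set K) F" "\<And>F. F \<in> \<F> \<Longrightarrow> covering_order_le n F"
    "finite I" "\<And>i. i \<in> I \<Longrightarrow> openin (top_of_set K) (U i)" "K \<subseteq> (\<Union>i\<in>I. U i)"
  shows "\<exists>V. (\<forall>i\<in>I. openin (top_of_set K) (V i) \<and> V i \<subseteq> U i) \<and> K \<subseteq> (\<Union>i\<in>I. V i) \<and>
           (\<forall>x\<in>\<Union>\<F>. card {i\<in>I. x \<in> V i} \<le> n)"
  using assms(1-3)
proof (induction \<F> rule: finite_induct)
  case empty
  then show ?case using assms(5,6) by (intro exI[of _ U]) auto
next
  case (insert F \<F>)
  have "\<exists>V. (\<forall>i\<in>I. openin (top_of_set K) (V i) \<and> V i \<subseteq> U i) \<and> K \<subseteq> (\<Union>i\<in>I. V i) \<and>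
           (\<forall>x\<in>\<Union>\<F>. card {i\<in>I. x \<in> V i} \<le> n)"
    using insert.prems by (intro insert.IH) auto
  then obtain V where "\<forall>i\<in>I. openin (top_of_set K) (V i) \<and> V i \<subseteq> U i"
    and V3: "K \<subseteq> (\<Union>i\<in>I. V i)" and "\<forall>x\<in>\<Union>\<F>. card {i\<in>I. x \<in> V i} \<le> n"
    by (elim exE conjE)
  then have V: "\<And>i. i \<in> I \<Longrightarrow> openin (top_of_set K) (V i)" "\<And>i. i \<in> I \<Longrightarrow> V i \<subseteq> U i"
    "\<And>x. x\<in>\<Union>\<F> \<Longrightarrow> card {i\<in>I. x \<in> V i} \<le> n"
    by auto
  have FK: "F \<subseteq> K" using insert.prems(1) closedin_imp_subset by blast
  obtain W where W: "\<And>i. i \<in> I \<Longrightarrow> openin (top_of_set K) (W i)" "\<And>i. i \<in> I \<Longrightarrow> W i \<subseteq> V i"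
    "F \<subseteq> (\<Union>i\<in>I. W i)" "\<And>x. card {i\<in>I. x \<in> W i} \<le> n"
    using covering_order_le_extend[OF insert.prems(2)[OF insertI1] FK \<open>finite I\<close> V(1) order_trans[OF FK V3]]
    by blast
  define X where "X i = W i \<union> (V i - F)" for i
  have X: "X i \<subseteq> V i" if "i \<in> I" for i using W(2)[OF that] by (auto simp: X_def)
  have "openin (top_of_set K) (X i)" if "i \<in> I" for i
    unfolding X_def using W(1)[OF that] V(1)[OF that] insert.prems(1)[of F]
    by (intro openin_Un openin_diff) auto
  moreover have "K \<subseteq> (\<Union>i\<in>I. X i)" using V3 W(3) by (auto simp: X_def)
  moreover have "card {i \<in> I. x \<in> X i} \<le> n" if "x \<in> \<Union>(insert F \<F>)" for x
  proof (cases "x \<in> F")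
    case True
    then have "{i \<in> I. x \<in> X i} = {i \<in> I. x \<in> W i}" by (auto simp: X_def)
    then show ?thesis using W(4) by simp
  next
    case False
    then have "card {i \<in> I. x \<in> V i} \<le> n" using that V(3) by blast
    moreover have "card {i \<in> I. x \<in> X i} \<le> card {i \<in> I. x \<in> V i}"
      using X \<open>finite I\<close> by (intro card_mono) auto
    ultimately show ?thesis by simp
  qed
  moreover have "X i \<subseteq> U i" if "i \<in> I" for i using X[OF that] V(2)[OF that] by simp
  ultimately show ?case by (intro exI[of _ X]) simp
qed

lemma dim_le_neighbourhood:
  assumes "X dim_le n" "openin X V" "a \<in> V"
  shows "\<exists>U. a \<in> U \<and> U \<subseteq> V \<and> openin X U \<and> subtopology X (X frontier_of U) dim_le n - 1"
proof -
  have "\<forall>V a. openin X V \<longrightarrow> a \<in> V \<longrightarrow>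
      (\<exists>U. a \<in> U \<and> U \<subseteq> V \<and> openin X U \<and> subtopology X (X frontier_of U) dim_le n - 1)"
    using assms(1) by (subst (asm) dimension_le.simps) simp
  then show ?thesis using assms(2,3) by simp
qed

text \<open>
  For compact sets the small inductive dimension dominates the covering dimension. Finitely many small
  neighbourhoods \<open>G\<close> cover \<open>K\<close>. Their frontiers have smaller dimension, so by induction and the sum
  theorem the cover shrinks to order \<open>n\<close> near the union \<open>F\<close> of the frontiers. Off \<open>F\<close> the neighbourhoods
  cut \<open>K\<close> into disjoint open pieces \<open>H\<close>, each inside one member of the cover; adding them raises the order
  by one.
\<close>

theorem dim_le_imp_covering_order_le:
  fixes K :: "'a::metric_space set"
  assumes "compact K" "top_of_set K dim_le int n - 1"
  shows "covering_order_le n K"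
  using assms
proof (induction n arbitrary: K)
  case 0
  then have "topspace (top_of_set K) = {}" by (simp only: of_nat_0 diff_0 dimension_le_eq_empty) simp
  then have "K = {}" by simp
  then show ?case by (auto simp: covering_order_le_def)
next
  case (Suc n)
  show ?case unfolding covering_order_le_def
  proof (intro allI impI)
    fix I :: "nat set" and U
    assume "finite I" and U: "\<forall>i\<in>I. openin (top_of_set K) (U i)" and cov: "K \<subseteq> (\<Union>i\<in>I. U i)"
    have "\<exists>i G. i \<in> I \<and> x \<in> G \<and> G \<subseteq> U i \<and> openin (top_of_set K) G \<and>
        subtopology (top_of_set K) (top_of_set K frontier_of G) dim_le int n - 1" if "x \<in> K" for x
    proof -
      obtain i where i: "i \<in> I" "x \<in> U i" using cov \<open>x \<in> K\<close> by blast
      then obtain G where "x \<in> G" "G \<subseteq> U i" "openin (top_of_set K) G"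
          "subtopology (top_of_set K) (top_of_set K frontier_of G) dim_le int (Suc n) - 1 - 1"
        using dim_le_neighbourhood[OF Suc.prems(2)] U by blast
      then show ?thesis
        using i by auto
    qed
    then obtain i G where G: "\<And>x. x \<in> K \<Longrightarrow> i x \<in> I" "\<And>x. x \<in> K \<Longrightarrow> x \<in> G x"
       "\<And>x. x \<in> K \<Longrightarrow> G x \<subseteq> U (i x)" "\<And>x. x \<in> K \<Longrightarrow> openin (top_of_set K) (G x)"
       "\<And>x. x \<in> K \<Longrightarrow> subtopology (top_of_set K) (top_of_set K frontier_of G x) dim_le int n - 1"
      by metis
    have "\<exists>D. finite D \<and> D \<subseteq> G ` K \<and> K \<subseteq> \<Union>D"
      using \<open>compact K\<close>[unfolded compact_eq_openin_cover, rule_format, of "G ` K"] G(2,4) by blast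
    then obtain D where D: "finite D" "D \<subseteq> K" "K \<subseteq> (\<Union>x\<in>D. G x)"
      by (metis finite_subset_image)
    obtain p and k :: nat where p: "D = p ` {..<k}"
      using \<open>finite D\<close> by (metis finite_conv_nat_seg_image lessThan_def)
    have pK: "p l \<in> K" if "l < k" for l using that p D(2) by auto
    define B where "B l = top_of_set K frontier_of G (p l)" for l
    have clB: "closedin (top_of_set K) (B l)" for l by (simp add: B_def closedin_frontier_of)
    have ordB: "covering_order_le n (B l)" if "l < k" for l
    proof (rule Suc.IH)
      show "compact (B l)" using clB \<open>compact K\<close> closedin_compact by blast
      show "top_of_set (B l) dim_le int n - 1"
        using G(5)[OF pK[OF that]] clB[of l] closedin_imp_subset
        unfolding B_def by (metis inf.absorb_iff2 subtopology_subtopology)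
    qed
    define F where "F = (\<Union>l<k. B l)"
    have FK: "F \<subseteq> K" using clB by (auto simp: F_def dest: closedin_imp_subset)
    have ordF: "covering_order_le n F"
      unfolding covering_order_le_def
    proof (intro allI impI)
      fix I :: "nat set" and U
      assume "finite I" "\<forall>i\<in>I. openin (top_of_set F) (U i)" "F \<subseteq> (\<Union>i\<in>I. U i)"
      moreover have "closedin (top_of_set F) (B l)" if "l < k" for l
        using clB[of l] FK that by (auto simp: F_def intro: closedin_subset_trans)
      ultimately show "\<exists>V. (\<forall>i\<in>I. openin (top_of_set F) (V i) \<and> V i \<subseteq> U i) \<and> F \<subseteq> (\<Union>i\<in>I. V i) \<and>
           (\<forall>x\<in>F. card {i\<in>I. x \<in> V i} \<le> n)"
        using covering_order_le_Union[of "B ` {..<k}" F n I U] ordB unfolding F_def by blast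
    qed
    obtain W where W: "\<And>i. i \<in> I \<Longrightarrow> openin (top_of_set K) (W i)" "\<And>i. i \<in> I \<Longrightarrow> W i \<subseteq> U i"
      "F \<subseteq> (\<Union>i\<in>I. W i)" "\<And>x. card {i\<in>I. x \<in> W i} \<le> n"
      using covering_order_le_extend[OF ordF FK \<open>finite I\<close> bspec[OF U] order_trans[OF FK cov]] by blast
    define H where "H l = G (p l) - (\<Union>l'<l. top_of_set K closure_of G (p l'))" for l
    have H_open: "openin (top_of_set K) (H l)" if "l < k" for l
      unfolding H_def using G(4)[OF pK[OF that]] by (intro openin_diff closedin_Union) auto
    have H_cover: "\<exists>l<k. x \<in> H l" if "x \<in> K" "x \<notin> F" for x
    proof -
      have ex: "\<exists>l. l < k \<and> x \<in> G (p l)" using D(3) p that(1) by auto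
      define l where "l = (LEAST l. l < k \<and> x \<in> G (p l))"
      have l: "l < k" "x \<in> G (p l)" using LeastI_ex[OF ex] by (auto simp: l_def)
      have "x \<notin> top_of_set K closure_of G (p l')" if "l' < l" for l'
      proof
        assume "x \<in> top_of_set K closure_of G (p l')"
        moreover have "x \<notin> B l'" using \<open>x \<notin> F\<close> that l(1) by (auto simp: F_def)
        ultimately have "x \<in> top_of_set K interior_of G (p l')"
          by (simp add: B_def frontier_of_def)
        then have "x \<in> G (p l')" by (rule subsetD[OF interior_of_subset])
        moreover have "\<not> (l' < k \<and> x \<in> G (p l'))"
          using that unfolding l_def by (rule not_less_Least)
        ultimately show False using that l(1) by linarith
      qed
      then show ?thesis using l by (auto simp: H_def)
    qed
    have H_disj: "l = l'" if "x \<in> H l" "x \<in> H l'" "l < k" "l' < k" for x l l'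
    proof -
      have sub: "H l \<subseteq> top_of_set K closure_of G (p l)" if "l < k" for l
        using closure_of_subset[of "G (p l)" "top_of_set K"] openin_subset[OF G(4)[OF pK[OF that]]]
        by (auto simp: H_def)
      show ?thesis
        using that sub[of l] sub[of l'] by (cases l l' rule: linorder_cases) (auto simp: H_def)
    qed
    define V where "V j = W j \<union> (\<Union>l\<in>{l. l < k \<and> i (p l) = j}. H l)" for j
    show "\<exists>V. (\<forall>i\<in>I. openin (top_of_set K) (V i) \<and> V i \<subseteq> U i) \<and> K \<subseteq> (\<Union>i\<in>I. V i) \<and>
           (\<forall>x\<in>K. card {i\<in>I. x \<in> V i} \<le> Suc n)"
    proof (intro exI[of _ V] conjI ballI)
      fix j assume "j \<in> I"
      then show "openin (top_of_set K) (V j)"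
        unfolding V_def using W(1) H_open by (intro openin_Un openin_Union) auto
      have "H l \<subseteq> U j" if "l < k" "i (p l) = j" for l
        using G(3)[OF pK[OF that(1)]] that(2) by (auto simp: H_def)
      then show "V j \<subseteq> U j" using W(2)[OF \<open>j \<in> I\<close>] by (auto simp: V_def)
    next
      show "K \<subseteq> (\<Union>i\<in>I. V i)"
      proof
        fix x assume "x \<in> K"
        show "x \<in> (\<Union>i\<in>I. V i)"
        proof (cases "x \<in> F")
          case True
          then show ?thesis using W(3) by (auto simp: V_def)
        next
          case False
          then obtain l where "l < k" "x \<in> H l" using H_cover \<open>x \<in> K\<close> by blast
          then show ?thesis using G(1)[OF pK[of l]] by (auto simp: V_def)
        qed
      qed
    next
      fix x assume "x \<in> K"
      obtain l0 where l0: "\<And>l. l < k \<Longrightarrow> x \<in> H l \<Longrightarrow> l = l0"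
        using H_disj by metis
      have "{i \<in> I. x \<in> V i} \<subseteq> insert (i (p l0)) {i \<in> I. x \<in> W i}"
        using l0 by (auto simp: V_def)
      then have "card {i \<in> I. x \<in> V i} \<le> card (insert (i (p l0)) {i \<in> I. x \<in> W i})"
        using \<open>finite I\<close> by (intro card_mono) auto
      also have "\<dots> \<le> Suc (card {i \<in> I. x \<in> W i})" by (rule card_insert_le_m1) auto
      finally show "card {i \<in> I. x \<in> V i} \<le> Suc n" using W(4)[of x] by simp
    qed
  qed
qed

section \<open>A simplex has full inductive dimension\<close>

text \<open>
  Cover the simplex by the complements of its facets and suppose that a shrinking \<open>V\<close> has no point
  common to all \<open>V i\<close>. A partition of unity subordinate to \<open>V\<close>, with the vertices permuted cyclically by
  \<open>\<sigma>\<close>, defines a self-map \<open>f\<close> of the simplex. At a fixed point \<open>x\<close>, if \<open>x\<close> is not in \<open>V i\<close> then the weight of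
  the vertex \<open>h (\<sigma> i)\<close> in \<open>x = f x\<close> vanishes, so \<open>x\<close> is on the facet opposite to it and not in \<open>V (\<sigma> i)\<close>.
  Going round the cycle, \<open>x\<close> is in none or in all of the sets, and both are impossible.
\<close>

theorem simplex_not_dim_le:
  fixes C :: "'a::euclidean_space set"
  assumes indep: "\<not> affine_dependent C" and card: "card C = Suc m"
  shows "\<not> top_of_set (convex hull C) dim_le int m - 1"
proof
  define Q where "Q = convex hull C"
  assume "top_of_set (convex hull C) dim_le int m - 1"
  have "finite C" using card card.infinite by fastforce
  have Q: "compact Q" "convex Q" "Q \<noteq> {}"
    using \<open>finite C\<close> card by (auto simp: Q_def finite_imp_compact_convex_hull)
  have ord: "covering_order_le m Q"
    using dim_le_imp_covering_order_le[OF Q(1)] \<open>top_of_set (convex hull C) dim_le _\<close>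
    by (simp add: Q_def)
  obtain h where h: "bij_betw h {..<Suc m} C"
    using \<open>finite C\<close> card by (metis atLeast0LessThan ex_bij_betw_nat_finite)
  then have hC: "h i \<in> C" if "i < Suc m" for i using that by (auto simp: bij_betw_def)
  define \<sigma> where "\<sigma> i = (if i = m then 0 else Suc i)" for i
  have \<sigma>: "\<sigma> i < Suc m" if "i < Suc m" for i using that by (auto simp: \<sigma>_def)
  define face where "face i = convex hull (C - {h i})" for i
  have cl_face: "closed (face i)" for i
    using \<open>finite C\<close> by (simp add: face_def compact_imp_closed finite_imp_compact_convex_hull)
  define U where "U i = Q - face i" for i
  have opU: "openin (top_of_set Q) (U i)" if "i \<in> {..<Suc m}" for i
    unfolding U_def by (metis Diff_eq cl_face open_Compl openin_open_Int)
  have covU: "Q \<subseteq> (\<Union>i\<in>{..<Suc m}. U i)"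
  proof
    fix x assume "x \<in> Q"
    have "\<exists>i<Suc m. x \<notin> face i"
    proof (rule ccontr)
      assume "\<not> ?thesis"
      then have "x \<in> convex hull (C - {c})" if "c \<in> C" for c
        using that h by (auto simp: face_def bij_betw_def)
      then have "x \<in> \<Inter> ((hull) convex ` (\<lambda>c. C - {c}) ` C)" by auto
      also have "\<dots> = convex hull (\<Inter> ((\<lambda>c. C - {c}) ` C))"
        using convex_hull_Inter[of "(\<lambda>c. C - {c}) ` C"] affine_independent_subset[OF indep, of "\<Union>((\<lambda>c. C - {c}) ` C)"]
        by auto
      also have "\<Inter> ((\<lambda>c. C - {c}) ` C) = {}" using card by auto
      finally show False by simp
    qed
    then show "x \<in> (\<Union>i\<in>{..<Suc m}. U i)" using \<open>x \<in> Q\<close> by (auto simp: U_def)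
  qed
  obtain V where V: "\<And>i. i \<in> {..<Suc m} \<Longrightarrow> openin (top_of_set Q) (V i)"
      "\<And>i. i \<in> {..<Suc m} \<Longrightarrow> V i \<subseteq> U i" "Q \<subseteq> (\<Union>i\<in>{..<Suc m}. V i)"
      "\<And>x. x \<in> Q \<Longrightarrow> card {i\<in>{..<Suc m}. x \<in> V i} \<le> m"
    using covering_order_leD[OF ord finite_lessThan opU covU] by blast
  \<comment> \<open>The distance to the empty set is 0, hence the separate case.\<close>
  define g where "g i x = (if V i = Q then 1 else infdist x (Q - V i))" for i x
  have g0: "g i x \<ge> 0" for i x by (simp add: g_def infdist_nonneg)
  have clV: "closed (Q - V i)" if "i < Suc m" for i
    using V(1)[of i] that Q(1)
    by (metis closedin_closed_trans closedin_diff closedin_topspace compact_imp_closed lessThan_iff topspace_euclidean_subtopology)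
  have g_pos: "g i x > 0 \<longleftrightarrow> x \<in> V i" if "x \<in> Q" "i < Suc m" for i x
  proof (cases "V i = Q")
    case False
    then have "Q - V i \<noteq> {}"
      using V(2)[of i] that(2) by (auto simp: U_def)
    from in_closed_iff_infdist_zero[OF clV[OF that(2)] this]
    have "x \<in> Q - V i \<longleftrightarrow> infdist x (Q - V i) = 0" by blast
    then show ?thesis using False that(1) infdist_nonneg[of x "Q - V i"]
      by (auto simp: g_def less_le)
  qed (use that in \<open>simp add: g_def\<close>)
  have g_cont: "continuous_on Q (g i)" for i
    unfolding g_def by (cases "V i = Q") (auto intro!: continuous_intros)
  define G where "G x = (\<Sum>i<Suc m. g i x)" for x
  have G_pos: "G x > 0" if x: "x \<in> Q" for x
  proof -
    obtain i where "i < Suc m" "x \<in> V i" using V(3) x by auto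
    then show ?thesis
      using g_pos[OF x] g0 unfolding G_def by (metis finite_lessThan lessThan_iff sum_pos2)
  qed
  define f where "f x = (\<Sum>i<Suc m. (g i x / G x) *\<^sub>R h (\<sigma> i))" for x
  have f_hull: "f x \<in> convex hull T" if x: "x \<in> Q" and T: "\<And>i. i < Suc m \<Longrightarrow> x \<in> V i \<Longrightarrow> h (\<sigma> i) \<in> T" for x T
  proof -
    have f_eq: "f x = (\<Sum>i\<in>{i\<in>{..<Suc m}. x \<in> V i}. (g i x / G x) *\<^sub>R h (\<sigma> i))"
      unfolding f_def using g_pos[OF x] g0[of _ x]
      by (intro sum.mono_neutral_right) (auto simp: less_le)
    have "(\<Sum>i\<in>{i\<in>{..<Suc m}. x \<in> V i}. g i x / G x) = (\<Sum>i<Suc m. g i x / G x)"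
      using g_pos[OF x] g0[of _ x]
      by (intro sum.mono_neutral_left) (auto simp: less_le)
    also have "\<dots> = G x / G x" by (simp only: G_def sum_divide_distrib)
    finally have sum_1: "(\<Sum>i\<in>{i\<in>{..<Suc m}. x \<in> V i}. g i x / G x) = 1" using G_pos[OF x] by simp
    show ?thesis
      unfolding f_eq
    proof (rule convex_sum)
      show "0 \<le> g i x / G x" for i using g0 G_pos[OF x] by simp
      show "h (\<sigma> i) \<in> convex hull T" if "i \<in> {i\<in>{..<Suc m}. x \<in> V i}" for i
        using that by (intro hull_inc T) auto
    qed (use sum_1 in auto)
  qed
  have "f x \<in> Q" if "x \<in> Q" for x
    unfolding Q_def using f_hull[OF that] hC \<sigma> by auto
  moreover have "continuous_on Q f"
    unfolding f_def using g_cont G_pos unfolding G_def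
    by (intro continuous_intros) (auto simp: less_imp_neq[symmetric])
  ultimately obtain x where x: "x \<in> Q" "f x = x"
    using brouwer[OF Q, of f] by (metis Pi_I)
  have step: "x \<in> V (\<sigma> i) \<Longrightarrow> x \<in> V i" if "i < Suc m" for i
  proof (rule ccontr)
    assume "x \<in> V (\<sigma> i)" "x \<notin> V i"
    have "h (\<sigma> j) \<in> C - {h (\<sigma> i)}" if "j < Suc m" "x \<in> V j" for j
    proof -
      have "j \<noteq> i" using that \<open>x \<notin> V i\<close> by auto
      then have "\<sigma> j \<noteq> \<sigma> i" by (auto simp: \<sigma>_def)
      then have "h (\<sigma> j) \<noteq> h (\<sigma> i)"
        using h \<sigma>[OF that(1)] \<sigma>[OF \<open>i < Suc m\<close>] by (auto simp: bij_betw_def inj_on_def)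
      then show ?thesis using hC[OF \<sigma>[OF that(1)]] by simp
    qed
    then have "x \<in> face (\<sigma> i)" using f_hull[OF x(1), of "C - {h (\<sigma> i)}"] x(2) by (simp add: face_def)
    then show False using \<open>x \<in> V (\<sigma> i)\<close> V(2)[of "\<sigma> i"] \<sigma>[OF that] by (auto simp: U_def)
  qed
  obtain i where i: "i < Suc m" "x \<in> V i" using V(3) x(1) by auto
  have down: "x \<in> V j" if "j \<le> k" "k < Suc m" "x \<in> V k" for j k
    using that
  proof (induction "k - j" arbitrary: j)
    case (Suc l)
    then have "x \<in> V (Suc j)" by auto
    then show ?case using step[of j] Suc by (auto simp: \<sigma>_def split: if_splits)
  qed simp
  have "x \<in> V 0" using down[of 0 i] i by simp
  then have "x \<in> V m" using step[of m] by (simp add: \<sigma>_def)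
  then have "{i\<in>{..<Suc m}. x \<in> V i} = {..<Suc m}" using down[of _ m] by auto
  then show False using V(4)[OF x(1)] by simp
qed

section \<open>Dimension of sets of lines\<close>

lemma frontier_of_subset_diff:
  assumes "openin X U" "closedin X C" "U \<subseteq> C"
  shows "X frontier_of U \<subseteq> C - U"
  unfolding frontier_of_def interior_of_openin[OF assms(1)]
  using closure_of_minimal[OF assms(3,2)] by blast

text \<open>
  A small ball around a point of a sphere cuts the sphere in a sphere of one dimension less, since the
  intersection of two spheres lies in a hyperplane. The centre \<open>a\<close> is required to lie in \<open>T\<close> so that an
  affine space of dimension 0 meets the sphere in the empty set.
\<close>

lemma sphere_Int_affine_dim_le:
  fixes a :: "'a::euclidean_space"
  assumes "affine T" "a \<in> T" "r > 0" "aff_dim T \<le> int m"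
  shows "top_of_set (sphere a r \<inter> T) dim_le int m - 1"
  using assms
proof (induction m arbitrary: a r T)
  case 0
  then have "aff_dim T = 0"
    using aff_dim_subset[of "{a}" T] by simp
  then have "T = {a}"
    using 0 by (auto simp: aff_dim_eq_0)
  then have "sphere a r \<inter> T = {}" using 0 by auto
  then show ?case by simp
next
  case (Suc m)
  have "\<exists>U. p \<in> U \<and> U \<subseteq> V \<and> open U \<and>
      top_of_set (top_of_set (sphere a r \<inter> T) frontier_of (sphere a r \<inter> T \<inter> U)) dim_le int m - 1"
    if V: "open V" "p \<in> V" "p \<in> sphere a r \<inter> T" for V p
  proof -
    obtain e0 where e0: "e0 > 0" "ball p e0 \<subseteq> V" using V openE by blast
    define e where "e = min e0 (r / 2)"
    have e: "0 < e" "e < r" "ball p e \<subseteq> V" using e0 Suc.prems by (auto simp: e_def)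
    have "norm (p - a) = r" "p \<in> T"
      using V(3) by (auto simp: dist_norm norm_minus_commute)
    then have pa: "(p - a) \<bullet> (p - a) = r\<^sup>2" "p \<in> T"
      by (simp_all only: dot_square_norm)
    \<comment> \<open>\<open>a'\<close> is the foot of the perpendicular from \<open>a\<close> to the hyperplane \<open>H\<close> that contains the
      intersection of the two spheres\<close>
    define l where "l = 1 - e\<^sup>2 / (2 * r\<^sup>2)"
    have e2: "e\<^sup>2 < r\<^sup>2" using e by (simp add: power_strict_mono)
    have r2: "r\<^sup>2 > 0" using Suc.prems by simp
    have "e\<^sup>2 < 2 * r\<^sup>2" using e2 r2 by linarith
    then have l: "0 < l" "l < 1" "l * r\<^sup>2 = r\<^sup>2 - e\<^sup>2 / 2"
      using e r2 by (auto simp: l_def field_simps)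
    define a' where "a' = a + l *\<^sub>R (p - a)"
    define r' where "r' = r * sqrt (1 - l\<^sup>2)"
    define H where "H = {x. (p - a) \<bullet> x = (p - a) \<bullet> a + l * r\<^sup>2}"
    have l2: "l\<^sup>2 < 1" using l by (simp add: power_less_one_iff)
    have "r' > 0" using l2 Suc.prems by (simp add: r'_def)
    have affTH: "affine (T \<inter> H)"
      unfolding H_def using Suc.prems affine_hyperplane by (intro affine_Int) auto
    have "a' \<in> T"
      using mem_affine[OF Suc.prems(1) \<open>p \<in> T\<close> Suc.prems(2), of l "1 - l"]
      by (simp add: a'_def algebra_simps)
    moreover have "a' \<in> H" using pa by (simp add: H_def a'_def inner_add_right)
    moreover have "l * r\<^sup>2 \<noteq> 0" using l(1) r2 by simp
    then have "a \<notin> H" unfolding H_def by simp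
    then have "T \<inter> H \<subset> T" using Suc.prems by auto
    then have "aff_dim (T \<inter> H) < aff_dim T"
      using affTH Suc.prems(1) by (intro aff_dim_psubset) (simp add: affine_hull_eq[THEN iffD2])
    ultimately have IH: "top_of_set (sphere a' r' \<inter> (T \<inter> H)) dim_le int m - 1"
      using Suc.prems(4) affTH \<open>r' > 0\<close> by (intro Suc.IH) auto
    have "sphere a r \<inter> T \<inter> sphere p e \<subseteq> sphere a' r' \<inter> (T \<inter> H)"
    proof
      fix x assume x: "x \<in> sphere a r \<inter> T \<inter> sphere p e"
      define u v where "u = x - a" and "v = p - a"
      have "norm u = r" "norm (u - v) = e" and vv: "v \<bullet> v = r\<^sup>2"
        using x pa by (auto simp: u_def v_def dist_norm norm_minus_commute)
      then have uu: "u \<bullet> u = r\<^sup>2" and "(u - v) \<bullet> (u - v) = e\<^sup>2"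
        by (simp_all only: dot_square_norm)
      then have uv: "u \<bullet> v = l * r\<^sup>2"
        using vv by (simp add: inner_diff inner_commute l(3))
      have "(u - l *\<^sub>R v) \<bullet> (u - l *\<^sub>R v) = r\<^sup>2 * (1 - l\<^sup>2)"
        using uu vv uv by (simp add: inner_diff inner_commute algebra_simps power2_eq_square)
      also have "\<dots> = r'\<^sup>2" using l2 by (simp add: r'_def power_mult_distrib)
      finally have "norm (u - l *\<^sub>R v) = r'"
        using \<open>r' > 0\<close> by (simp add: norm_eq_sqrt_inner)
      then have "x \<in> sphere a' r'"
        by (simp add: a'_def u_def v_def dist_norm norm_minus_commute algebra_simps)
      moreover have "x \<in> H"
        using uv by (simp add: H_def u_def v_def inner_diff_left inner_diff_right inner_commute algebra_simps)
      ultimately show "x \<in> sphere a' r' \<inter> (T \<inter> H)" using x by simp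
    qed
    moreover have "top_of_set (sphere a r \<inter> T) frontier_of (sphere a r \<inter> T \<inter> ball p e)
        \<subseteq> (sphere a r \<inter> T \<inter> cball p e) - (sphere a r \<inter> T \<inter> ball p e)"
      by (intro frontier_of_subset_diff openin_open_Int closedin_closed_Int) auto
    ultimately have "top_of_set (sphere a r \<inter> T) frontier_of (sphere a r \<inter> T \<inter> ball p e)
        \<subseteq> sphere a' r' \<inter> (T \<inter> H)"
      by (force simp: subset_iff)
    then have "top_of_set (top_of_set (sphere a r \<inter> T) frontier_of (sphere a r \<inter> T \<inter> ball p e))
        dim_le int m - 1"
      using IH dimension_le_subtopologies by blast
    then show ?thesis using e by (intro exI[of _ "ball p e"]) auto
  qed
  then show ?case by (subst dimension_le_eq_subtopology) auto
qed

lemma proj_eq_iff: "proj x = proj y \<longleftrightarrow> (\<exists>c. c \<noteq> 0 \<and> y = c *\<^sub>R x)"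
proof
  assume "proj x = proj y"
  moreover have "y \<in> proj y" by (auto simp: proj_def intro: exI[of _ 1])
  ultimately have "y \<in> proj x" by simp
  then show "\<exists>c. c \<noteq> 0 \<and> y = c *\<^sub>R x" by (auto simp: proj_def)
next
  assume "\<exists>c. c \<noteq> 0 \<and> y = c *\<^sub>R x"
  then obtain c where c: "c \<noteq> 0" "y = c *\<^sub>R x" by blast
  have "\<exists>b'. b *\<^sub>R x = b' *\<^sub>R y \<and> b' \<noteq> 0" if "b \<noteq> 0" for b
    using c that by (intro exI[of _ "b / c"]) simp
  moreover have "\<exists>b'. b *\<^sub>R y = b' *\<^sub>R x \<and> b' \<noteq> 0" if "b \<noteq> 0" for b
    using c that by (intro exI[of _ "b * c"]) simp
  ultimately show "proj x = proj y" unfolding proj_def by blast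
qed

lemma proj_scaleR: "c \<noteq> 0 \<Longrightarrow> proj (c *\<^sub>R x) = proj x"
  unfolding proj_eq_iff by (intro exI[of _ "1 / c"]) simp

lemma continuous_map_proj: "continuous_map (top_of_set (- {0})) proj_topology proj"
  by (rule quotient_imp_continuous_map[OF quotient_map_proj])

text \<open>
  The sets \<open>Z\<close> described here are the saturated open sets of the quotient map \<open>proj\<close>.
\<close>

lemma openin_proj_image:
  fixes Z :: "'a::euclidean_space set"
  assumes "open Z" "0 \<notin> Z" "\<And>c y. c \<noteq> 0 \<Longrightarrow> y \<in> Z \<Longrightarrow> c *\<^sub>R y \<in> Z"
  shows "openin proj_topology (proj ` Z)"
proof -
  have "{x. x \<noteq> 0 \<and> proj x \<in> proj ` Z} = Z"
  proof (intro equalityI subsetI)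
    fix x assume "x \<in> {x. x \<noteq> 0 \<and> proj x \<in> proj ` Z}"
    then obtain z where "z \<in> Z" "proj z = proj x" by force
    then show "x \<in> Z" using assms(3) by (auto simp: proj_eq_iff)
  qed (use assms(2) in auto)
  then show ?thesis using assms(1,2) by (auto simp: openin_proj_topology proj_set_def)
qed

lemma homeomorphic_space_proj_image:
  fixes K :: "'a::euclidean_space set"
  assumes "compact K" "0 \<notin> K" "inj_on proj K" "Hausdorff_space (proj_topology :: 'a set topology)"
  shows "top_of_set K homeomorphic_space subtopology proj_topology (proj ` K)"
proof -
  have "continuous_map (top_of_set K) (subtopology proj_topology (proj ` K)) proj"
    using continuous_map_proj assms(2)
    by (auto simp: continuous_map_in_subtopology intro: continuous_map_from_subtopology_mono)
  moreover have "topspace (subtopology proj_topology (proj ` K)) = proj ` K"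
    using assms(2) by (auto simp: topspace_proj_topology proj_set_def)
  ultimately have "homeomorphic_map (top_of_set K) (subtopology proj_topology (proj ` K)) proj"
    using assms by (intro continuous_imp_homeomorphic_map) (auto simp: compact_space_subtopology Hausdorff_space_subtopology)
  then show ?thesis using homeomorphic_map_imp_homeomorphic_space by blast
qed

text \<open>
  Every point has small neighbourhoods that are balls in an affine chart, with frontier homeomorphic to a
  sphere in an affine space of dimension at most \<open>m\<close>.
\<close>

lemma proj_subspace_dim_le:
  fixes W :: "'a::euclidean_space set"
  assumes haus: "Hausdorff_space (proj_topology :: 'a set topology)"
    and W: "subspace W" "dim W \<le> Suc m"
  shows "subtopology proj_topology (proj_set W) dim_le int m"
proof -
  have "\<exists>U. p \<in> U \<and> U \<subseteq> V \<and> openin proj_topology U \<and>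
      subtopology proj_topology (subtopology proj_topology (proj_set W) frontier_of (proj_set W \<inter> U)) dim_le int m - 1"
    if V: "openin proj_topology V" "p \<in> V" "p \<in> proj_set W" for V p
  proof -
    obtain y0 where y0: "y0 \<in> W" "y0 \<noteq> 0" "p = proj y0" using V(3) by (auto simp: proj_set_def)
    define e where "e = (1 / norm y0) *\<^sub>R y0"
    have e: "e \<in> W" "norm e = 1" "p = proj e" "e \<noteq> 0"
      using y0 W(1) by (auto simp: e_def subspace_scale proj_scaleR)
    then have ee: "e \<bullet> e = 1" by (simp add: norm_eq_1)
    have "open {x. x \<noteq> 0 \<and> proj x \<in> V}" "e \<in> {x. x \<noteq> 0 \<and> proj x \<in> V}"
      using V e by (auto simp: openin_proj_topology)
    then obtain \<epsilon> where \<epsilon>: "\<epsilon> > 0" "ball e \<epsilon> \<subseteq> {x. x \<noteq> 0 \<and> proj x \<in> V}"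
      using openE by blast
    \<comment> \<open>The sign of \<open>f\<close> is constant on lines. In the affine chart \<open>y \<bullet> e = 1\<close> centred at \<open>e\<close>,
      \<open>f\<close> is negative on the ball of radius \<open>\<epsilon>\<close> and zero on its bounding sphere.\<close>
    define f where "f y = norm (y - (y \<bullet> e) *\<^sub>R e) - \<epsilon> * \<bar>y \<bullet> e\<bar>" for y
    have f_scale: "f (c *\<^sub>R y) = \<bar>c\<bar> * f y" for c y
    proof -
      have "c *\<^sub>R y - ((c *\<^sub>R y) \<bullet> e) *\<^sub>R e = c *\<^sub>R (y - (y \<bullet> e) *\<^sub>R e)"
        by (simp add: scaleR_diff_right)
      then show ?thesis by (simp add: f_def abs_mult right_diff_distrib)
    qed
    have f_cont: "continuous_on UNIV f" unfolding f_def by (intro continuous_intros)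
    have f0: "f 0 = 0" by (simp add: f_def)
    define Z where "Z = {y. f y < 0}"
    define C where "C = {y. f y > 0}"
    have opZ: "openin proj_topology (proj ` Z)"
    proof (rule openin_proj_image)
      show "open Z" unfolding Z_def using f_cont by (intro open_Collect_less) auto
    qed (auto simp: Z_def f0 f_scale mult_pos_neg)
    have opC: "openin proj_topology (proj ` C)"
    proof (rule openin_proj_image)
      show "open C" unfolding C_def using f_cont by (intro open_Collect_less) auto
    qed (auto simp: C_def f0 f_scale)
    have sgn_f: "proj x = proj y \<Longrightarrow> (f x < 0 \<longleftrightarrow> f y < 0) \<and> (f x > 0 \<longleftrightarrow> f y > 0)" for x y
      by (auto simp: proj_eq_iff f_scale zero_less_mult_iff mult_less_0_iff)
    have normalise: "w \<bullet> e \<noteq> 0 \<and> norm ((1 / (w \<bullet> e)) *\<^sub>R w - e) = norm (w - (w \<bullet> e) *\<^sub>R e) / \<bar>w \<bullet> e\<bar>"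
      if "w \<noteq> 0" "f w \<le> 0" for w
    proof -
      have ne: "w \<bullet> e \<noteq> 0" using that by (auto simp: f_def)
      then have "(1 / (w \<bullet> e)) *\<^sub>R w - e = (1 / (w \<bullet> e)) *\<^sub>R (w - (w \<bullet> e) *\<^sub>R e)"
        by (simp add: scaleR_diff_right)
      then show ?thesis using ne by simp
    qed
    have ZV: "proj ` Z \<subseteq> V"
    proof
      fix q assume "q \<in> proj ` Z"
      then obtain y where y: "q = proj y" "f y < 0" by (auto simp: Z_def)
      then have "y \<noteq> 0" using f0 by auto
      note n = normalise[OF this]
      have "norm ((1 / (y \<bullet> e)) *\<^sub>R y - e) < \<epsilon>"
        using n y by (simp add: f_def divide_less_eq)
      then have "(1 / (y \<bullet> e)) *\<^sub>R y \<in> ball e \<epsilon>" by (simp add: dist_norm norm_minus_commute)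
      then have "proj ((1 / (y \<bullet> e)) *\<^sub>R y) \<in> V" using \<epsilon> by blast
      then show "q \<in> V" using n y by (simp add: proj_scaleR)
    qed
    define T where "T = {y \<in> W. y \<bullet> e = 1}"
    have T_eq: "T = W \<inter> {y. e \<bullet> y = 1}" by (auto simp: T_def inner_commute)
    have affT: "affine T" unfolding T_eq
      using W(1) by (intro affine_Int subspace_imp_affine affine_hyperplane)
    have "0 \<in> W - T" using subspace_0[OF W(1)] by (simp add: T_def)
    moreover have "T \<subseteq> W" by (auto simp: T_def)
    ultimately have "T \<subset> W" by blast
    then have "aff_dim T < aff_dim W"
      using affT W(1) by (intro aff_dim_psubset) (simp add: affine_hull_eq[THEN iffD2] subspace_imp_affine)
    then have "aff_dim T \<le> int m" using W aff_dim_subspace[OF W(1)] by simp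
    then have dimS: "top_of_set (sphere e \<epsilon> \<inter> T) dim_le int m - 1"
      using affT e ee \<epsilon> by (intro sphere_Int_affine_dim_le) (auto simp: T_def)
    have "closed T" unfolding T_eq using W(1) closed_subspace closed_hyperplane by blast
    moreover have "inj_on proj (sphere e \<epsilon> \<inter> T)"
      by (auto simp: inj_on_def T_def proj_eq_iff)
    ultimately have "top_of_set (sphere e \<epsilon> \<inter> T) homeomorphic_space
        subtopology proj_topology (proj ` (sphere e \<epsilon> \<inter> T))"
      using haus by (intro homeomorphic_space_proj_image) (auto simp: T_def compact_Int_closed)
    then have dimP: "subtopology proj_topology (proj ` (sphere e \<epsilon> \<inter> T)) dim_le int m - 1"
      using dimS homeomorphic_space_dimension_le by blast
    have "subtopology proj_topology (proj_set W) frontier_of (proj_set W \<inter> proj ` Z)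
        \<subseteq> (proj_set W \<inter> (topspace proj_topology - proj ` C)) - (proj_set W \<inter> proj ` Z)"
    proof (rule frontier_of_subset_diff)
      show "proj_set W \<inter> proj ` Z \<subseteq> proj_set W \<inter> (topspace proj_topology - proj ` C)"
      proof
        fix q assume q: "q \<in> proj_set W \<inter> proj ` Z"
        then obtain z where z: "q = proj z" "f z < 0" by (auto simp: Z_def)
        have "q \<notin> proj ` C"
        proof
          assume "q \<in> proj ` C"
          then obtain c where "q = proj c" "f c > 0" by (auto simp: C_def)
          then show False using sgn_f[of z c] z by simp
        qed
        then show "q \<in> proj_set W \<inter> (topspace proj_topology - proj ` C)"
          using q openin_subset[OF opZ] by blast
      qed
    qed (use opZ opC in \<open>auto intro!: openin_subtopology_Int2 closedin_subtopology_Int_closed\<close>)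
    also have "\<dots> \<subseteq> proj ` (sphere e \<epsilon> \<inter> T)"
    proof
      fix q assume q: "q \<in> (proj_set W \<inter> (topspace proj_topology - proj ` C)) - (proj_set W \<inter> proj ` Z)"
      then obtain w where w: "w \<in> W" "w \<noteq> 0" "q = proj w" by (auto simp: proj_set_def)
      then have "w \<notin> C" "w \<notin> Z" using q by blast+
      then have "f w = 0" by (simp add: C_def Z_def)
      note n = normalise[OF w(2)]
      define v where "v = (1 / (w \<bullet> e)) *\<^sub>R w"
      have "norm (v - e) = \<epsilon>" using n \<open>f w = 0\<close> by (simp add: f_def v_def)
      moreover have "v \<in> T" using n \<open>f w = 0\<close> w W(1) by (simp add: T_def v_def subspace_scale)
      moreover have "q = proj v" using n \<open>f w = 0\<close> w by (simp add: v_def proj_scaleR)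
      ultimately show "q \<in> proj ` (sphere e \<epsilon> \<inter> T)" by (auto simp: dist_norm norm_minus_commute)
    qed
    finally have "subtopology proj_topology (subtopology proj_topology (proj_set W) frontier_of (proj_set W \<inter> proj ` Z)) dim_le int m - 1"
      using dimP dimension_le_subtopologies by blast
    moreover have "p \<in> proj ` Z" using e ee \<epsilon> by (auto simp: Z_def f_def)
    ultimately show ?thesis using opZ ZV by (intro exI[of _ "proj ` Z"]) simp
  qed
  then show ?thesis by (subst dimension_le_eq_subtopology) auto
qed

text \<open>
  The affine space \<open>y0 + L\<close> avoids the origin and meets each line through the origin at most once, so a
  simplex in it is embedded by \<open>proj\<close>.
\<close>

lemma proj_affine_not_dim_le:
  fixes L :: "'a::euclidean_space set"
  assumes haus: "Hausdorff_space (proj_topology :: 'a set topology)"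
    and L: "subspace L" "y0 \<notin> L" and sub: "proj ` ((+) y0 ` L) \<subseteq> S"
  shows "\<not> subtopology proj_topology S dim_le int (dim L) - 1"
proof
  assume dimS: "subtopology proj_topology S dim_le int (dim L) - 1"
  obtain B where B: "B \<subseteq> L" "independent B" "L \<subseteq> span B" "card B = dim L"
    using basis_exists by blast
  define C where "C = insert y0 ((+) y0 ` B)"
  have "finite B" using B(2) independent_bound by blast
  have "0 \<notin> B" using B(2) dependent_zero by blast
  then have ni: "y0 \<notin> (+) y0 ` B" by auto
  have "(\<lambda>x. - y0 + x) ` (+) y0 ` B = B" by (auto simp: image_image)
  then have indep: "\<not> affine_dependent C"
    using affine_dependent_iff_dependent[OF ni] B(2) by (simp add: C_def)
  have "card C = Suc (dim L)"
    using ni \<open>finite B\<close> B(4) by (simp add: C_def card_image)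
  have affL: "affine ((+) y0 ` L)" using L(1) subspace_imp_affine affine_translation by blast
  have "C \<subseteq> (+) y0 ` L" using B(1) subspace_0[OF L(1)] by (auto simp: C_def image_iff)
  then have hull: "convex hull C \<subseteq> (+) y0 ` L"
    using affL by (intro hull_minimal affine_imp_convex)
  have L0: "0 \<notin> (+) y0 ` L"
    using L subspace_neg[OF L(1)] by (auto simp: add_eq_0_iff2)
  have "inj_on proj ((+) y0 ` L)"
  proof (rule inj_onI)
    fix x y assume x: "x \<in> (+) y0 ` L" and y: "y \<in> (+) y0 ` L" and "proj x = proj y"
    then obtain c where c: "c \<noteq> 0" "y = c *\<^sub>R x" by (auto simp: proj_eq_iff)
    obtain a b where ab: "a \<in> L" "b \<in> L" "x = y0 + a" "y = y0 + b" using x y by auto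
    have eq: "(1 - c) *\<^sub>R y0 = c *\<^sub>R a - b" using c ab by (simp add: algebra_simps)
    have "(1 - c) *\<^sub>R y0 \<in> L" unfolding eq using ab L(1) by (simp add: subspace_diff subspace_scale)
    then have "c = 1"
      using L subspace_scale[OF L(1), of "(1 - c) *\<^sub>R y0" "1 / (1 - c)"] by (cases "c = 1") auto
    then show "x = y" using c by simp
  qed
  then have "top_of_set (convex hull C) homeomorphic_space subtopology proj_topology (proj ` (convex hull C))"
    using haus hull L0 \<open>finite B\<close>
    by (intro homeomorphic_space_proj_image)
       (auto simp: C_def finite_imp_compact_convex_hull intro: inj_on_subset)
  moreover have "subtopology proj_topology (proj ` (convex hull C)) dim_le int (dim L) - 1"
    using dimS hull sub by (blast intro: dimension_le_subtopologies)
  ultimately show False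
    using simplex_not_dim_le[OF indep \<open>card C = _\<close>] homeomorphic_space_dimension_le by blast
qed

lemma has_dimension_proj_between:
  fixes L :: "'a::euclidean_space set"
  assumes "Hausdorff_space (proj_topology :: 'a set topology)" "subspace L" "y0 \<notin> L"
    "proj ` ((+) y0 ` L) \<subseteq> S" "S \<subseteq> proj_set (span (insert y0 L))"
  shows "has_dimension (subtopology proj_topology S) (int (dim L))"
proof -
  have "subtopology proj_topology S dim_le int (dim L)"
    using assms by (intro dimension_le_subtopologies[OF proj_subspace_dim_le assms(5)]) (auto simp: dim_insert)
  then show ?thesis using proj_affine_not_dim_le[OF assms(1-4)] by (simp add: has_dimension_def)
qed

section \<open>The exponential of a commuting sum\<close>

lemma linear_funpow: "linear A \<Longrightarrow> linear (A ^^ k)" for A :: "'a::real_vector \<Rightarrow> 'a"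
  by (induction k) (auto simp: linear_id linear_compose simp flip: id_def)

lemma norm_funpow_le:
  fixes A :: "'a::real_normed_vector \<Rightarrow> 'a"
  assumes "\<And>x. norm (A x) \<le> B * norm x" "B > 0"
  shows "norm ((A ^^ k) x) \<le> B ^ k * norm x"
proof (induction k)
  case (Suc k)
  have "norm ((A ^^ Suc k) x) \<le> B * norm ((A ^^ k) x)" using assms by simp
  also have "\<dots> \<le> B * (B ^ k * norm x)" using Suc assms by simp
  finally show ?case by (simp add: mult.assoc)
qed simp

lemma summable_lin_exp:
  fixes A :: "'a::euclidean_space \<Rightarrow> 'a"
  assumes "linear A"
  shows "summable (\<lambda>k. (t ^ k / fact k) *\<^sub>R (A ^^ k) x)"
proof -
  obtain B where B: "B > 0" "\<And>x. norm (A x) \<le> B * norm x"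
    using linear_bounded_pos[OF assms] by blast
  show ?thesis
  proof (rule summable_comparison_test)
    show "summable (\<lambda>k. norm x * ((\<bar>t\<bar> * B) ^ k / fact k))"
      using summable_exp_generic[of "\<bar>t\<bar> * B"] by (intro summable_mult) (simp add: field_simps)
    have "norm ((t ^ k / fact k) *\<^sub>R (A ^^ k) x) \<le> norm x * ((\<bar>t\<bar> * B) ^ k / fact k)" for k
    proof -
      have "norm ((t ^ k / fact k) *\<^sub>R (A ^^ k) x) = (\<bar>t\<bar> ^ k / fact k) * norm ((A ^^ k) x)"
        by (simp add: power_abs)
      also have "\<dots> \<le> (\<bar>t\<bar> ^ k / fact k) * (B ^ k * norm x)"
        using norm_funpow_le[OF B(2,1)] by (intro mult_left_mono) auto
      finally show ?thesis by (simp add: power_mult_distrib algebra_simps)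
    qed
    then show "\<exists>N. \<forall>k\<ge>N. norm ((t ^ k / fact k) *\<^sub>R (A ^^ k) x) \<le> norm x * ((\<bar>t\<bar> * B) ^ k / fact k)"
      by blast
  qed
qed

lemma linear_lin_exp:
  assumes "linear A"
  shows "linear (lin_exp A t)"
proof (rule linearI)
  fix x y c
  note lin = linear_funpow[OF assms]
  show "lin_exp A t (x + y) = lin_exp A t x + lin_exp A t y"
    using suminf_add[OF summable_lin_exp[OF assms] summable_lin_exp[OF assms], of t x t y]
    by (simp add: lin_exp_def linear_add[OF lin] scaleR_add_right)
  show "lin_exp A t (c *\<^sub>R x) = c *\<^sub>R lin_exp A t x"
    using suminf_scaleR_right[OF summable_lin_exp[OF assms], of c t x]
    by (simp add: lin_exp_def linear_scale[OF lin] mult.commute)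
qed

text \<open>
  A solution \<open>g\<close> of \<open>g' = A g\<close> has the \<open>n\<close>-th derivative \<open>(A ^^ n) (g t)\<close>, which grows at most
  geometrically in \<open>n\<close>. Tested against any \<open>w\<close>, it is therefore the sum of its Maclaurin series, which is the series of
  \<open>lin_exp\<close>.
\<close>

lemma lin_exp_unique:
  fixes A :: "'a::euclidean_space \<Rightarrow> 'a"
  assumes A: "linear A" and g: "\<And>t. (g has_vector_derivative A (g t)) (at t)"
  shows "g t = lin_exp A t (g 0)"
proof -
  obtain B where B: "B > 0" "\<And>x. norm (A x) \<le> B * norm x"
    using linear_bounded_pos[OF A] by blast
  have "continuous_on {-\<bar>t\<bar>..\<bar>t\<bar>} g"
    by (intro continuous_at_imp_continuous_on ballI has_vector_derivative_continuous[OF g])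
  then have "bounded (g ` {-\<bar>t\<bar>..\<bar>t\<bar>})"
    by (intro compact_imp_bounded compact_continuous_image) auto
  then obtain G where G: "\<And>s. \<bar>s\<bar> \<le> \<bar>t\<bar> \<Longrightarrow> norm (g s) \<le> G"
    unfolding bounded_iff by (metis abs_le_iff atLeastAtMost_iff imageI minus_le_iff)
  have "g t \<bullet> w = lin_exp A t (g 0) \<bullet> w" for w
  proof -
    define h where "h n s = (A ^^ n) (g s) \<bullet> w" for n s
    have deriv: "DERIV (h n) s :> h (Suc n) s" for n s
    proof -
      have "bounded_linear (\<lambda>v. (A ^^ n) v \<bullet> w)"
        using linear_funpow[OF A, of n]
        by (intro bounded_linear_inner_left_comp) (simp add: linear_conv_bounded_linear)
      from bounded_linear.has_vector_derivative[OF this g]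
      show ?thesis
        by (simp add: h_def[abs_def] has_real_derivative_iff_has_vector_derivative funpow_swap1)
    qed
    define p where "p n = (\<Sum>m<n. (h m 0 / fact m) * t ^ m)" for n
    have rem: "norm (h 0 t - p n) \<le> G * norm w * ((B * \<bar>t\<bar>) ^ n / fact n)" for n
    proof -
      obtain s where s: "\<bar>s\<bar> \<le> \<bar>t\<bar>" "h 0 t = p n + (h n s / fact n) * t ^ n"
        using Maclaurin_all_le[of h "h 0" t n] deriv unfolding p_def by blast
      have "\<bar>h n s\<bar> \<le> norm ((A ^^ n) (g s)) * norm w"
        unfolding h_def by (rule Cauchy_Schwarz_ineq2)
      also have "\<dots> \<le> (B ^ n * G) * norm w"
        using norm_funpow_le[OF B(2,1), of n "g s"] G[OF s(1)] B(1)
        by (intro mult_right_mono order_trans[OF norm_funpow_le[OF B(2,1), of n "g s"]] mult_left_mono) auto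
      finally have "\<bar>h n s\<bar> * (\<bar>t\<bar> ^ n / fact n) \<le> (B ^ n * G) * norm w * (\<bar>t\<bar> ^ n / fact n)"
        by (intro mult_right_mono) auto
      moreover have "norm (h 0 t - p n) = \<bar>h n s\<bar> * (\<bar>t\<bar> ^ n / fact n)"
        using s(2) by (simp add: abs_mult power_abs)
      ultimately show ?thesis by (simp add: power_mult_distrib mult_ac)
    qed
    have "(\<lambda>n. (B * \<bar>t\<bar>) ^ n / fact n) \<longlonglongrightarrow> 0"
      using summable_LIMSEQ_zero[OF summable_exp_generic[of "B * \<bar>t\<bar>"]] by (simp add: field_simps)
    then have "(\<lambda>n. G * norm w * ((B * \<bar>t\<bar>) ^ n / fact n)) \<longlonglongrightarrow> 0"
      by (rule tendsto_mult_right_zero)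
    then have "(\<lambda>n. h 0 t - p n) \<longlonglongrightarrow> 0"
      by (rule Lim_null_comparison[rotated]) (use rem in auto)
    then have "p \<longlonglongrightarrow> h 0 t"
      using tendsto_diff[OF tendsto_const[of "h 0 t"], of "\<lambda>n. h 0 t - p n" 0] by simp
    moreover have "p \<longlonglongrightarrow> lin_exp A t (g 0) \<bullet> w"
    proof -
      have "(\<lambda>n. (\<Sum>k<n. (t ^ k / fact k) *\<^sub>R (A ^^ k) (g 0)) \<bullet> w) \<longlonglongrightarrow> lin_exp A t (g 0) \<bullet> w"
        unfolding lin_exp_def using summable_LIMSEQ[OF summable_lin_exp[OF A]]
        by (intro tendsto_inner tendsto_const)
      then show ?thesis by (simp add: p_def[abs_def] h_def inner_sum_left mult.commute)
    qed
    ultimately show ?thesis using LIMSEQ_unique by (fastforce simp: h_def)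
  qed
  then show ?thesis by (metis vector_eq_rdot)
qed

text \<open>
  The real and imaginary parts of an eigenvector of \<open>S\<close> for \<open>\<i> * \<alpha>\<close> satisfy this relation;
  \<open>\<alpha> = 0\<close> with \<open>y = 0\<close> covers the kernel of \<open>S\<close>.
\<close>

definition rotates :: "('a::euclidean_space \<Rightarrow> 'a) \<Rightarrow> real \<Rightarrow> 'a \<Rightarrow> 'a \<Rightarrow> bool"
  where "rotates S \<alpha> x y \<longleftrightarrow> S x = - \<alpha> *\<^sub>R y \<and> S y = \<alpha> *\<^sub>R x"

lemma has_vector_derivative_rotation:
  "((\<lambda>t. cos (\<alpha> * t) *\<^sub>R x - sin (\<alpha> * t) *\<^sub>R y) has_vector_derivative
     - \<alpha> *\<^sub>R (sin (\<alpha> * t) *\<^sub>R x + cos (\<alpha> * t) *\<^sub>R y)) (at t)"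
proof -
  have "((\<lambda>t. cos (\<alpha> * t)) has_real_derivative - sin (\<alpha> * t) * \<alpha>) (at t)"
    and "((\<lambda>t. sin (\<alpha> * t)) has_real_derivative cos (\<alpha> * t) * \<alpha>) (at t)"
    by (auto intro!: derivative_eq_intros)
  note d = this[THEN has_vector_derivative_scaleR, OF has_vector_derivative_const]
  show ?thesis
    by (rule has_vector_derivative_eq_rhs[OF has_vector_derivative_diff[OF d(1)[of x] d(2)[of y]]])
       (simp add: algebra_simps)
qed

lemma sum_power_fact_derivative:
  fixes c :: "nat \<Rightarrow> 'a::real_vector"
  assumes "c (Suc m) = 0"
  shows "(\<Sum>k\<le>m. (real k * t ^ (k - 1) / fact k) *\<^sub>R c k) = (\<Sum>k\<le>m. (t ^ k / fact k) *\<^sub>R c (Suc k))"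
proof (cases m)
  case (Suc l)
  have "(\<Sum>k\<le>Suc l. (real k * t ^ (k - 1) / fact k) *\<^sub>R c k) = (\<Sum>k\<le>l. (real (Suc k) * t ^ k / fact (Suc k)) *\<^sub>R c (Suc k))"
    by (subst sum.atMost_Suc_shift) simp
  also have "\<dots> = (\<Sum>k\<le>l. (t ^ k / fact k) *\<^sub>R c (Suc k))"
    by (intro sum.cong refl arg_cong2[where f = scaleR]) (simp del: of_nat_Suc)
  finally show ?thesis using assms Suc by simp
qed (use assms in simp)

text \<open>
  The right-hand side solves the differential equation of \<open>A\<close>: differentiating the rotation contributes
  \<open>A - N\<close>, and differentiating the powers of \<open>t\<close> shifts the index and contributes \<open>N\<close>.
\<close>

lemma lin_exp_rotates:
  fixes A N :: "'a::euclidean_space \<Rightarrow> 'a"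
  assumes A: "linear A" and N: "linear N" "\<And>x. A (N x) = N (A x)" "\<And>x. (N ^^ Suc m) x = 0"
    and rot: "rotates (\<lambda>x. A x - N x) \<alpha> x y"
  shows "lin_exp A t x = (\<Sum>k\<le>m. (t ^ k / fact k) *\<^sub>R (N ^^ k) (cos (\<alpha> * t) *\<^sub>R x - sin (\<alpha> * t) *\<^sub>R y))"
proof -
  define u where "u t = cos (\<alpha> * t) *\<^sub>R x - sin (\<alpha> * t) *\<^sub>R y" for t
  define g where "g t = (\<Sum>k\<le>m. (t ^ k / fact k) *\<^sub>R (N ^^ k) (u t))" for t
  note lin = linear_funpow[OF N(1)]
  have AN: "A ((N ^^ k) v) = (N ^^ k) (A v)" for k v
    by (induction k) (simp_all add: N(2))
  have Au: "A (u t) = N (u t) - \<alpha> *\<^sub>R (sin (\<alpha> * t) *\<^sub>R x + cos (\<alpha> * t) *\<^sub>R y)" for t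
  proof -
    have xy: "A x = N x - \<alpha> *\<^sub>R y" "A y = N y + \<alpha> *\<^sub>R x" using rot by (auto simp: rotates_def algebra_simps)
    show ?thesis
      by (simp add: xy u_def linear_diff[OF A] linear_diff[OF N(1)] linear_scale[OF A] linear_scale[OF N(1)] algebra_simps)
  qed
  have Ag: "A (g t) = (\<Sum>k\<le>m. (t ^ k / fact k) *\<^sub>R (N ^^ k) (N (u t)))
      + (\<Sum>k\<le>m. (t ^ k / fact k) *\<^sub>R (N ^^ k) (- \<alpha> *\<^sub>R (sin (\<alpha> * t) *\<^sub>R x + cos (\<alpha> * t) *\<^sub>R y)))" for t
    by (simp add: g_def linear_sum[OF A] linear_scale[OF A] AN Au linear_diff[OF lin] linear_scale[OF lin]
        scaleR_diff_right sum_subtractf sum_negf linear_neg[OF lin])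
  have deriv: "(g has_vector_derivative A (g t)) (at t)" for t
  proof -
    have 1: "((\<lambda>t. (N ^^ k) (u t)) has_vector_derivative
        (N ^^ k) (- \<alpha> *\<^sub>R (sin (\<alpha> * t) *\<^sub>R x + cos (\<alpha> * t) *\<^sub>R y))) (at t)" for k
      unfolding u_def
      using lin[of k] by (intro bounded_linear.has_vector_derivative[OF _ has_vector_derivative_rotation])
        (simp add: linear_conv_bounded_linear)
    have 2: "((\<lambda>t. t ^ k / fact k) has_real_derivative (real k * t ^ (k - 1) / fact k)) (at t)" for k
      by (auto intro!: derivative_eq_intros)
    have "(g has_vector_derivative (\<Sum>k\<le>m. (t ^ k / fact k) *\<^sub>R (N ^^ k) (- \<alpha> *\<^sub>R (sin (\<alpha> * t) *\<^sub>R x + cos (\<alpha> * t) *\<^sub>R y))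
        + (real k * t ^ (k - 1) / fact k) *\<^sub>R (N ^^ k) (u t))) (at t)"
      unfolding g_def[abs_def]
      by (intro has_vector_derivative_sum has_vector_derivative_scaleR 1 2)
    also have "(\<Sum>k\<le>m. (t ^ k / fact k) *\<^sub>R (N ^^ k) (- \<alpha> *\<^sub>R (sin (\<alpha> * t) *\<^sub>R x + cos (\<alpha> * t) *\<^sub>R y))
        + (real k * t ^ (k - 1) / fact k) *\<^sub>R (N ^^ k) (u t)) = A (g t)"
      unfolding Ag sum.distrib using sum_power_fact_derivative[of "\<lambda>k. (N ^^ k) (u t)" m t] N(3)
      by (simp add: funpow_swap1)
    finally show ?thesis .
  qed
  have "g 0 = x"
    by (simp add: g_def u_def power_0_left if_distrib if_distribR cong: if_cong)
  then show ?thesis using lin_exp_unique[OF A deriv, of t] by (simp add: g_def u_def)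
qed

text \<open>
  Here \<open>R t\<close> is the flow of the semisimple part \<open>A - N\<close>. Each property is linear in \<open>x\<close> and evident for
  rotating vectors, which span the space. Boundedness is obtained vector by vector and then made
  uniform over a basis; together with \<open>R (- t) (R t x) = x\<close> it also bounds \<open>R t\<close> from below.
\<close>

lemma bounded_propagator:
  fixes A N :: "'a::euclidean_space \<Rightarrow> 'a"
  assumes A: "linear A" and N: "linear N" "\<And>x. A (N x) = N (A x)" "\<And>x. (N ^^ Suc m) x = 0"
    and rot: "span {x. \<exists>\<alpha> y. rotates (\<lambda>x. A x - N x) \<alpha> x y} = UNIV"
  obtains R C where "\<And>t :: real. linear (R t)" "C > 0" "\<And>t x. norm (R t x) \<le> C * norm x"
    "\<And>t x. R (- t) (R t x) = x" "\<And>t x. lin_exp A t x = (\<Sum>k\<le>m. (t ^ k / fact k) *\<^sub>R R t ((N ^^ k) x))"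
proof -
  define S where "S x = A x - N x" for x
  define R where "R = lin_exp S"
  have S: "linear S" unfolding S_def[abs_def] using A N(1) by (rule linear_compose_sub)
  have linR: "linear (R t)" for t unfolding R_def using S by (rule linear_lin_exp)
  have R_rot: "R t x = cos (\<alpha> * t) *\<^sub>R x - sin (\<alpha> * t) *\<^sub>R y" if "rotates S \<alpha> x y" for \<alpha> x y t
    unfolding R_def using lin_exp_rotates[OF S, of "\<lambda>x. 0" 0 \<alpha> x y t] that
    by (simp add: linear_0[OF S] linear_zero)
  have spanI: "P x" if "\<And>\<alpha> x y. rotates S \<alpha> x y \<Longrightarrow> P x" "subspace {x. P x}" for P x
  proof -
    have "span {x. \<exists>\<alpha> y. rotates (\<lambda>x. A x - N x) \<alpha> x y} \<subseteq> {x. P x}"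
      using that by (intro span_minimal) (auto simp: S_def[abs_def])
    then show ?thesis using rot by auto
  qed
  have bdd: "\<exists>C. \<forall>t. norm (R t x) \<le> C" for x
  proof (rule spanI)
    fix \<alpha> x y assume "rotates S \<alpha> x y"
    then have "norm (R t x) \<le> norm x + norm y" for t
      unfolding R_rot[OF \<open>rotates S \<alpha> x y\<close>]
      by (intro order_trans[OF norm_triangle_ineq4] add_mono) (auto intro!: mult_left_le_one_le)
    then show "\<exists>C. \<forall>t. norm (R t x) \<le> C" by blast
  next
    show "subspace {x. \<exists>C. \<forall>t. norm (R t x) \<le> C}"
    proof (intro subspaceI; clarsimp)
      show "\<exists>C. \<forall>t. norm (R t 0) \<le> C" by (auto simp: linear_0[OF linR])
    next
      fix x y C D assume "\<forall>t. norm (R t x) \<le> C" "\<forall>t. norm (R t y) \<le> D"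
      then have "norm (R t (x + y)) \<le> C + D" for t
        unfolding linear_add[OF linR] by (intro norm_triangle_le add_mono) auto
      then show "\<exists>C. \<forall>t. norm (R t (x + y)) \<le> C" by blast
    next
      fix c x C assume "\<forall>t. norm (R t x) \<le> C"
      then have "norm (R t (c *\<^sub>R x)) \<le> \<bar>c\<bar> * C" for t
        by (simp add: linear_scale[OF linR] mult_left_mono)
      then show "\<exists>C. \<forall>t. norm (R t (c *\<^sub>R x)) \<le> C" by blast
    qed
  qed
  then obtain K where K: "\<And>x t. norm (R t x) \<le> K x" by metis
  define C where "C = 1 + (\<Sum>b\<in>Basis. K b)"
  have K0: "K x \<ge> 0" for x using K[of 0 x] norm_ge_zero order_trans by blast
  have bound: "norm (R t x) \<le> C * norm x" for t x
  proof -
    have "R t x = (\<Sum>b\<in>Basis. (x \<bullet> b) *\<^sub>R R t b)"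
      by (metis (no_types, lifting) euclidean_representation linR linear_scale linear_sum sum.cong)
    also have "norm \<dots> \<le> (\<Sum>b\<in>Basis. norm x * K b)"
      by (intro sum_norm_le) (auto intro!: mult_mono Basis_le_norm K)
    also have "\<dots> = norm x * (\<Sum>b\<in>Basis. K b)" by (simp add: sum_distrib_left)
    also have "\<dots> \<le> C * norm x" by (simp add: C_def algebra_simps)
    finally show ?thesis .
  qed
  have inv: "R (- t) (R t x) = x" for t x
  proof (rule spanI)
    fix \<alpha> x y assume xy: "rotates S \<alpha> x y"
    then have yx: "rotates S \<alpha> y (- x)" by (simp add: rotates_def linear_neg[OF S])
    show "R (- t) (R t x) = x"
      unfolding R_rot[OF xy, of t] linear_diff[OF linR] linear_scale[OF linR] R_rot[OF xy, of "- t"] R_rot[OF yx, of "- t"]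
      by (simp add: algebra_simps flip: scaleR_add_left power2_eq_square)
  qed (auto intro!: subspaceI simp: linear_0[OF linR] linear_add[OF linR] linear_scale[OF linR])
  have RN: "R t (N x) = N (R t x)" for t x
  proof (rule spanI[where P = "\<lambda>x. R t (N x) = N (R t x)"])
    fix \<alpha> x y assume xy: "rotates S \<alpha> x y"
    then have SN: "S (N v) = N (S v)" for v by (simp add: S_def N(2) linear_diff[OF N(1)])
    have "rotates S \<alpha> (N x) (N y)" using xy by (simp add: rotates_def SN linear_scale[OF N(1)] linear_neg[OF N(1)])
    then show "R t (N x) = N (R t x)"
      using xy by (simp add: R_rot linear_diff[OF N(1)] linear_scale[OF N(1)])
  qed (auto intro!: subspaceI simp: linear_0[OF linR] linear_add[OF linR] linear_scale[OF linR]
        linear_0[OF N(1)] linear_add[OF N(1)] linear_scale[OF N(1)])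
  have RNk: "R t ((N ^^ k) x) = (N ^^ k) (R t x)" for t k x
    by (induction k) (simp_all add: RN)
  have expA: "lin_exp A t x = (\<Sum>k\<le>m. (t ^ k / fact k) *\<^sub>R R t ((N ^^ k) x))" for t x
  proof (rule spanI[where P = "\<lambda>x. lin_exp A t x = (\<Sum>k\<le>m. (t ^ k / fact k) *\<^sub>R R t ((N ^^ k) x))"])
    fix \<alpha> x y assume xy: "rotates S \<alpha> x y"
    then show "lin_exp A t x = (\<Sum>k\<le>m. (t ^ k / fact k) *\<^sub>R R t ((N ^^ k) x))"
      using lin_exp_rotates[OF A N, of \<alpha> x y t] by (simp add: S_def[abs_def] RNk R_rot[OF xy])
  next
    note lins = linear_lin_exp[OF A, of t] linR linear_funpow[OF N(1)]
    show "subspace {x. lin_exp A t x = (\<Sum>k\<le>m. (t ^ k / fact k) *\<^sub>R R t ((N ^^ k) x))}"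
      by (intro subspaceI; clarsimp)
         (simp_all add: lins[THEN linear_0] lins[THEN linear_add] lins[THEN linear_scale]
           scaleR_add_right sum.distrib scaleR_sum_right mult.commute)
  qed
  have "C > 0" unfolding C_def using K0 by (simp add: add_pos_nonneg sum_nonneg)
  then show ?thesis using that linR bound inv expA by blast
qed

section \<open>Stable manifolds in projective space\<close>

text \<open>
  This carries the hypothesis on \<open>d\<close> over to continuity in vector coordinates, after which compactness
  arguments can be made with vectors.
\<close>

lemma continuous_on_proj_dist:
  fixes d :: "'a::euclidean_space set \<Rightarrow> 'a set \<Rightarrow> real"
  assumes "Metric_space (proj_set UNIV) d" "Metric_space.mtopology (proj_set UNIV) d = proj_topology"
  shows "continuous_on ((- {0}) \<times> (- {0})) (\<lambda>(u, w). d (proj u) (proj w))"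
proof -
  interpret M: Metric_space "proj_set UNIV :: 'a set set" d by fact
  have top: "mtopology_of (metric (proj_set UNIV, d)) = proj_topology"
    using M.mtopology_of assms(2) by simp
  define Z where "Z = (- {0 :: 'a}) \<times> (- {0 :: 'a})"
  have f: "continuous_map (top_of_set Z) (top_of_set (- {0})) fst"
    and g: "continuous_map (top_of_set Z) (top_of_set (- {0})) snd"
    by (auto simp: Z_def intro!: continuous_intros)
  have "continuous_map (top_of_set Z) euclidean
      (\<lambda>x. mdist (metric (proj_set UNIV, d)) ((proj \<circ> fst) x) ((proj \<circ> snd) x))"
    by (intro continuous_map_mdist)
       (simp_all only: top continuous_map_compose[OF f continuous_map_proj]
          continuous_map_compose[OF g continuous_map_proj])
  then show ?thesis by (simp add: case_prod_unfold Z_def)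
qed

text \<open>
  Since \<open>u\<close> stays in an annulus and \<open>w\<close> approaches it, both finally lie in a slightly larger annulus, on which
  the distance of the spanned lines is uniformly continuous.
\<close>

lemma proj_dist_tendsto_0:
  fixes d :: "'a::euclidean_space set \<Rightarrow> 'a set \<Rightarrow> real" and u w :: "real \<Rightarrow> 'a"
  assumes d: "Metric_space (proj_set UNIV) d" "Metric_space.mtopology (proj_set UNIV) d = proj_topology"
    and b: "b > 0" "\<And>t. b \<le> norm (u t)" "\<And>t. norm (u t) \<le> B"
    and uw: "((\<lambda>t. w t - u t) \<longlongrightarrow> 0) at_top"
  shows "((\<lambda>t. d (proj (u t)) (proj (w t))) \<longlongrightarrow> 0) at_top"
proof (rule tendstoI)
  fix e :: real assume "e > 0"
  interpret M: Metric_space "proj_set UNIV :: 'a set set" d by fact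
  define K where "K = cball 0 (B + 1) - ball (0 :: 'a) (b / 2)"
  have "compact K" by (simp add: K_def compact_diff)
  have K: "v \<in> K \<longleftrightarrow> b / 2 \<le> norm v \<and> norm v \<le> B + 1" for v by (auto simp: K_def)
  have K0: "K \<subseteq> - {0}" using b(1) by (auto simp: K)
  have "continuous_on (K \<times> K) (\<lambda>(u, w). d (proj u) (proj w))"
    by (rule continuous_on_subset[OF continuous_on_proj_dist[OF d]]) (use K0 in auto)
  then have "uniformly_continuous_on (K \<times> K) (\<lambda>(u, w). d (proj u) (proj w))"
    by (intro compact_uniformly_continuous compact_Times \<open>compact K\<close>)
  then obtain \<delta> where \<delta>: "\<delta> > 0" "\<And>p q. p \<in> K \<times> K \<Longrightarrow> q \<in> K \<times> K \<Longrightarrow> dist q p < \<delta> \<Longrightarrow>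
      dist (case q of (u, w) \<Rightarrow> d (proj u) (proj w)) (case p of (u, w) \<Rightarrow> d (proj u) (proj w)) < e"
    using \<open>e > 0\<close> unfolding uniformly_continuous_on_def by blast
  have "eventually (\<lambda>t. norm (w t - u t) < min \<delta> (min (b / 2) 1)) at_top"
    using tendstoD[OF uw, of "min \<delta> (min (b / 2) 1)"] \<delta> b(1) by simp
  then show "eventually (\<lambda>t. dist (d (proj (u t)) (proj (w t))) 0 < e) at_top"
  proof eventually_elim
    case (elim t)
    have u: "u t \<in> K" using b(2,3)[of t] b(1) by (simp add: K)
    have "w t \<in> K"
      using elim b(2,3)[of t] norm_triangle_ineq2[of "u t" "w t"] norm_triangle_ineq2[of "w t" "u t"]
      by (simp add: K norm_minus_commute)
    moreover have "dist (u t, w t) (u t, u t) < \<delta>"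
      using elim by (simp add: dist_Pair_Pair dist_norm)
    ultimately have "dist (d (proj (u t)) (proj (w t))) (d (proj (u t)) (proj (u t))) < e"
      using \<delta>(2)[of "(u t, u t)" "(u t, w t)"] u by simp
    moreover have "proj (u t) \<in> proj_set UNIV" using u K0 by (auto simp: proj_set_def)
    ultimately show ?case by simp
  qed
qed

text \<open>
  Conversely, when the lines approach each other, then along some sequence of times both vectors converge by compactness of the annulus, and the
  limits span the same line.
\<close>

lemma proj_dist_tendsto_0_imp_parallel:
  fixes d :: "'a::euclidean_space set \<Rightarrow> 'a set \<Rightarrow> real" and u w :: "real \<Rightarrow> 'a"
  assumes d: "Metric_space (proj_set UNIV) d" "Metric_space.mtopology (proj_set UNIV) d = proj_topology"
    and b: "b > 0" "\<And>t. b \<le> norm (u t)" "\<And>t. norm (u t) \<le> B"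
    and w: "eventually (\<lambda>t. b \<le> norm (w t) \<and> norm (w t) \<le> B) at_top"
    and lim: "((\<lambda>t. d (proj (u t)) (proj (w t))) \<longlongrightarrow> 0) at_top"
  obtains c and t :: "nat \<Rightarrow> real"
  where "c \<noteq> 0" "filterlim t at_top sequentially" "(\<lambda>n. w (t n) - c *\<^sub>R u (t n)) \<longlonglongrightarrow> 0"
proof -
  interpret M: Metric_space "proj_set UNIV :: 'a set set" d by fact
  define K where "K = cball 0 B - ball (0 :: 'a) b"
  have "compact K" by (simp add: K_def compact_diff)
  have K: "v \<in> K \<longleftrightarrow> b \<le> norm v \<and> norm v \<le> B" for v by (auto simp: K_def)
  have K0: "K \<subseteq> - {0}" using b(1) by (auto simp: K)
  obtain T where T: "\<And>t. t \<ge> T \<Longrightarrow> w t \<in> K" using w unfolding eventually_at_top_linorder K by blast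
  define s where "s n = T + real n" for n
  have s_lim: "filterlim s at_top sequentially"
    unfolding s_def by (intro filterlim_tendsto_add_at_top[OF tendsto_const] filterlim_real_sequentially)
  have "(u (s n), w (s n)) \<in> K \<times> K" for n using b(2,3) T[of "s n"] by (simp add: s_def K)
  then obtain l r where l: "l \<in> K \<times> K" "strict_mono r" "((\<lambda>n. (u (s n), w (s n))) \<circ> r) \<longlonglongrightarrow> l"
    using compact_Times[OF \<open>compact K\<close> \<open>compact K\<close>] unfolding compact_def by meson
  obtain u' w' where l_eq: "l = (u', w')" by (cases l)
  have ul: "(\<lambda>n. u (s (r n))) \<longlonglongrightarrow> u'" and wl: "(\<lambda>n. w (s (r n))) \<longlonglongrightarrow> w'"
    using tendsto_fst[OF l(3)] tendsto_snd[OF l(3)] by (simp_all add: l_eq o_def)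
  have sr: "filterlim (\<lambda>n. s (r n)) at_top sequentially"
    using filterlim_compose[OF s_lim filterlim_subseq[OF l(2)]] .
  have "isCont (\<lambda>(u, w). d (proj u) (proj w)) (u', w')"
  proof (rule continuous_on_interior[OF continuous_on_proj_dist[OF d]])
    have "open ((- {0 :: 'a}) \<times> (- {0 :: 'a}))" by (intro open_Times open_Compl) auto
    then show "(u', w') \<in> interior ((- {0}) \<times> (- {0}))" using l(1) K0 l_eq by (auto simp: interior_open)
  qed
  from isCont_tendsto_compose[OF this, of "\<lambda>n. (u (s (r n)), w (s (r n)))"]
  have "(\<lambda>n. d (proj (u (s (r n)))) (proj (w (s (r n))))) \<longlonglongrightarrow> d (proj u') (proj w')"
    using tendsto_Pair[OF ul wl] by simp
  moreover have "(\<lambda>n. d (proj (u (s (r n)))) (proj (w (s (r n))))) \<longlonglongrightarrow> 0"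
    using filterlim_compose[OF lim sr] .
  ultimately have "d (proj u') (proj w') = 0" using LIMSEQ_unique by blast
  moreover have "proj u' \<in> proj_set UNIV" "proj w' \<in> proj_set UNIV"
    using l(1) l_eq K0 by (auto simp: proj_set_def)
  ultimately have "proj u' = proj w'" by simp
  then obtain c where c: "c \<noteq> 0" "w' = c *\<^sub>R u'" by (auto simp: proj_eq_iff)
  have "(\<lambda>n. w (s (r n)) - c *\<^sub>R u (s (r n))) \<longlonglongrightarrow> w' - c *\<^sub>R u'"
    by (intro tendsto_intros ul wl)
  then show ?thesis using that[OF c(1) sr] c(2) by simp
qed

lemma last_nonzero_iterate:
  fixes N :: "'a::zero \<Rightarrow> 'a"
  assumes "(N ^^ m) x = 0" "x \<noteq> 0"
  obtains j where "(N ^^ j) x \<noteq> 0" "(N ^^ Suc j) x = 0"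
proof -
  define k where "k = (LEAST k. (N ^^ k) x = 0)"
  have k: "(N ^^ k) x = 0" unfolding k_def by (rule LeastI[of _ m]) (fact assms(1))
  then obtain j where j: "k = Suc j" using assms(2) k by (cases k) auto
  then have "(N ^^ j) x \<noteq> 0" using not_less_Least[of j "\<lambda>k. (N ^^ k) x = 0"] by (auto simp: k_def)
  then show ?thesis using that k j by blast
qed

text \<open>
  For large times the orbit of \<open>y\<close> is governed by the last nonzero iterate of the nilpotent part: the lower
  powers of \<open>t\<close> are absorbed in the error \<open>r\<close>.
\<close>

lemma propagator_leading_term:
  fixes N :: "'a::euclidean_space \<Rightarrow> 'a" and R :: "real \<Rightarrow> 'a \<Rightarrow> 'a"
  assumes N: "linear N" "(N ^^ Suc m) y = 0" "(N ^^ j) y \<noteq> 0" "(N ^^ Suc j) y = 0"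
    and R: "\<And>t. linear (R t)" "\<And>t x. lin_exp A t x = (\<Sum>k\<le>m. (t ^ k / fact k) *\<^sub>R R t ((N ^^ k) x))"
  obtains r where "(r \<longlongrightarrow> 0) at_top"
    "\<And>t. t > 0 \<Longrightarrow> lin_exp A t y = (t ^ j / fact j) *\<^sub>R R t ((N ^^ j) y + r t)"
proof -
  define r where "r t = (\<Sum>k<j. (fact j / fact k * inverse t ^ (j - k)) *\<^sub>R (N ^^ k) y)" for t :: real
  have zero: "(N ^^ k) y = 0" if "(N ^^ l) y = 0" "l \<le> k" for l k
  proof -
    have "(N ^^ k) y = (N ^^ (k - l)) ((N ^^ l) y)"
      using that(2) by (metis funpow_add comp_apply le_add_diff_inverse2)
    then show ?thesis using that linear_0[OF linear_funpow[OF N(1)]] by simp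
  qed
  have "j \<le> m" using zero[OF N(2), of j] N(3) by (meson not_less_eq_eq)
  have "lin_exp A t y = (t ^ j / fact j) *\<^sub>R R t ((N ^^ j) y + r t)" if "t > 0" for t
  proof -
    have "lin_exp A t y = (\<Sum>k\<le>j. (t ^ k / fact k) *\<^sub>R R t ((N ^^ k) y))"
      unfolding R(2) using \<open>j \<le> m\<close> zero[OF N(4)] linear_0[OF R(1)]
      by (intro sum.mono_neutral_right) auto
    also have "\<dots> = R t (\<Sum>k\<le>j. (t ^ k / fact k) *\<^sub>R (N ^^ k) y)"
      by (simp add: linear_sum[OF R(1)] linear_scale[OF R(1)])
    also have "(\<Sum>k\<le>j. (t ^ k / fact k) *\<^sub>R (N ^^ k) y) = (t ^ j / fact j) *\<^sub>R ((N ^^ j) y + r t)"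
    proof -
      have "t ^ k = t ^ j * inverse t ^ (j - k)" if "k < j" for k
        using \<open>t > 0\<close> that by (simp add: power_diff power_inverse field_simps)
      then have "(t ^ j / fact j) *\<^sub>R r t = (\<Sum>k<j. (t ^ k / fact k) *\<^sub>R (N ^^ k) y)"
        unfolding r_def scaleR_sum_right by (intro sum.cong) simp_all
      then show ?thesis by (simp add: scaleR_add_right flip: lessThan_Suc_atMost)
    qed
    finally show ?thesis by (simp add: linear_scale[OF R(1)])
  qed
  moreover have "(r \<longlongrightarrow> (\<Sum>k<j. (fact j / fact k * 0 ^ (j - k)) *\<^sub>R (N ^^ k) y)) at_top"
    unfolding r_def by (intro tendsto_intros tendsto_inverse_0_at_top filterlim_ident)
  then have "(r \<longlongrightarrow> 0) at_top" by (simp add: power_0_left)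
  ultimately show ?thesis using that by blast
qed

text \<open>
  With \<open>z\<close> the last nonzero iterate of \<open>y\<close>, the question is when the lines through \<open>R t x\<close> and
  \<open>R t (z + r t)\<close> become close. If \<open>z\<close> is a multiple of \<open>x\<close>, then suitable vectors on these lines approach each other.
  If the lines become close, then \<open>R t (z - c *\<^sub>R x)\<close> tends to 0 along a sequence of times for some \<open>c\<close>,
  and the lower bound on \<open>R t\<close> forces \<open>z = c *\<^sub>R x\<close>.
\<close>

theorem stable_manifold_eq:
  fixes A N :: "'a::euclidean_space \<Rightarrow> 'a" and d :: "'a set \<Rightarrow> 'a set \<Rightarrow> real"
  assumes d: "Metric_space (proj_set UNIV) d" "Metric_space.mtopology (proj_set UNIV) d = proj_topology"
    and A: "linear A" and N: "linear N" "\<And>x. (N ^^ Suc m) x = 0"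
    and R: "\<And>t :: real. linear (R t)" "C > 0" "\<And>t x. norm (R t x) \<le> C * norm x"
      "\<And>t x. R (- t) (R t x) = x" "\<And>t x. lin_exp A t x = (\<Sum>k\<le>m. (t ^ k / fact k) *\<^sub>R R t ((N ^^ k) x))"
    and x: "x \<noteq> 0" "N x = 0"
  shows "stable_manifold (proj_set UNIV) d (proj_flow A) (proj x) =
    proj ` {y. \<exists>j c. c \<noteq> 0 \<and> (N ^^ j) y = c *\<^sub>R x}"
proof -
  have lower: "norm v / C \<le> norm (R t v)" for t v
    using R(3)[of "- t" "R t v"] R(2,4) by (simp add: divide_le_eq mult.commute)
  have flow_x: "proj_flow A t (proj x) = proj (R t x)" for t
  proof -
    have "(N ^^ k) x = 0" if "k > 0" for k
      using that x(2) linear_0[OF linear_funpow[OF N(1)]] by (cases k) (simp_all add: funpow_swap1)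
    then have "lin_exp A t x = (\<Sum>k\<in>{0}. (t ^ k / fact k) *\<^sub>R R t ((N ^^ k) x))"
      unfolding R(5) using linear_0[OF R(1)] by (intro sum.mono_neutral_right) auto
    then show ?thesis by (simp add: proj_flow_proj[OF A])
  qed
  have shrink: "((\<lambda>t. R t (r t)) \<longlongrightarrow> 0) F" if "(r \<longlongrightarrow> 0) F" for r F
  proof (rule Lim_null_comparison)
    show "eventually (\<lambda>t. norm (R t (r t)) \<le> C * norm (r t)) F" using R(3) by simp
    show "((\<lambda>t. C * norm (r t)) \<longlongrightarrow> 0) F"
      using tendsto_mult_right_zero[OF tendsto_norm_zero[OF that]] .
  qed
  have key: "((\<lambda>t. d (proj_flow A t (proj x)) (proj_flow A t (proj y))) \<longlongrightarrow> 0) at_top \<longleftrightarrow>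
      (\<exists>c. c \<noteq> 0 \<and> (N ^^ j) y = c *\<^sub>R x)" if j: "(N ^^ j) y \<noteq> 0" "(N ^^ Suc j) y = 0" for y j
  proof -
    define z where "z = (N ^^ j) y"
    obtain r where r: "(r \<longlongrightarrow> 0) at_top"
      "\<And>t. t > 0 \<Longrightarrow> lin_exp A t y = (t ^ j / fact j) *\<^sub>R R t (z + r t)"
      using propagator_leading_term[OF N(1) N(2) j R(1) R(5)] unfolding z_def by metis
    have flow_y: "proj_flow A t (proj y) = proj (R t (z + r t))" if "t > 0" for t
      using that by (simp add: proj_flow_proj[OF A] r(2) proj_scaleR)
    have ev: "eventually (\<lambda>t. d (proj_flow A t (proj x)) (proj_flow A t (proj y)) =
        d (proj (R t x)) (proj (R t (z + r t)))) at_top"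
      by (rule eventually_mono[OF eventually_gt_at_top[of 0]]) (simp add: flow_x flow_y)
    have "((\<lambda>t. d (proj_flow A t (proj x)) (proj_flow A t (proj y))) \<longlongrightarrow> 0) at_top \<longleftrightarrow>
        ((\<lambda>t. d (proj (R t x)) (proj (R t (z + r t)))) \<longlongrightarrow> 0) at_top"
      by (rule tendsto_cong[OF ev])
    also have "\<dots> \<longleftrightarrow> (\<exists>c. c \<noteq> 0 \<and> z = c *\<^sub>R x)"
    proof
      assume lim: "((\<lambda>t. d (proj (R t x)) (proj (R t (z + r t)))) \<longlongrightarrow> 0) at_top"
      define b where "b = min (norm x / C) (norm z / (2 * C))"
      define B where "B = max (C * norm x) (2 * C * norm z)"
      have b: "b > 0" using x(1) j(1) R(2) by (simp add: b_def z_def)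
      have "eventually (\<lambda>t. norm (r t) < norm z / 2) at_top"
        using tendstoD[OF r(1), of "norm z / 2"] j(1) by (simp add: z_def)
      then have "eventually (\<lambda>t. b \<le> norm (R t (z + r t)) \<and> norm (R t (z + r t)) \<le> B) at_top"
      proof eventually_elim
        case (elim t)
        have "norm z / 2 \<le> norm (z + r t)" "norm (z + r t) \<le> 2 * norm z"
          using elim norm_triangle_ineq[of z "r t"] norm_triangle_ineq4[of "z + r t" "r t"] by auto
        then have "norm z / 2 / C \<le> norm (z + r t) / C" "C * norm (z + r t) \<le> C * (2 * norm z)"
          using R(2) by (intro divide_right_mono mult_left_mono; simp)+
        then show ?case
          using lower[of "z + r t" t] R(3)[of t "z + r t"] by (auto simp: b_def B_def)
      qed
      moreover have "b \<le> norm (R t x)" "norm (R t x) \<le> B" for t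
        using lower[of x t] R(3)[of t x] by (auto simp: b_def B_def)
      ultimately obtain c and t :: "nat \<Rightarrow> real" where c: "c \<noteq> 0" "filterlim t at_top sequentially"
          "(\<lambda>n. R (t n) (z + r (t n)) - c *\<^sub>R R (t n) x) \<longlonglongrightarrow> 0"
        using proj_dist_tendsto_0_imp_parallel[OF d b, of "\<lambda>t. R t x" B "\<lambda>t. R t (z + r t)"] lim by metis
      have "(\<lambda>n. (R (t n) (z + r (t n)) - c *\<^sub>R R (t n) x) - R (t n) (r (t n))) \<longlonglongrightarrow> 0 - 0"
        using filterlim_compose[OF shrink[OF r(1)] c(2)] c(3) by (intro tendsto_diff) auto
      then have "(\<lambda>n. R (t n) (z - c *\<^sub>R x)) \<longlonglongrightarrow> 0"
        by (simp add: linear_add[OF R(1)] linear_diff[OF R(1)] linear_scale[OF R(1)])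
      then have "(\<lambda>n. norm (R (t n) (z - c *\<^sub>R x))) \<longlonglongrightarrow> 0" by (rule tendsto_norm_zero)
      then have "norm (z - c *\<^sub>R x) / C \<le> 0"
        by (rule Lim_bounded2) (use lower in auto)
      then have "z = c *\<^sub>R x" using R(2) by (simp add: divide_le_0_iff)
      then show "\<exists>c. c \<noteq> 0 \<and> z = c *\<^sub>R x" using c(1) by blast
    next
      assume "\<exists>c. c \<noteq> 0 \<and> z = c *\<^sub>R x"
      then obtain c where c: "c \<noteq> 0" "z = c *\<^sub>R x" by blast
      have "proj (R t (z + r t)) = proj (R t (x + (1 / c) *\<^sub>R r t))" for t
      proof -
        have "z + r t = c *\<^sub>R (x + (1 / c) *\<^sub>R r t)" using c by (simp add: scaleR_add_right)
        then show ?thesis using c(1) by (simp add: linear_scale[OF R(1)] proj_scaleR)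
      qed
      moreover have "((\<lambda>t. d (proj (R t x)) (proj (R t (x + (1 / c) *\<^sub>R r t)))) \<longlongrightarrow> 0) at_top"
      proof (rule proj_dist_tendsto_0[OF d])
        show "norm x / C > 0" using x R(2) by simp
        show "norm x / C \<le> norm (R t x)" "norm (R t x) \<le> C * norm x" for t using lower R(3) by auto
        have "((\<lambda>t. (1 / c) *\<^sub>R r t) \<longlongrightarrow> 0) at_top" using tendsto_scaleR[OF tendsto_const r(1), of "1 / c"] by simp
        from shrink[OF this] show "((\<lambda>t. R t (x + (1 / c) *\<^sub>R r t) - R t x) \<longlongrightarrow> 0) at_top"
          by (simp add: linear_add[OF R(1)])
      qed
      ultimately show "((\<lambda>t. d (proj (R t x)) (proj (R t (z + r t)))) \<longlongrightarrow> 0) at_top" by simp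
    qed
    finally show ?thesis by (simp add: z_def)
  qed
  show ?thesis
  proof (intro equalityI subsetI)
    fix q assume q: "q \<in> stable_manifold (proj_set UNIV) d (proj_flow A) (proj x)"
    then obtain y where y: "y \<noteq> 0" "q = proj y" by (auto simp: stable_manifold_def proj_set_def)
    obtain j where "(N ^^ j) y \<noteq> 0" "(N ^^ Suc j) y = 0" using last_nonzero_iterate[OF N(2) y(1)] .
    from key[OF this] show "q \<in> proj ` {y. \<exists>j c. c \<noteq> 0 \<and> (N ^^ j) y = c *\<^sub>R x}"
      using q y(2) by (auto simp: stable_manifold_def)
  next
    fix q assume "q \<in> proj ` {y. \<exists>j c. c \<noteq> 0 \<and> (N ^^ j) y = c *\<^sub>R x}"
    then obtain y j c where y: "q = proj y" "c \<noteq> 0" "(N ^^ j) y = c *\<^sub>R x" by auto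
    then have nz: "(N ^^ j) y \<noteq> 0" using x(1) by simp
    then have "y \<noteq> 0" using linear_0[OF linear_funpow[OF N(1), of j]] by auto
    moreover have "(N ^^ Suc j) y = 0" using y x(2) by (simp add: linear_scale[OF N(1)])
    ultimately show "q \<in> stable_manifold (proj_set UNIV) d (proj_flow A) (proj x)"
      using key[OF nz] y by (auto simp: stable_manifold_def proj_set_def)
  qed
qed

text \<open>
  For \<open>j < k\<close> a vector \<open>y\<close> with \<open>(N ^^ j) y\<close> parallel to \<open>x\<close> lies in the kernel of \<open>N ^^ k\<close>, since \<open>N x = 0\<close>;
  for \<open>j = k\<close> it differs from a multiple of \<open>y0\<close> by such a vector; and \<open>j > k\<close> is excluded since \<open>x\<close> is not in the
  range of \<open>N ^^ Suc k\<close>. So the stable manifold is squeezed between \<open>y0 + L\<close> and \<open>span (insert y0 L)\<close>.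
\<close>

theorem stable_manifold_has_dimension:
  fixes A N :: "'a::euclidean_space \<Rightarrow> 'a" and d :: "'a set \<Rightarrow> 'a set \<Rightarrow> real"
  assumes d: "Metric_space (proj_set UNIV) d" "Metric_space.mtopology (proj_set UNIV) d = proj_topology"
    and A: "linear A" and N: "linear N" "\<And>x. A (N x) = N (A x)" "\<And>x. (N ^^ Suc m) x = 0"
    and rot: "span {x. \<exists>\<alpha> y. rotates (\<lambda>x. A x - N x) \<alpha> x y} = UNIV"
    and x: "x \<noteq> 0" "N x = 0" "x \<in> range (N ^^ k)" "x \<notin> range (N ^^ Suc k)"
  shows "has_dimension
    (subtopology proj_topology (stable_manifold (proj_set UNIV) d (proj_flow A) (proj x)))
    (int (dim {y. (N ^^ k) y = 0}))"
proof -
  interpret M: Metric_space "proj_set UNIV :: 'a set set" d by fact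
  obtain R C where R: "\<And>t :: real. linear (R t)" "C > 0" "\<And>t x. norm (R t x) \<le> C * norm x"
      "\<And>t x. R (- t) (R t x) = x" "\<And>t x. lin_exp A t x = (\<Sum>k\<le>m. (t ^ k / fact k) *\<^sub>R R t ((N ^^ k) x))"
    by (rule bounded_propagator[OF A N rot]) blast
  note st = stable_manifold_eq[OF d A N(1,3) R x(1,2)]
  note lin = linear_funpow[OF N(1)]
  define L where "L = {y. (N ^^ k) y = 0}"
  have L: "subspace L" unfolding L_def by (rule linear_subspace_kernel[OF lin])
  obtain y0 where y0: "x = (N ^^ k) y0" using x(3) by blast
  have "y0 \<notin> L" using x(1) y0 by (simp add: L_def)
  have "proj ` ((+) y0 ` L) \<subseteq> proj ` {y. \<exists>j c. c \<noteq> 0 \<and> (N ^^ j) y = c *\<^sub>R x}"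
  proof (intro image_mono subsetI CollectI)
    fix y assume "y \<in> (+) y0 ` L"
    then have "(N ^^ k) y = 1 *\<^sub>R x" using y0 by (auto simp: L_def linear_add[OF lin])
    then show "\<exists>j c. c \<noteq> 0 \<and> (N ^^ j) y = c *\<^sub>R x" using zero_neq_one by metis
  qed
  moreover have "proj ` {y. \<exists>j c. c \<noteq> 0 \<and> (N ^^ j) y = c *\<^sub>R x} \<subseteq> proj_set (span (insert y0 L))"
    unfolding proj_set_def
  proof (intro image_mono subsetI)
    fix y assume "y \<in> {y. \<exists>j c. c \<noteq> 0 \<and> (N ^^ j) y = c *\<^sub>R x}"
    then obtain j c where jc: "c \<noteq> 0" "(N ^^ j) y = c *\<^sub>R x" by blast
    have "y \<noteq> 0" using jc x(1) linear_0[OF lin, of j] by auto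
    have "j \<le> k"
    proof (rule ccontr)
      assume "\<not> j \<le> k"
      then have "(N ^^ Suc k) ((N ^^ (j - Suc k)) y) = c *\<^sub>R x"
        by (metis comp_apply funpow_add le_add_diff_inverse not_less_eq_eq jc(2))
      then have "(N ^^ Suc k) ((1 / c) *\<^sub>R (N ^^ (j - Suc k)) y) = x"
        using jc(1) by (simp only: linear_scale[OF lin]) simp
      then show False using x(4) by blast
    qed
    then have *: "(N ^^ k) y = (N ^^ (k - j)) (c *\<^sub>R x)"
      by (metis jc(2) comp_apply funpow_add le_add_diff_inverse2)
    have "\<exists>a. (N ^^ k) y = (N ^^ k) (a *\<^sub>R y0)"
    proof (cases "j = k")
      case True
      then show ?thesis using jc(2) y0 by (auto simp: linear_scale[OF lin])
    next
      case False
      then obtain i where "k - j = Suc i" using \<open>j \<le> k\<close> by (metis Suc_diff_Suc le_neq_implies_less)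
      then have "(N ^^ k) y = (N ^^ k) (0 *\<^sub>R y0)"
        using * x(2) by (simp add: funpow_swap1 linear_scale[OF N(1)] linear_0[OF N(1)] linear_0[OF lin])
      then show ?thesis by blast
    qed
    then obtain a where "y - a *\<^sub>R y0 \<in> L" by (auto simp: L_def linear_diff[OF lin])
    then have "y \<in> span (insert y0 L)" using span_breakdown_eq[of y y0 L] span_base by blast
    then show "y \<in> span (insert y0 L) - {0}" using \<open>y \<noteq> 0\<close> by simp
  qed
  moreover have "Hausdorff_space (proj_topology :: 'a set topology)"
    using M.Hausdorff_space_mtopology d(2) by simp
  ultimately show ?thesis
    unfolding st L_def[symmetric] using has_dimension_proj_between[OF _ L \<open>y0 \<notin> L\<close>] by simp
qed

section \<open>Jordan chains and Jordan blocks\<close>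

text \<open>
  A Jordan chain together with its scalars: \<open>P j c\<close> stands for \<open>c\<close> times the \<open>j\<close>-th chain vector. With
  scalars \<open>real\<close> this is a real chain in the space itself, with scalars \<open>complex\<close> a complex chain in the
  complexification, and both are treated at once as real vector spaces.
\<close>

locale jordan_string =
  fixes T :: "'v::euclidean_space \<Rightarrow> 'v" and P :: "nat \<Rightarrow> 'k::euclidean_space \<Rightarrow> 'v" and s :: nat
  assumes lin_T: "linear T" and lin_P: "linear (P j)"
    and T_0: "T (P 0 c) = 0" and T_Suc: "Suc j < s \<Longrightarrow> T (P (Suc j) c) = P j c"
    and P_0: "P 0 c = 0 \<Longrightarrow> c = 0"
begin

definition string_span :: "nat \<Rightarrow> 'v set"
  where "string_span n = {\<Sum>j<n. P j (c j) | c. True}"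

lemma string_span_0: "string_span 0 = {0}"
  by (simp add: string_span_def)

lemma string_span_Suc: "string_span (Suc n) = {u + w | u w. u \<in> string_span n \<and> w \<in> range (P n)}"
proof (intro equalityI subsetI)
  fix x assume "x \<in> {u + w | u w. u \<in> string_span n \<and> w \<in> range (P n)}"
  then obtain c a where x: "x = (\<Sum>j<n. P j (c j)) + P n a" by (auto simp: string_span_def)
  have "x = (\<Sum>j<Suc n. P j ((c(n := a)) j))" by (simp add: x)
  then show "x \<in> string_span (Suc n)" unfolding string_span_def by blast
qed (auto simp: string_span_def)

lemma subspace_range_P: "subspace (range (P n))"
  using linear_subspace_image[OF lin_P subspace_UNIV] .

lemma subspace_string_span: "subspace (string_span n)"
  by (induction n) (simp_all add: string_span_0 string_span_Suc subspace_single_0 subspace_sums subspace_range_P)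

lemma P_in_string_span: "j < n \<Longrightarrow> P j c \<in> string_span n"
proof (induction n)
  case (Suc n)
  have "P j c + 0 \<in> string_span (Suc n)" if "j < n"
    using Suc.IH[OF that] linear_0[OF lin_P, of n] unfolding string_span_Suc by (auto simp del: add_0_right intro!: exI)
  moreover have "0 + P n c \<in> string_span (Suc n)"
    using subspace_0[OF subspace_string_span, of n] unfolding string_span_Suc by blast
  ultimately show ?case using Suc.prems by (cases "j = n") auto
qed simp

lemma string_span_subset:
  assumes "subspace S" "\<And>j c. j < n \<Longrightarrow> P j c \<in> S"
  shows "string_span n \<subseteq> S"
  unfolding string_span_def using assms by (auto intro!: subspace_sum)

lemma T_funpow_P: "i \<le> j \<Longrightarrow> j < s \<Longrightarrow> (T ^^ i) (P j c) = P (j - i) c"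
proof (induction i)
  case (Suc i)
  then have "j - i = Suc (j - Suc i)" by simp
  then have "T (P (j - i) c) = P (j - Suc i) c" using T_Suc[of "j - Suc i" c] Suc.prems by simp
  then show ?case using Suc by simp
qed simp

lemma T_funpow_Suc_P: "j < s \<Longrightarrow> (T ^^ Suc j) (P j c) = 0"
  using T_funpow_P[of j j c] by (simp add: T_0)

lemma T_funpow_zero:
  assumes "n \<le> s" "u \<in> string_span n"
  shows "(T ^^ n) u = 0"
proof -
  note lin = linear_funpow[OF lin_T]
  have "(T ^^ n) (P j c) = 0" if "j < n" for j c
  proof -
    have "(T ^^ n) (P j c) = (T ^^ (n - Suc j)) ((T ^^ Suc j) (P j c))"
      using that by (metis Suc_leI comp_apply funpow_add le_add_diff_inverse2)
    then show ?thesis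
      using T_funpow_Suc_P[of j c] that assms(1) linear_0[OF lin] by (simp del: funpow.simps)
  qed
  then have "string_span n \<subseteq> {u. (T ^^ n) u = 0}"
    by (intro string_span_subset linear_subspace_kernel[OF lin]) auto
  then show ?thesis using assms(2) by blast
qed

lemma T_string_span:
  assumes "n \<le> s" "u \<in> string_span n"
  shows "T u \<in> string_span n"
proof -
  have "T (P j c) \<in> string_span n" if "j < n" for j c
    using that assms(1) T_Suc[of "j - 1" c] P_in_string_span[of "j - 1" n c] subspace_0[OF subspace_string_span]
    by (cases j) (simp_all add: T_0)
  then have "string_span n \<subseteq> T -` string_span n"
    by (intro string_span_subset linear_subspace_vimage[OF lin_T subspace_string_span]) auto
  then show ?thesis using assms(2) by blast
qed

lemma inj_P: "j < s \<Longrightarrow> P j c = 0 \<Longrightarrow> c = 0"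
  using T_funpow_P[of j j c] linear_0[OF linear_funpow[OF lin_T]] by (auto intro: P_0)

lemma dim_string_span: "n \<le> s \<Longrightarrow> dim (string_span n) = n * DIM('k)"
proof (induction n)
  case (Suc n)
  have "u = 0" if u: "u \<in> string_span n" "u \<in> range (P n)" for u
  proof -
    obtain c where c: "u = P n c" using u(2) by blast
    have "P 0 c = 0" using T_funpow_zero[OF _ u(1)] T_funpow_P[of n n c] Suc.prems c by simp
    then show ?thesis using c P_0 linear_0[OF lin_P] by auto
  qed
  then have "string_span n \<inter> range (P n) \<subseteq> {0}" by blast
  then have "dim (string_span n \<inter> range (P n)) = 0" by (simp only: dim_eq_0)
  moreover have "inj (P n)"
    using inj_P[of n] Suc.prems by (simp add: linear_injective_0[OF lin_P])
  then have "dim (range (P n)) = DIM('k)"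
    using dim_image_eq[OF lin_P, of n UNIV] by simp
  ultimately show ?case
    using dim_sums_Int[OF subspace_string_span subspace_range_P, of n n] Suc
    by (simp add: string_span_Suc del: dim_eq_0)
qed (simp add: string_span_0)

lemma kernel_string_span: "n \<le> s \<Longrightarrow> u \<in> string_span n \<Longrightarrow> T u = 0 \<Longrightarrow> u \<in> range (P 0)"
proof (induction n arbitrary: u)
  case 0
  then show ?case using linear_0[OF lin_P, of 0] by (auto simp: string_span_0 intro: range_eqI[of _ _ 0])
next
  case (Suc n)
  then obtain u' c where u: "u = u' + P n c" "u' \<in> string_span n" by (auto simp: string_span_Suc)
  show ?case
  proof (cases n)
    case 0
    then show ?thesis using u by (simp add: string_span_0)
  next
    case (Suc l)
    note lin = linear_funpow[OF lin_T]
    have "(T ^^ n) u = P 0 c"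
      using T_funpow_zero[OF _ u(2)] T_funpow_P[of n n c] Suc.prems(1) \<open>Suc n \<le> s\<close> u(1) by (simp add: linear_add[OF lin])
    moreover have "(T ^^ n) u = 0" using \<open>T u = 0\<close> linear_0[OF lin] Suc by (simp add: funpow_swap1)
    ultimately have "c = 0" using P_0 by simp
    then have "u = u'" using u linear_0[OF lin_P] by simp
    then show ?thesis using Suc.IH u(2) \<open>T u = 0\<close> \<open>Suc n \<le> s\<close> by simp
  qed
qed

lemma kernel_in_range:
  assumes "s \<ge> 1" "u \<in> string_span s" "T u = 0"
  shows "u \<in> (T ^^ (s - 1)) ` string_span s"
proof -
  obtain c where "u = P 0 c" using kernel_string_span[OF _ assms(2,3)] by auto
  then have "u = (T ^^ (s - 1)) (P (s - 1) c)" using T_funpow_P[of "s - 1" "s - 1" c] assms(1) by simp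
  then show ?thesis using P_in_string_span[of "s - 1" s c] assms(1) by simp
qed

end

text \<open>
  Generalised eigenspaces for different eigenvalues meet trivially: on a nonzero vector of the
  intersection one could lower \<open>a\<close> and \<open>b\<close> until both maps vanish, contradicting injectivity of their
  difference.
\<close>

lemma commuting_nilpotents_kernel:
  fixes T T' :: "'v::real_vector \<Rightarrow> 'v"
  assumes lin: "linear T" "linear T'" and comm: "\<And>u. T (T' u) = T' (T u)"
    and inj: "\<And>u. T u = T' u \<Longrightarrow> u = 0"
  shows "(T ^^ a) u = 0 \<Longrightarrow> (T' ^^ b) u = 0 \<Longrightarrow> u = 0"
proof (induction "a + b" arbitrary: a b u rule: less_induct)
  case less
  show ?case
  proof (cases "a = 0 \<or> b = 0")
    case True
    then show ?thesis using less.prems by auto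
  next
    case False
    have c1: "(T' ^^ k) (T v) = T ((T' ^^ k) v)" and c2: "(T ^^ k) (T' v) = T' ((T ^^ k) v)" for k v
      by (induction k) (simp_all add: comm)
    have "T u = 0"
      using False less.prems linear_0[OF lin(1)]
      by (intro less.hyps[of "a - 1" b "T u"]) (auto simp: c1 funpow_swap1[symmetric] gr0_conv_Suc simp flip: funpow_swap1)
    moreover have "T' u = 0"
      using False less.prems linear_0[OF lin(2)]
      by (intro less.hyps[of a "b - 1" "T' u"]) (auto simp: c2 gr0_conv_Suc simp flip: funpow_swap1)
    ultimately show ?thesis using inj by simp
  qed
qed


text \<open>
  What is needed of a Jordan block of size \<open>s\<close>: the nilpotent part \<open>N\<close>, the rotations
  generated by \<open>A - N\<close>, and the fact that all chains in the block have full length, so that the kernel of \<open>N\<close>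
  is reached by \<open>s - 1\<close> steps. The map \<open>N\<close> is only determined on \<open>U\<close>.
\<close>

definition jordan_block :: "('a::euclidean_space \<Rightarrow> 'a) \<Rightarrow> ('a \<Rightarrow> 'a) \<Rightarrow> nat \<Rightarrow> 'a set \<Rightarrow> bool"
  where "jordan_block A N s U \<longleftrightarrow> subspace U \<and> linear N \<and>
    (\<forall>x\<in>U. N x \<in> U \<and> A x \<in> U \<and> A (N x) = N (A x) \<and> (N ^^ s) x = 0 \<and>
      (N x = 0 \<longrightarrow> x \<in> (N ^^ (s - 1)) ` U) \<and>
      (\<exists>\<alpha>. \<exists>y\<in>U. rotates (\<lambda>x. A x - N x) \<alpha> x y))"

lemma real_string_block:
  fixes A :: "'a::euclidean_space \<Rightarrow> 'a"
  assumes A: "linear A" and s: "s \<ge> 1" and v: "v 0 \<noteq> 0" "A (v 0) = 0" "\<And>j. Suc j < s \<Longrightarrow> A (v (Suc j)) = v j"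
  shows "jordan_block A A s (span (v ` {..<s}))" "dim (span (v ` {..<s})) = s"
proof -
  interpret jordan_string A "\<lambda>j c. c *\<^sub>R v j" s
  proof (rule jordan_string.intro)
    show "linear (\<lambda>c. c *\<^sub>R v j)" for j by (intro linearI) (simp_all add: scaleR_add_left)
  qed (use A v in \<open>simp_all add: linear_scale[OF A]\<close>)
  have "span (v ` {..<s}) = string_span s"
  proof
    have "v j \<in> string_span s" if "j < s" for j using P_in_string_span[OF that, of 1] by simp
    then show "span (v ` {..<s}) \<subseteq> string_span s"
      by (intro span_minimal subspace_string_span) auto
    show "string_span s \<subseteq> span (v ` {..<s})"
      by (intro string_span_subset subspace_span span_scale span_base) auto
  qed
  then show "jordan_block A A s (span (v ` {..<s}))" "dim (span (v ` {..<s})) = s"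
    using T_string_span[of s] T_funpow_zero[of s] kernel_in_range[OF s] dim_string_span[of s]
      subspace_string_span A subspace_0[OF subspace_string_span]
    by (auto simp: jordan_block_def rotates_def simp del: dim_span)
qed

lemma linear_cscale: "linear (cscale c)"
  by (intro linearI) (simp_all add: cscale_def algebra_simps)

lemma linear_cscale_left: "linear (\<lambda>c. cscale c v)"
  by (intro linearI) (simp_all add: cscale_def algebra_simps)

lemma cscale_cscale: "cscale a (cscale b v) = cscale (a * b) v"
  by (simp add: cscale_def algebra_simps)

lemma cscale_of_real: "cscale (complex_of_real r) v = r *\<^sub>R v"
  by (simp add: cscale_def prod_eq_iff)

lemma cscale_eq_0:
  assumes "cscale c v = 0"
  shows "v = 0 \<or> c = 0"
proof -
  have "cscale (cnj c) (cscale c v) = 0" by (simp add: assms linear_0[OF linear_cscale])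
  then have "cscale (complex_of_real ((cmod c)\<^sup>2)) v = 0"
    by (simp only: cscale_cscale complex_norm_square mult.commute)
  then show ?thesis by (simp only: cscale_of_real) auto
qed

lemma linear_map_prod: "linear A \<Longrightarrow> linear (map_prod A A)"
  by (intro linearI) (auto simp: linear_add linear_scale map_prod_def split: prod.splits)

lemma map_prod_cscale: "linear A \<Longrightarrow> map_prod A A (cscale c v) = cscale c (map_prod A A v)"
  by (cases v) (simp add: cscale_def linear_add linear_diff linear_scale)

lemma complex_jordan_string:
  fixes A :: "'a::euclidean_space \<Rightarrow> 'a"
  assumes A: "linear A" and v: "jordan_chain A \<mu> s v"
  shows "jordan_string (\<lambda>u. map_prod A A u - cscale \<mu> u) (\<lambda>j c. cscale c (v j)) s"
proof (rule jordan_string.intro)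
  show "linear (\<lambda>u. map_prod A A u - cscale \<mu> u)"
    by (intro linear_compose_sub linear_map_prod A linear_cscale)
  show "linear (\<lambda>c. cscale c (v j))" for j by (rule linear_cscale_left)
  have v_0: "map_prod A A (v 0) = cscale \<mu> (v 0)" and v_Suc: "Suc j < s \<Longrightarrow> map_prod A A (v (Suc j)) = cscale \<mu> (v (Suc j)) + v j" for j
    using v by (auto simp: jordan_chain_def)
  show "map_prod A A (cscale c (v 0)) - cscale \<mu> (cscale c (v 0)) = 0" for c
    by (simp add: map_prod_cscale[OF A] v_0 cscale_cscale mult.commute)
  show "map_prod A A (cscale c (v (Suc j))) - cscale \<mu> (cscale c (v (Suc j))) = cscale c (v j)" if "Suc j < s" for j c
    by (simp add: map_prod_cscale[OF A] v_Suc[OF that] cscale_cscale mult.commute linear_add[OF linear_cscale])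
  show "cscale c (v 0) = 0 \<Longrightarrow> c = 0" for c
    using cscale_eq_0[of c "v 0"] v by (auto simp: jordan_chain_def)
qed

lemma linear_conj_vec: "linear conj_vec"
  by (intro linearI) (simp_all add: conj_vec_def)

lemma conj_vec_cscale: "conj_vec (cscale c v) = cscale (cnj c) (conj_vec v)"
  by (simp add: conj_vec_def cscale_def)

lemma conj_vec_map_prod: "linear A \<Longrightarrow> conj_vec (map_prod A A v) = map_prod A A (conj_vec v)"
  by (cases v) (simp add: conj_vec_def linear_neg)

lemma conj_vec_conj_vec [simp]: "conj_vec (conj_vec v) = v"
  by (simp add: conj_vec_def)

text \<open>
  A purely imaginary vector is, up to sign, its own conjugate. A generalised eigenvector for \<open>\<mu>\<close> of this
  form is hence also one for \<open>cnj \<mu>\<close>, which is a different number. This makes taking real parts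
  injective on the Jordan subspaces of \<open>\<mu>\<close>.
\<close>

lemma imaginary_generalised_eigenvector:
  fixes A :: "'a::euclidean_space \<Rightarrow> 'a"
  assumes A: "linear A" and "\<mu> \<notin> \<real>"
    and u: "((\<lambda>u. map_prod A A u - cscale \<mu> u) ^^ k) u = 0" "fst u = 0"
  shows "u = 0"
proof -
  define T where "T \<nu> w = map_prod A A w - cscale \<nu> w" for \<nu> w
  have lin: "linear (T \<nu>)" for \<nu>
    unfolding T_def[abs_def] by (intro linear_compose_sub linear_map_prod A linear_cscale)
  have conj: "conj_vec ((T \<mu> ^^ j) w) = (T (cnj \<mu>) ^^ j) (conj_vec w)" for j w
    by (induction j) (simp_all add: T_def linear_diff[OF linear_conj_vec] conj_vec_cscale conj_vec_map_prod[OF A])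
  have "conj_vec u = - u" using u(2) by (simp add: conj_vec_def prod_eq_iff)
  then have "(T (cnj \<mu>) ^^ k) (- u) = conj_vec ((T \<mu> ^^ k) u)" using conj[of k u] by simp
  also have "(T \<mu> ^^ k) u = 0" using u(1) by (simp add: T_def[abs_def])
  finally have "(T (cnj \<mu>) ^^ k) u = 0"
    by (simp add: linear_neg[OF linear_funpow[OF lin]] linear_0[OF linear_conj_vec])
  moreover have "T \<mu> (T (cnj \<mu>) w) = T (cnj \<mu>) (T \<mu> w)" for w
    by (simp add: T_def linear_diff[OF linear_map_prod[OF A]] linear_diff[OF linear_cscale]
        map_prod_cscale[OF A] cscale_cscale mult.commute algebra_simps)
  moreover have "w = 0" if "T \<mu> w = T (cnj \<mu>) w" for w
  proof -
    have "cscale (\<mu> - cnj \<mu>) w = 0"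
      using that linear_diff[OF linear_cscale_left[of w], of \<mu> "cnj \<mu>"] by (simp add: T_def)
    moreover have "\<mu> - cnj \<mu> \<noteq> 0" using \<open>\<mu> \<notin> \<real>\<close> by (metis Reals_cnj_iff eq_iff_diff_eq_0)
    ultimately show ?thesis using cscale_eq_0 by blast
  qed
  ultimately show ?thesis
    using commuting_nilpotents_kernel[OF lin lin, of \<mu> "cnj \<mu>" k u k] u(1) by (simp add: T_def[abs_def])
qed

text \<open>
  Taking real parts identifies the complex Jordan subspace \<open>J\<close> with the real Jordan subspace. The nilpotent
  part of the complexification is transported along this identification, and multiplication by \<open>\<i>\<close>
  on \<open>J\<close> supplies the rotation partner of a vector.
\<close>

lemma complex_string_block:
  fixes A :: "'a::euclidean_space \<Rightarrow> 'a"
  assumes A: "linear A" and v: "jordan_chain A (\<i> * complex_of_real \<alpha>) s v" and "\<alpha> \<noteq> 0"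
    and J: "J = {\<Sum>j<s. cscale (c j) (v j) | c. True}"
  shows "{x. \<exists>u\<in>J. \<exists>w\<in>J. (x, 0) = u + conj_vec w} = fst ` J"
    and "\<exists>N. jordan_block A N s (fst ` J)" and "dim (fst ` J) = 2 * s"
proof -
  define \<mu> where "\<mu> = \<i> * complex_of_real \<alpha>"
  define T where "T u = map_prod A A u - cscale \<mu> u" for u
  interpret jordan_string T "\<lambda>j c. cscale c (v j)" s
    using complex_jordan_string[OF A v] by (simp add: T_def[abs_def] \<mu>_def)
  have J_eq: "J = string_span s" unfolding J string_span_def ..
  have subJ: "subspace J" unfolding J_eq by (rule subspace_string_span)
  have s: "s \<ge> 1" using v by (simp add: jordan_chain_def)
  have JT: "T u \<in> J" if "u \<in> J" for u using T_string_span[of s u] that by (simp add: J_eq)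
  have J0: "(T ^^ s) u = 0" if "u \<in> J" for u using T_funpow_zero[of s u] that by (simp add: J_eq)
  have Jc: "cscale a u \<in> J" if "u \<in> J" for a u
  proof -
    have "string_span s \<subseteq> cscale a -` string_span s"
      by (intro string_span_subset linear_subspace_vimage[OF linear_cscale subspace_string_span])
         (auto simp: cscale_cscale P_in_string_span)
    then show ?thesis using that by (auto simp: J_eq)
  qed
  have "\<mu> \<notin> \<real>" using \<open>\<alpha> \<noteq> 0\<close> by (simp add: \<mu>_def complex_is_Real_iff)
  then have fst0: "u = 0" if "u \<in> J" "fst u = 0" for u
    using imaginary_generalised_eigenvector[OF A _ _ that(2), of \<mu> s] J0[OF that(1)] by (simp add: T_def[abs_def])
  have inj: "inj_on fst J"
  proof (rule inj_onI)
    fix u w assume "u \<in> J" "w \<in> J" "fst u = fst w"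
    then have "u - w = 0" by (intro fst0 subspace_diff[OF subJ]) auto
    then show "u = w" by simp
  qed
  show "{x. \<exists>u\<in>J. \<exists>w\<in>J. (x, 0) = u + conj_vec w} = fst ` J"
  proof (intro equalityI subsetI)
    fix x assume "x \<in> {x. \<exists>u\<in>J. \<exists>w\<in>J. (x, 0) = u + conj_vec w}"
    then obtain u w where "u \<in> J" "w \<in> J" "(x, 0) = u + conj_vec w" by blast
    then have "u + w \<in> J" "x = fst (u + w)" by (auto simp: subspace_add[OF subJ] conj_vec_def prod_eq_iff)
    then show "x \<in> fst ` J" by blast
  next
    fix x assume "x \<in> fst ` J"
    then obtain u where u: "u \<in> J" "x = fst u" by blast
    then have "(1/2) *\<^sub>R u \<in> J" "(x, 0) = (1/2) *\<^sub>R u + conj_vec ((1/2) *\<^sub>R u)"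
      by (auto simp: subspace_scale[OF subJ] conj_vec_def prod_eq_iff simp flip: scaleR_add_left)
    then show "x \<in> {x. \<exists>u\<in>J. \<exists>w\<in>J. (x, 0) = u + conj_vec w}" by blast
  qed
  have linfst: "linear (fst :: 'a \<times> 'a \<Rightarrow> 'a)" by (rule bounded_linear.linear[OF bounded_linear_fst])
  show "dim (fst ` J) = 2 * s"
    using dim_image_eq[OF linfst, of J] inj subJ dim_string_span[of s] by (simp add: span_eq_iff[THEN iffD2] J_eq)
  obtain g where g: "linear g" "\<And>u. u \<in> J \<Longrightarrow> g (fst u) = u"
    using linear_exists_left_inverse_on[OF linfst subJ inj] by blast
  define N where "N = fst \<circ> T \<circ> g"
  have linN: "linear N" unfolding N_def using linfst lin_T g(1) by (intro linear_compose)
  have N: "N (fst u) = fst (T u)" if "u \<in> J" for u using g(2)[OF that] by (simp add: N_def)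
  have Nk: "(N ^^ k) (fst u) = fst ((T ^^ k) u)" if "u \<in> J" for u k
  proof -
    have "(T ^^ k) u \<in> J" for k by (induction k) (simp_all add: that JT)
    then show ?thesis by (induction k) (simp_all add: N)
  qed
  have MJ: "map_prod A A u \<in> J" if "u \<in> J" for u
    using subspace_add[OF subJ JT[OF that] Jc[OF that, of \<mu>]] by (simp add: T_def)
  have TM: "T (map_prod A A u) = map_prod A A (T u)" for u
    by (simp add: T_def linear_diff[OF linear_map_prod[OF A]] map_prod_cscale[OF A])
  have A_fst: "A (fst u) = fst (map_prod A A u)" for u by simp
  have "jordan_block A N s (fst ` J)"
    unfolding jordan_block_def
  proof (intro conjI ballI impI)
    show "subspace (fst ` J)" using linear_subspace_image[OF linfst subJ] .
    fix x assume "x \<in> fst ` J"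
    then obtain u where u: "u \<in> J" "x = fst u" by blast
    show "N x \<in> fst ` J" using u by (simp add: N JT)
    show "A x \<in> fst ` J" using u MJ by (simp only: A_fst) blast
    show "A (N x) = N (A x)" using u MJ[OF u(1)] by (simp only: A_fst N TM)
    show "(N ^^ s) x = 0" using u by (simp add: Nk J0)
    show "x \<in> (N ^^ (s - 1)) ` fst ` J" if "N x = 0"
    proof -
      have "T u = 0" using that u by (intro fst0 JT) (simp_all add: N)
      then obtain w where "w \<in> J" "u = (T ^^ (s - 1)) w" using kernel_in_range[OF s, of u] u(1) unfolding J_eq by blast
      then show ?thesis using u by (auto simp: Nk intro!: image_eqI[of _ _ "fst w"])
    qed
    have S: "A (fst w) - N (fst w) = fst (cscale \<mu> w)" if "w \<in> J" for w
      using that by (simp add: N T_def)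
    have "snd u = fst (cscale (- \<i>) u)" by (simp add: cscale_def)
    moreover have "rotates (\<lambda>x. A x - N x) \<alpha> (fst u) (fst (cscale (- \<i>) u))"
      unfolding rotates_def S[OF u(1)] S[OF Jc[OF u(1)]]
      by (simp add: cscale_def \<mu>_def)
    ultimately show "\<exists>\<alpha>. \<exists>y\<in>fst ` J. rotates (\<lambda>x. A x - N x) \<alpha> x y" using u Jc by blast
  qed (rule linN)
  then show "\<exists>N. jordan_block A N s (fst ` J)" by blast
qed

section \<open>Sizes of the summands\<close>

lemma jordan_chain_length_le:
  fixes A :: "'a::euclidean_space \<Rightarrow> 'a"
  assumes "linear A" "jordan_chain A \<mu> s v"
  shows "s \<le> DIM('a)"
proof -
  interpret jordan_string "\<lambda>u. map_prod A A u - cscale \<mu> u" "\<lambda>j c. cscale c (v j)" s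
    by (rule complex_jordan_string[OF assms])
  have "2 * s \<le> DIM('a \<times> 'a)"
    using dim_string_span[of s] dim_subset_UNIV[of "string_span s"] by simp
  then show ?thesis by simp
qed

lemma jordan_length_le_s_max:
  assumes "linear A" "complex_jordan_subspace A \<mu> s J"
  shows "s \<le> s_max A"
  unfolding s_max_def
proof (rule Max_ge)
  show "finite {s. \<exists>\<mu> J. complex_jordan_subspace A \<mu> s J}"
    by (rule finite_subset[of _ "{..DIM('a)}"])
       (auto simp: complex_jordan_subspace_def jordan_chain_length_le[OF assms(1)])
qed (use assms(2) in blast)

lemma real_jordan_subspace_0:
  assumes A: "linear A" and U: "real_jordan_subspace A 0 U"
  shows "jordan_block A A (dim U) U" "dim U \<ge> 1" "dim U \<le> s_max A"
proof -
  obtain s v where v: "jordan_chain A 0 s (\<lambda>j. (v j, 0))" "U = span (v ` {..<s})"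
    using U by (auto simp: real_jordan_subspace_def)
  have s: "s \<ge> 1" and v0: "v 0 \<noteq> 0" and Av: "\<And>j. j < s \<Longrightarrow> A (v j) = (if j = 0 then 0 else v (j - 1))"
    using v(1) by (auto simp: jordan_chain_def cscale_def zero_prod_def prod_eq_iff split: if_splits)
  have "A (v 0) = 0" "\<And>j. Suc j < s \<Longrightarrow> A (v (Suc j)) = v j" using Av s by auto
  then have "jordan_block A A s U" "dim U = s"
    using real_string_block[of A s v, OF A s v0] unfolding v(2) by blast+
  moreover have "s \<le> s_max A"
    using v(1) by (intro jordan_length_le_s_max[OF A, of 0 s]) (auto simp: complex_jordan_subspace_def)
  ultimately show "jordan_block A A (dim U) U" "dim U \<ge> 1" "dim U \<le> s_max A" using s by auto
qed

text \<open>
  Conjugation turns a chain for \<open>\<i> * \<alpha>\<close> into one for \<open>- \<i> * \<alpha>\<close> with the same real part, so the sign of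
  \<open>\<alpha>\<close> does not matter. The vector \<open>x\<close> distinguishes such subspaces from those for the
  eigenvalue 0.
\<close>

lemma real_jordan_subspace_imaginary:
  assumes A: "linear A" and \<alpha>: "\<alpha> \<noteq> 0" and U: "real_jordan_subspace A (\<i> * complex_of_real \<alpha>) U"
  obtains s N x where "jordan_block A N s U" "dim U = 2 * s" "s \<ge> 1" "s \<le> s_max A"
    "real_jordan_subspace A (\<i> * complex_of_real (- \<alpha>)) U"
    "x \<in> U" "x \<noteq> 0" "A (A x) = - (\<alpha>\<^sup>2) *\<^sub>R x"
proof -
  have nonreal: "\<i> * complex_of_real \<beta> \<notin> \<real>" if "\<beta> \<noteq> 0" for \<beta> using that by (simp add: complex_is_Real_iff)
  obtain s J where J: "complex_jordan_subspace A (\<i> * complex_of_real \<alpha>) s J"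
      "U = {x. \<exists>u\<in>J. \<exists>w\<in>J. (x, 0) = u + conj_vec w}"
    using U nonreal[OF \<alpha>] by (auto simp: real_jordan_subspace_def)
  then obtain v where v: "jordan_chain A (\<i> * complex_of_real \<alpha>) s v" and J_eq: "J = {\<Sum>j<s. cscale (c j) (v j) | c. True}"
    by (auto simp: complex_jordan_subspace_def)
  have s: "s \<ge> 1" using v by (simp add: jordan_chain_def)
  note block = complex_string_block[OF A v \<alpha> J_eq]
  have U_eq: "U = fst ` J" using J(2) block(1) by simp
  obtain N where N: "jordan_block A N s U" using block(2) unfolding U_eq by blast
  have chain': "jordan_chain A (\<i> * complex_of_real (- \<alpha>)) s (conj_vec \<circ> v)"
    unfolding jordan_chain_def
  proof (intro conjI allI impI)
    show "1 \<le> s" by fact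
    show "(conj_vec \<circ> v) 0 \<noteq> 0"
      using v by (auto simp: jordan_chain_def conj_vec_def prod_eq_iff)
    fix j assume "j < s"
    then have "map_prod A A (v j) = cscale (\<i> * complex_of_real \<alpha>) (v j) + (if j = 0 then 0 else v (j - 1))"
      using v by (simp add: jordan_chain_def)
    from arg_cong[OF this, of conj_vec]
    show "map_prod A A ((conj_vec \<circ> v) j) = cscale (\<i> * complex_of_real (- \<alpha>)) ((conj_vec \<circ> v) j) + (if j = 0 then 0 else (conj_vec \<circ> v) (j - 1))"
      by (simp add: conj_vec_map_prod[OF A] linear_add[OF linear_conj_vec] linear_0[OF linear_conj_vec] conj_vec_cscale)
  qed
  have "complex_jordan_subspace A (\<i> * complex_of_real (- \<alpha>)) s (conj_vec ` J)"
    unfolding complex_jordan_subspace_def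
  proof (intro exI[of _ "conj_vec \<circ> v"] conjI chain')
    have *: "conj_vec (\<Sum>j<s. cscale (c j) (v j)) = (\<Sum>j<s. cscale (cnj (c j)) ((conj_vec \<circ> v) j))" for c
      by (simp add: linear_sum[OF linear_conj_vec] conj_vec_cscale)
    show "conj_vec ` J = {\<Sum>j<s. cscale (c j) ((conj_vec \<circ> v) j) | c. True}"
    proof (intro equalityI subsetI)
      fix x assume "x \<in> {\<Sum>j<s. cscale (c j) ((conj_vec \<circ> v) j) | c. True}"
      then obtain c where "x = (\<Sum>j<s. cscale (c j) ((conj_vec \<circ> v) j))" by blast
      then have "x = conj_vec (\<Sum>j<s. cscale (cnj (c j)) (v j))" unfolding * by simp
      moreover have "(\<Sum>j<s. cscale (cnj (c j)) (v j)) \<in> J"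
        unfolding J_eq by (intro CollectI exI[of _ "\<lambda>j. cnj (c j)"]) simp
      ultimately show "x \<in> conj_vec ` J" by (rule image_eqI)
    next
      fix x assume "x \<in> conj_vec ` J"
      then obtain c where "x = conj_vec (\<Sum>j<s. cscale (c j) (v j))" unfolding J_eq by blast
      then show "x \<in> {\<Sum>j<s. cscale (c j) ((conj_vec \<circ> v) j) | c. True}"
        unfolding * by (intro CollectI exI[of _ "\<lambda>j. cnj (c j)"]) simp
    qed
  qed
  moreover have "U = {x. \<exists>u\<in>conj_vec ` J. \<exists>w\<in>conj_vec ` J. (x, 0) = u + conj_vec w}"
    unfolding J(2) by (auto simp: add.commute)
  ultimately have conj: "real_jordan_subspace A (\<i> * complex_of_real (- \<alpha>)) U"
    using nonreal[of "- \<alpha>"] \<alpha> unfolding real_jordan_subspace_def by (simp only: neg_equal_0_iff_equal not_False_eq_True if_False simp_thms) blast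
  interpret str: jordan_string "\<lambda>u. map_prod A A u - cscale (\<i> * complex_of_real \<alpha>) u" "\<lambda>j c. cscale c (v j)" s
    by (rule complex_jordan_string[OF A v])
  have "cscale 1 (v 0) \<in> J"
    using str.P_in_string_span[of 0 s 1] s by (simp only: J_eq str.string_span_def)
  then have "v 0 \<in> J" by (simp add: cscale_def)
  have Av: "A (fst (v 0)) = - \<alpha> *\<^sub>R snd (v 0)" "A (snd (v 0)) = \<alpha> *\<^sub>R fst (v 0)" and v0: "v 0 \<noteq> 0"
    using v s by (auto simp: jordan_chain_def cscale_def prod_eq_iff)
  have "fst (v 0) \<noteq> 0"
    using Av(1) v0 \<alpha> linear_0[OF A] by (auto simp: prod_eq_iff)
  moreover have "A (A (fst (v 0))) = - (\<alpha>\<^sup>2) *\<^sub>R fst (v 0)"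
    unfolding Av(1) linear_scale[OF A] Av(2) by (simp add: power2_eq_square)
  moreover have "fst (v 0) \<in> U" using \<open>v 0 \<in> J\<close> U_eq by blast
  ultimately show ?thesis
    using that[OF N _ s jordan_length_le_s_max[OF A J(1)] conj] block(3) U_eq by blast
qed

text \<open>
  A power of \<open>A\<close> vanishes on a Jordan subspace for 0, whereas \<open>A \<circ> A\<close> has a negative eigenvalue on one for
  \<open>\<i> * \<alpha>\<close>.
\<close>

lemma real_jordan_subspace_types_exclusive:
  assumes A: "linear A" and "\<alpha> \<noteq> 0" "real_jordan_subspace A (\<i> * complex_of_real \<alpha>) U"
  shows "\<not> real_jordan_subspace A 0 U"
proof
  assume "real_jordan_subspace A 0 U"
  then have "jordan_block A A (dim U) U" by (rule real_jordan_subspace_0[OF A])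
  moreover obtain x where x: "x \<in> U" "x \<noteq> 0" "A (A x) = - (\<alpha>\<^sup>2) *\<^sub>R x"
    using real_jordan_subspace_imaginary[OF assms] by metis
  ultimately have nil: "(A ^^ dim U) x = 0" by (simp add: jordan_block_def)
  have "(A ^^ (2 * k)) x = (- (\<alpha>\<^sup>2)) ^ k *\<^sub>R x" for k
    by (induction k) (simp_all add: linear_scale[OF A] x(3))
  then have "(A ^^ (2 * dim U)) x \<noteq> 0" using x(2) \<open>\<alpha> \<noteq> 0\<close> by simp
  moreover have "(A ^^ (2 * dim U)) x = 0"
    using nil linear_0[OF linear_funpow[OF A]] by (simp add: mult_2 funpow_add)
  ultimately show False by simp
qed

text \<open>
  The size \<open>s\<close> of the block agrees with the size read off from the dimension, which is how the summands
  are grouped in \<open>jordan_sum\<close>. The two ways of reading it do not conflict since a summand is of one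
  type only.
\<close>

lemma real_jordan_subspace_block:
  fixes A :: "'a::euclidean_space \<Rightarrow> 'a"
  assumes A: "linear A" and spec: "\<And>\<mu>. is_eigenvalue A \<mu> \<Longrightarrow> Re \<mu> = 0" and U: "real_jordan_subspace A \<mu> U"
  shows "\<exists>N s. jordan_block A N s U \<and> 1 \<le> s \<and> s \<le> s_max A \<and>
    (\<forall>i. (real_jordan_subspace A 0 U \<and> dim U = i) \<or>
         (\<exists>\<alpha>>0. real_jordan_subspace A (\<i> * complex_of_real \<alpha>) U \<and> dim U = 2 * i) \<longleftrightarrow> i = s)"
proof -
  have eigen: "Re \<mu> = 0" if "jordan_chain A \<mu> s v" for s v
  proof (rule spec)
    have "v 0 \<in> complex_eigenspace A \<mu>" "v 0 \<noteq> 0"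
      using that by (auto simp: complex_eigenspace_def jordan_chain_def)
    then show "is_eigenvalue A \<mu>" unfolding is_eigenvalue_def by blast
  qed
  show ?thesis
  proof (cases "\<mu> \<in> \<real>")
    case True
    then have "Re \<mu> = 0" using U eigen by (auto simp: real_jordan_subspace_def)
    then have "\<mu> = 0" using True by (simp add: complex_is_Real_iff complex_eq_iff)
    then have U0: "real_jordan_subspace A 0 U" using U by simp
    have "\<not> real_jordan_subspace A (\<i> * complex_of_real \<alpha>) U" if "\<alpha> > 0" for \<alpha>
      using real_jordan_subspace_types_exclusive[OF A, of \<alpha> U] U0 that by auto
    then show ?thesis using real_jordan_subspace_0[OF A U0] U0
      by (intro exI[of _ A] exI[of _ "dim U"]) auto
  next
    case False
    then have "Re \<mu> = 0" using U eigen by (auto simp: real_jordan_subspace_def complex_jordan_subspace_def)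
    then have mu: "\<mu> = \<i> * complex_of_real (Im \<mu>)" by (simp add: complex_eq_iff)
    have "Im \<mu> \<noteq> 0" using False by (simp add: complex_is_Real_iff)
    have U': "real_jordan_subspace A (\<i> * complex_of_real (Im \<mu>)) U" using U mu by metis
    obtain s N where s: "jordan_block A N s U" "dim U = 2 * s" "s \<ge> 1" "s \<le> s_max A"
        "real_jordan_subspace A (\<i> * complex_of_real (- Im \<mu>)) U"
      using real_jordan_subspace_imaginary[OF A \<open>Im \<mu> \<noteq> 0\<close> U'] by metis
    have "real_jordan_subspace A (\<i> * complex_of_real \<bar>Im \<mu>\<bar>) U"
      using U' s(5) by (cases "Im \<mu> > 0") simp_all
    then have "\<exists>\<alpha>>0. real_jordan_subspace A (\<i> * complex_of_real \<alpha>) U"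
      using \<open>Im \<mu> \<noteq> 0\<close> by (intro exI[of _ "\<bar>Im \<mu>\<bar>"]) simp
    moreover have "\<not> real_jordan_subspace A 0 U"
      by (rule real_jordan_subspace_types_exclusive[OF A \<open>Im \<mu> \<noteq> 0\<close> U'])
    ultimately show ?thesis using s by (intro exI[of _ N] exI[of _ s]) auto
  qed
qed

section \<open>The nilpotent part of the whole map\<close>

locale internal_direct_sum =
  fixes \<D> :: "'a::real_vector set set"
  assumes finite_summands: "finite \<D>" and subspace_summand: "U \<in> \<D> \<Longrightarrow> subspace U"
    and unique_decomposition: "\<exists>!f. f \<in> (\<Pi>\<^sub>E U\<in>\<D>. U) \<and> x = (\<Sum>U\<in>\<D>. f U)"
begin

definition component :: "'a set \<Rightarrow> 'a \<Rightarrow> 'a"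
  where "component U x = (THE f. f \<in> (\<Pi>\<^sub>E U\<in>\<D>. U) \<and> x = (\<Sum>U\<in>\<D>. f U)) U"

lemma component_in: "U \<in> \<D> \<Longrightarrow> component U x \<in> U"
  and sum_component: "(\<Sum>U\<in>\<D>. component U x) = x"
  using theI'[OF unique_decomposition[of x]] by (auto simp: component_def)

lemma component_unique:
  assumes "\<And>U. U \<in> \<D> \<Longrightarrow> f U \<in> U" "x = (\<Sum>U\<in>\<D>. f U)" "U \<in> \<D>"
  shows "component U x = f U"
proof -
  have "(THE f. f \<in> (\<Pi>\<^sub>E U\<in>\<D>. U) \<and> x = (\<Sum>U\<in>\<D>. f U)) = restrict f \<D>"
    using assms(1,2) by (intro the1_equality[OF unique_decomposition]) auto
  then show ?thesis using assms(3) by (simp add: component_def)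
qed

lemma linear_component: "U \<in> \<D> \<Longrightarrow> linear (component U)"
proof (rule linearI)
  fix x y c assume U: "U \<in> \<D>"
  show "component U (x + y) = component U x + component U y"
    using U by (intro component_unique) (auto simp: sum.distrib sum_component intro!: subspace_add subspace_summand component_in)
  show "component U (c *\<^sub>R x) = c *\<^sub>R component U x"
    using U by (intro component_unique) (auto simp: sum_component intro!: subspace_scale subspace_summand component_in simp flip: scaleR_sum_right)
qed

lemma component_same: "U \<in> \<D> \<Longrightarrow> x \<in> U \<Longrightarrow> component U x = x"
  and component_other: "U \<in> \<D> \<Longrightarrow> x \<in> U \<Longrightarrow> U' \<in> \<D> \<Longrightarrow> U' \<noteq> U \<Longrightarrow> component U' x = 0"
  using component_unique[of "\<lambda>U'. if U' = U then x else 0" x] finite_summands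
  by (auto simp: subspace_0 subspace_summand)

lemma component_eqI: "(\<And>U. U \<in> \<D> \<Longrightarrow> component U x = component U y) \<Longrightarrow> x = y"
  by (metis (no_types, lifting) sum.cong sum_component)

end

text \<open>
  Vectors rotated by \<open>A\<close> itself have bounded orbits, whereas the orbit of a vector outside the kernel of
  \<open>N\<close> grows at least linearly.
\<close>

lemma rotates_imp_kernel:
  fixes A N :: "'a::euclidean_space \<Rightarrow> 'a"
  assumes A: "linear A" and N: "linear N" "\<And>x. A (N x) = N (A x)" "\<And>x. (N ^^ Suc m) x = 0"
    and rot: "span {x. \<exists>\<alpha> y. rotates (\<lambda>x. A x - N x) \<alpha> x y} = UNIV"
    and xy: "rotates A \<beta> x y"
  shows "N x = 0"
proof (rule ccontr)
  assume "N x \<noteq> 0"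
  then have "x \<noteq> 0" using linear_0[OF N(1)] by auto
  obtain R C where R: "\<And>t :: real. linear (R t)" "C > 0" "\<And>t x. norm (R t x) \<le> C * norm x"
      "\<And>t x. R (- t) (R t x) = x" "\<And>t x. lin_exp A t x = (\<Sum>k\<le>m. (t ^ k / fact k) *\<^sub>R R t ((N ^^ k) x))"
    by (rule bounded_propagator[OF A N rot]) blast
  obtain j where j: "(N ^^ j) x \<noteq> 0" "(N ^^ Suc j) x = 0"
    using last_nonzero_iterate[OF N(3) \<open>x \<noteq> 0\<close>] .
  have "j \<noteq> 0" using j(2) \<open>N x \<noteq> 0\<close> by (cases j) auto
  define z where "z = (N ^^ j) x"
  obtain r where r: "(r \<longlongrightarrow> 0) at_top"
      "\<And>t. t > 0 \<Longrightarrow> lin_exp A t x = (t ^ j / fact j) *\<^sub>R R t (z + r t)"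
    using propagator_leading_term[OF N(1) N(3) j R(1) R(5)] unfolding z_def by blast
  have bdd: "norm (lin_exp A t x) \<le> norm x + norm y" for t
  proof -
    have "lin_exp A t x = cos (\<beta> * t) *\<^sub>R x - sin (\<beta> * t) *\<^sub>R y"
      using lin_exp_rotates[OF A, of "\<lambda>x. 0" 0 \<beta> x y t] xy by (simp add: linear_0[OF A] linear_zero)
    then show ?thesis
      by (auto intro!: order_trans[OF norm_triangle_ineq4] add_mono mult_left_le_one_le)
  qed
  have "eventually (\<lambda>t. norm (r t) < norm z / 2) at_top"
    using tendstoD[OF r(1), of "norm z / 2"] j(1) by (simp add: z_def)
  then have "eventually (\<lambda>t. t * (norm z / (2 * C * fact j)) \<le> norm x + norm y) at_top"
    using eventually_ge_at_top[of 1]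
  proof eventually_elim
    case (elim t)
    have "norm z / 2 \<le> norm (z + r t)"
      using elim norm_triangle_ineq4[of "z + r t" "r t"] by auto
    also have "\<dots> \<le> C * norm (R t (z + r t))" using R(3)[of "- t" "R t (z + r t)"] R(4) by simp
    finally have "norm z / (2 * C) \<le> norm (R t (z + r t))" using R(2) by (simp add: field_simps)
    moreover have "t / fact j \<le> t ^ j / fact j"
      using elim \<open>j \<noteq> 0\<close> self_le_power[of t j] by (intro divide_right_mono) auto
    ultimately have "(t / fact j) * (norm z / (2 * C)) \<le> (t ^ j / fact j) * norm (R t (z + r t))"
      using elim R(2) by (intro mult_mono) auto
    also have "\<dots> = norm (lin_exp A t x)" using elim by (simp add: r(2))
    finally show ?case using bdd[of t] by (simp add: mult_ac)
  qed
  moreover have "norm z / (2 * C * fact j) > 0" using j(1) R(2) by (simp add: z_def)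
  then have "filterlim (\<lambda>t. t * (norm z / (2 * C * fact j))) at_top at_top"
    by (intro filterlim_at_top_mult_tendsto_pos[OF tendsto_const] filterlim_ident)
  then have "eventually (\<lambda>t. t * (norm z / (2 * C * fact j)) > norm x + norm y) at_top"
    by (simp add: filterlim_at_top_dense)
  ultimately have "eventually (\<lambda>t :: real. False) at_top"
    by eventually_elim simp
  then show False by simp
qed

text \<open>
  Rank-nullity on a subspace: \<open>T\<close> is injective on the orthogonal complement of its kernel in \<open>S\<close>.
\<close>

lemma dim_image_plus_kernel:
  fixes T :: "'a::euclidean_space \<Rightarrow> 'b::euclidean_space"
  assumes T: "linear T" and S: "subspace S"
  shows "dim (T ` S) + dim {x \<in> S. T x = 0} = dim S"
proof -
  define K where "K = {x \<in> S. T x = 0}"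
  define C where "C = {y \<in> S. \<forall>x\<in>K. orthogonal x y}"
  have K: "subspace K" "K \<subseteq> S"
    using subspace_inter[OF S linear_subspace_kernel[OF T]] by (auto simp: K_def Collect_conj_eq)
  have C: "subspace C"
    unfolding C_def using S
    by (auto simp: subspace_def orthogonal_def inner_add_right)
  have KC: "K \<inter> C \<subseteq> {0}" by (auto simp: C_def orthogonal_def K_def)
  have dimS: "dim C + dim K = dim S"
    unfolding C_def by (rule dim_subspace_orthogonal_to_vectors[OF K(1) S K(2)])
  have "dim {x + y | x y. x \<in> K \<and> y \<in> C} = dim S"
    using dim_sums_Int[OF K(1) C] KC dimS by (simp add: dim_eq_0[THEN iffD2])
  then have S_eq: "{x + y | x y. x \<in> K \<and> y \<in> C} = S"
    using K C S by (intro subspace_dim_equal subspace_sums) (auto simp: C_def intro: subspace_add)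
  have "T ` S \<subseteq> T ` C"
  proof (rule image_subsetI)
    fix x assume "x \<in> S"
    then obtain u c where "x = u + c" "u \<in> K" "c \<in> C" unfolding S_eq[symmetric] by blast
    then have "T x = T c" by (simp add: linear_add[OF T] K_def)
    then show "T x \<in> T ` C" using \<open>c \<in> C\<close> by simp
  qed
  then have "T ` S = T ` C" by (auto simp: C_def)
  moreover have "inj_on T C"
  proof (rule inj_onI)
    fix x y assume "x \<in> C" "y \<in> C" "T x = T y"
    then have "x - y \<in> K \<inter> C" using subspace_diff[OF C] by (auto simp: K_def linear_diff[OF T] C_def)
    then show "x = y" using KC by auto
  qed
  then have "dim (T ` C) = dim C" using dim_image_eq[OF T, of C] C by (simp add: span_eq_iff[THEN iffD2])
  ultimately show ?thesis using dimS by (simp add: K_def)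
qed

text \<open>
  A direct sum decomposition into Jordan blocks; \<open>NU U\<close> and \<open>sz U\<close> are the nilpotent part and the size of the
  block \<open>U\<close>.
\<close>

locale jordan_decomposed = internal_direct_sum \<D>
  for \<D> :: "'a::euclidean_space set set" +
  fixes A :: "'a \<Rightarrow> 'a" and NU :: "'a set \<Rightarrow> 'a \<Rightarrow> 'a" and sz :: "'a set \<Rightarrow> nat" and m :: nat
  assumes lin_A: "linear A"
    and block: "U \<in> \<D> \<Longrightarrow> jordan_block A (NU U) (sz U) U"
    and sz: "U \<in> \<D> \<Longrightarrow> 1 \<le> sz U" "U \<in> \<D> \<Longrightarrow> sz U \<le> m"
begin

definition N :: "'a \<Rightarrow> 'a"
  where "N x = (\<Sum>U\<in>\<D>. NU U (component U x))"

lemma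
  assumes "U \<in> \<D>"
  shows linear_NU: "linear (NU U)"
    and NU_in: "x \<in> U \<Longrightarrow> NU U x \<in> U" and A_in: "x \<in> U \<Longrightarrow> A x \<in> U"
    and A_NU: "x \<in> U \<Longrightarrow> A (NU U x) = NU U (A x)"
    and NU_nilpotent: "x \<in> U \<Longrightarrow> (NU U ^^ sz U) x = 0"
    and NU_kernel: "x \<in> U \<Longrightarrow> NU U x = 0 \<Longrightarrow> x \<in> (NU U ^^ (sz U - 1)) ` U"
    and NU_rotates: "x \<in> U \<Longrightarrow> \<exists>\<alpha>. \<exists>y\<in>U. rotates (\<lambda>x. A x - NU U x) \<alpha> x y"
  using block[OF assms] by (auto simp: jordan_block_def)

lemma linear_N: "linear N"
proof -
  have "linear (\<lambda>x. NU U (component U x))" if "U \<in> \<D>" for U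
    using linear_compose[OF linear_component[OF that] linear_NU[OF that]] by (simp add: o_def)
  then show ?thesis unfolding N_def[abs_def] by (intro linear_compose_sum) simp
qed

lemma component_N: "U \<in> \<D> \<Longrightarrow> component U (N x) = NU U (component U x)"
  by (rule component_unique) (auto simp: N_def NU_in component_in)

lemma component_A: "U \<in> \<D> \<Longrightarrow> component U (A x) = A (component U x)"
  by (rule component_unique) (auto simp: A_in component_in sum_component simp flip: linear_sum[OF lin_A])

lemma component_N_funpow: "U \<in> \<D> \<Longrightarrow> component U ((N ^^ k) x) = (NU U ^^ k) (component U x)"
  by (induction k) (simp_all add: component_N)

lemma N_A: "A (N x) = N (A x)"
  by (rule component_eqI) (simp add: component_A component_N A_NU component_in)

lemma NU_funpow_in: "U \<in> \<D> \<Longrightarrow> x \<in> U \<Longrightarrow> (NU U ^^ k) x \<in> U"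
  by (induction k) (simp_all add: NU_in)

lemma NU_funpow_zero:
  assumes "U \<in> \<D>" "x \<in> U" "sz U \<le> k"
  shows "(NU U ^^ k) x = 0"
proof -
  have "(NU U ^^ k) x = (NU U ^^ (k - sz U)) ((NU U ^^ sz U) x)"
    using assms(3) by (metis comp_apply funpow_add le_add_diff_inverse2)
  then show ?thesis
    using NU_nilpotent[OF assms(1,2)] linear_0[OF linear_funpow[OF linear_NU[OF assms(1)]]] by simp
qed

lemma component_0: "U \<in> \<D> \<Longrightarrow> component U 0 = 0"
  using linear_0[OF linear_component] .

lemma N_nilpotent:
  assumes "m \<le> k"
  shows "(N ^^ k) x = 0"
proof (rule component_eqI)
  fix U assume U: "U \<in> \<D>"
  then have "sz U \<le> k" using sz(2)[OF U] assms by simp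
  then show "component U ((N ^^ k) x) = component U 0"
    using U by (simp add: component_N_funpow NU_funpow_zero component_in component_0)
qed

lemma N_summand:
  assumes "U \<in> \<D>" "x \<in> U"
  shows "N x = NU U x"
proof (rule component_eqI)
  fix U' assume "U' \<in> \<D>"
  then show "component U' (N x) = component U' (NU U x)"
    using assms component_same[OF assms] component_same[OF assms(1) NU_in[OF assms]]
      component_other[OF assms] component_other[OF assms(1) NU_in[OF assms]] linear_0[OF linear_NU]
    by (cases "U' = U") (simp_all add: component_N)
qed

lemma rotates_summand:
  assumes "U \<in> \<D>" "x \<in> U"
  shows "\<exists>\<alpha> y. y \<in> U \<and> rotates (\<lambda>x. A x - N x) \<alpha> x y"
proof -
  obtain \<alpha> y where "y \<in> U" "rotates (\<lambda>x. A x - NU U x) \<alpha> x y" using NU_rotates[OF assms] by blast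
  then show ?thesis
    by (intro exI[of _ \<alpha>] exI[of _ y]) (simp add: rotates_def N_summand[OF assms(1)] assms(2))
qed

lemma span_rotates: "span {x. \<exists>\<alpha> y. rotates (\<lambda>x. A x - N x) \<alpha> x y} = UNIV"
proof -
  have "x \<in> span {x. \<exists>\<alpha> y. rotates (\<lambda>x. A x - N x) \<alpha> x y}" for x
  proof -
    have "(\<Sum>U\<in>\<D>. component U x) \<in> span {x. \<exists>\<alpha> y. rotates (\<lambda>x. A x - N x) \<alpha> x y}"
      using rotates_summand component_in by (intro span_sum span_base) blast
    then show ?thesis by (simp add: sum_component)
  qed
  then show ?thesis by blast
qed

text \<open>
  Eigenvectors are rotated by \<open>A\<close>, hence lie in the kernel of \<open>N\<close>. Conversely, on the kernel \<open>A\<close> agrees with its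
  semisimple part. A component \<open>x\<close> there is killed by \<open>A\<close>, or it has a rotation partner \<open>z\<close> and is the sum of the
  conjugate eigenvectors \<open>(x \<plusminus> \<i> z) / 2\<close>.
\<close>

lemma real_eigenspace_sum_eq: "real_eigenspace_sum A = {x. N x = 0}"
proof
  have ker: "N x = 0" if "rotates A \<beta> x y" for \<beta> x y
    using rotates_imp_kernel[OF lin_A linear_N N_A N_nilpotent span_rotates that, of m] by simp
  show "real_eigenspace_sum A \<subseteq> {x. N x = 0}"
    unfolding real_eigenspace_sum_def
  proof (intro span_minimal linear_subspace_kernel[OF linear_N] subsetI)
    fix x assume "x \<in> {x. A x = 0} \<union> (\<Union>\<alpha>\<in>{0<..}. {x. \<exists>u\<in>complex_eigenspace A (\<i> * complex_of_real \<alpha>).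
                       \<exists>w\<in>complex_eigenspace A (- \<i> * complex_of_real \<alpha>). (x, 0) = u + w})"
    then consider "A x = 0" | \<alpha> u w where "u \<in> complex_eigenspace A (\<i> * complex_of_real \<alpha>)"
        "w \<in> complex_eigenspace A (- \<i> * complex_of_real \<alpha>)" "(x, 0) = u + w" by blast
    then show "x \<in> {x. N x = 0}"
    proof cases
      case 1
      then have "rotates A 0 x 0" by (simp add: rotates_def linear_0[OF lin_A])
      then show ?thesis using ker by simp
    next
      case 2
      then have "rotates A \<alpha> (fst u) (snd u)" "rotates A (- \<alpha>) (fst w) (snd w)"
        by (auto simp: complex_eigenspace_def cscale_def rotates_def prod_eq_iff)
      then have "N (fst u) = 0" "N (fst w) = 0" using ker by blast+
      moreover have "x = fst u + fst w" using 2(3) by (metis fst_add fst_conv)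
      ultimately show ?thesis by (simp add: linear_add[OF linear_N])
    qed
  qed
  have "x \<in> real_eigenspace_sum A" if U: "U \<in> \<D>" "x \<in> U" "N x = 0" for U x
  proof -
    obtain \<alpha> y where y: "y \<in> U" "rotates (\<lambda>x. A x - N x) \<alpha> x y" using rotates_summand[OF U(1,2)] by blast
    show ?thesis
    proof (cases "\<alpha> = 0")
      case True
      then have "A x = 0" using y(2) U(3) by (simp add: rotates_def)
      then show ?thesis unfolding real_eigenspace_sum_def by (intro span_base) simp
    next
      case False
      have Ax: "A x = - \<alpha> *\<^sub>R y" using y(2) U(3) by (simp add: rotates_def)
      have "- \<alpha> *\<^sub>R N y = N (A x)" unfolding Ax by (rule linear_scale[OF linear_N, symmetric])
      also have "\<dots> = 0" using U(3) linear_0[OF lin_A] by (simp flip: N_A)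
      finally have "N y = 0" using False by simp
      then have Ay: "A y = \<alpha> *\<^sub>R x" using y(2) by (simp add: rotates_def)
      have "\<exists>\<beta>>0. \<exists>z. A x = - \<beta> *\<^sub>R z \<and> A z = \<beta> *\<^sub>R x"
      proof (cases "\<alpha> > 0")
        case True
        then show ?thesis using Ax Ay by blast
      next
        case False
        then show ?thesis using Ax Ay \<open>\<alpha> \<noteq> 0\<close> linear_neg[OF lin_A]
          by (intro exI[of _ "- \<alpha>"] conjI exI[of _ "- y"]) simp_all
      qed
      then obtain \<beta> z where z: "\<beta> > 0" "A x = - \<beta> *\<^sub>R z" "A z = \<beta> *\<^sub>R x" by blast
      have "((1/2) *\<^sub>R x, (1/2) *\<^sub>R z) \<in> complex_eigenspace A (\<i> * complex_of_real \<beta>)"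
        "((1/2) *\<^sub>R x, - (1/2) *\<^sub>R z) \<in> complex_eigenspace A (- \<i> * complex_of_real \<beta>)"
        using z by (auto simp: complex_eigenspace_def cscale_def linear_scale[OF lin_A] linear_neg[OF lin_A])
      moreover have "(x, 0) = ((1/2) *\<^sub>R x, (1/2) *\<^sub>R z) + ((1/2) *\<^sub>R x, - (1/2) *\<^sub>R z)"
        by (simp flip: scaleR_add_left)
      ultimately have "\<exists>u\<in>complex_eigenspace A (\<i> * complex_of_real \<beta>).
          \<exists>w\<in>complex_eigenspace A (- \<i> * complex_of_real \<beta>). (x, 0) = u + w" by blast
      then show ?thesis
        unfolding real_eigenspace_sum_def using z(1) by (intro span_base UnI2 UN_I[of \<beta>] CollectI) auto
    qed
  qed
  moreover have "N (component U x) = 0" if "U \<in> \<D>" "N x = 0" for U x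
    using component_N[OF that(1), of x] N_summand[OF that(1) component_in[OF that(1)]] that(2)
    by (simp add: component_0[OF that(1)])
  ultimately have "(\<Sum>U\<in>\<D>. component U x) \<in> real_eigenspace_sum A" if "N x = 0" for x
    using that component_in by (auto simp: real_eigenspace_sum_def intro!: span_sum)
  then show "{x. N x = 0} \<subseteq> real_eigenspace_sum A" by (auto simp: sum_component)
qed

definition kernel_above :: "nat \<Rightarrow> 'a set"
  where "kernel_above k = {x. N x = 0 \<and> (\<forall>U\<in>\<D>. sz U \<le> k \<longrightarrow> component U x = 0)}"

text \<open>
  In a block of size \<open>s\<close> all chains have length \<open>s\<close>, so a vector at the end of the chains is a \<open>k\<close>-th iterate
  exactly when \<open>k < s\<close> or it is zero.
\<close>

lemma kernel_Int_range: "{x. N x = 0} \<inter> range (N ^^ k) = kernel_above k"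
proof (intro equalityI subsetI)
  fix x assume "x \<in> {x. N x = 0} \<inter> range (N ^^ k)"
  then show "x \<in> kernel_above k"
    by (auto simp: kernel_above_def component_N_funpow intro!: NU_funpow_zero component_in)
next
  fix x assume "x \<in> kernel_above k"
  then have x: "N x = 0" and small: "\<And>U. U \<in> \<D> \<Longrightarrow> sz U \<le> k \<Longrightarrow> component U x = 0"
    by (auto simp: kernel_above_def)
  have "\<exists>y\<in>U. (NU U ^^ k) y = component U x" if U: "U \<in> \<D>" for U
  proof (cases "sz U \<le> k")
    case True
    then show ?thesis
      using small[OF U] subspace_0[OF subspace_summand[OF U]] linear_0[OF linear_funpow[OF linear_NU[OF U]]] by auto
  next
    case False
    have "NU U (component U x) = 0" using component_N[OF U, of x] x component_0[OF U] by simp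
    then obtain w where w: "w \<in> U" "component U x = (NU U ^^ (sz U - 1)) w"
      using NU_kernel[OF U component_in[OF U]] by blast
    have "sz U - 1 = k + (sz U - 1 - k)" using False by simp
    then have "component U x = (NU U ^^ k) ((NU U ^^ (sz U - 1 - k)) w)"
      using w(2) by (metis comp_apply funpow_add)
    then show ?thesis using NU_funpow_in[OF U w(1)] by metis
  qed
  then obtain f where f: "\<And>U. U \<in> \<D> \<Longrightarrow> f U \<in> U \<and> (NU U ^^ k) (f U) = component U x" by metis
  define y where "y = (\<Sum>U\<in>\<D>. f U)"
  have "(N ^^ k) y = x"
  proof (rule component_eqI)
    fix U assume U: "U \<in> \<D>"
    have "component U y = f U" by (rule component_unique[OF _ y_def U]) (use f in blast)
    then show "component U ((N ^^ k) y) = component U x"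
      using f[OF U] by (simp add: component_N_funpow[OF U])
  qed
  then show "x \<in> {x. N x = 0} \<inter> range (N ^^ k)" using x by blast
qed

text \<open>
  The sum of the blocks of size \<open>i\<close> (\<open>span_summands\<close>), described by components so that membership can be
  computed.
\<close>

definition stratum :: "nat \<Rightarrow> 'a set"
  where "stratum i = {x. \<forall>U\<in>\<D>. sz U \<noteq> i \<longrightarrow> component U x = 0}"

lemma subspace_stratum: "subspace (stratum i)"
  unfolding stratum_def
  by (auto intro!: subspaceI simp: linear_0[OF linear_component] linear_add[OF linear_component] linear_scale[OF linear_component])

lemma subspace_kernel_above: "subspace (kernel_above k)"
  unfolding kernel_above_def
  by (auto intro!: subspaceI simp: linear_0[OF linear_component] linear_add[OF linear_component] linear_scale[OF linear_component]
      linear_0[OF linear_N] linear_add[OF linear_N] linear_scale[OF linear_N])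

lemma span_summands: "span (\<Union>{U \<in> \<D>. sz U = i}) = stratum i"
proof
  show "span (\<Union>{U \<in> \<D>. sz U = i}) \<subseteq> stratum i"
    by (intro span_minimal subspace_stratum) (auto simp: stratum_def intro: component_other)
  show "stratum i \<subseteq> span (\<Union>{U \<in> \<D>. sz U = i})"
  proof
    fix x assume x: "x \<in> stratum i"
    have "component U x \<in> span (\<Union>{U \<in> \<D>. sz U = i})" if U: "U \<in> \<D>" for U
    proof (cases "sz U = i")
      case True
      then show ?thesis using U component_in[OF U] by (intro span_base) blast
    next
      case False
      then show ?thesis using x U by (simp add: stratum_def span_zero)
    qed
    then have "(\<Sum>U\<in>\<D>. component U x) \<in> span (\<Union>{U \<in> \<D>. sz U = i})" by (intro span_sum)
    then show "x \<in> span (\<Union>{U \<in> \<D>. sz U = i})" by (simp add: sum_component)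
  qed
qed

lemma dim_kernel_above_Suc:
  "dim (kernel_above k) = dim (kernel_above (Suc k)) + dim ({x. N x = 0} \<inter> stratum (Suc k))"
proof -
  have sub: "subspace ({x. N x = 0} \<inter> stratum (Suc k))"
    by (intro subspace_inter linear_subspace_kernel[OF linear_N] subspace_stratum)
  have "x = 0" if x: "x \<in> kernel_above (Suc k)" "x \<in> stratum (Suc k)" for x
  proof (rule component_eqI)
    fix U assume "U \<in> \<D>"
    then show "component U x = component U 0"
      using x by (cases "sz U = Suc k") (simp_all add: kernel_above_def stratum_def component_0)
  qed
  then have "kernel_above (Suc k) \<inter> ({x. N x = 0} \<inter> stratum (Suc k)) \<subseteq> {0}" by blast
  then have "dim (kernel_above (Suc k) \<inter> ({x. N x = 0} \<inter> stratum (Suc k))) = 0" by (simp only: dim_eq_0)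
  moreover have "{x + y | x y. x \<in> kernel_above (Suc k) \<and> y \<in> {x. N x = 0} \<inter> stratum (Suc k)} = kernel_above k"
  proof (intro equalityI subsetI)
    fix v assume "v \<in> {x + y | x y. x \<in> kernel_above (Suc k) \<and> y \<in> {x. N x = 0} \<inter> stratum (Suc k)}"
    then obtain x y where v: "v = x + y" "x \<in> kernel_above (Suc k)" "N y = 0" "y \<in> stratum (Suc k)" by blast
    have "component U v = 0" if "U \<in> \<D>" "sz U \<le> k" for U
      using that v by (simp add: linear_add[OF linear_component[OF that(1)]] kernel_above_def stratum_def)
    then show "v \<in> kernel_above k" using v by (simp add: kernel_above_def linear_add[OF linear_N])
  next
    fix v assume v: "v \<in> kernel_above k"
    define y where "y = (\<Sum>U\<in>\<D>. if sz U = Suc k then component U v else 0)"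
    have y: "component U y = (if sz U = Suc k then component U v else 0)" if "U \<in> \<D>" for U
      using that by (intro component_unique) (auto simp: y_def component_in subspace_0 subspace_summand)
    have "component U (N v) = 0" if "U \<in> \<D>" for U
      using v component_0[OF that] by (simp add: kernel_above_def)
    then have NU: "NU U (component U v) = 0" if "U \<in> \<D>" for U
      using that by (simp add: component_N)
    have "N y = 0"
      by (rule component_eqI) (simp add: component_N y NU component_0 linear_0[OF linear_NU])
    moreover have "component U (v - y) = 0" if "U \<in> \<D>" "sz U \<le> Suc k" for U
      using v that by (auto simp: linear_diff[OF linear_component] y kernel_above_def)
    ultimately have "v - y \<in> kernel_above (Suc k)" "y \<in> {x. N x = 0} \<inter> stratum (Suc k)"
      using v y by (auto simp: kernel_above_def stratum_def linear_diff[OF linear_N])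
    moreover have "v = (v - y) + y" by simp
    ultimately show "v \<in> {x + y | x y. x \<in> kernel_above (Suc k) \<and> y \<in> {x. N x = 0} \<inter> stratum (Suc k)}" by blast
  qed
  ultimately show ?thesis
    using dim_sums_Int[OF subspace_kernel_above[of "Suc k"] sub] by (simp del: dim_eq_0)
qed

lemma dim_kernel_above:
  "k \<le> m \<Longrightarrow> dim (kernel_above k) = (\<Sum>i = Suc k..m. dim ({x. N x = 0} \<inter> stratum i))"
proof (induction k rule: inc_induct)
  case base
  have "x = 0" if "x \<in> kernel_above m" for x
  proof (rule component_eqI)
    fix U assume U: "U \<in> \<D>"
    then have "component U x = 0" using that sz(2)[OF U] by (simp add: kernel_above_def)
    then show "component U x = component U 0" using component_0[OF U] by simp
  qed
  then have "kernel_above m \<subseteq> {0}" by blast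
  then show ?case by simp
next
  case (step k)
  then show ?case using dim_kernel_above_Suc[of k] by (simp add: sum.atLeast_Suc_atMost[of "Suc k"])
qed

text \<open>
  The map \<open>N ^^ k\<close> sends the kernel of \<open>N ^^ Suc k\<close> onto \<open>kernel_above k\<close>, with kernel that of \<open>N ^^ k\<close>. So the
  dimension drops by \<open>dim (kernel_above k)\<close> when the exponent decreases from \<open>Suc k\<close> to \<open>k\<close>, starting
  from the whole space at exponent \<open>m\<close>.
\<close>

lemma dim_kernel_funpow:
  "k \<le> m \<Longrightarrow> int (dim {x. (N ^^ k) x = 0}) =
    int DIM('a) - (\<Sum>i = Suc k..m. (int i - int k) * int (dim ({x. N x = 0} \<inter> stratum i)))"
proof (induction k rule: inc_induct)
  case base
  then show ?case by (simp add: N_nilpotent dim_UNIV)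
next
  case (step k)
  note lin = linear_funpow[OF linear_N]
  let ?d = "\<lambda>i. int (dim ({x. N x = 0} \<inter> stratum i))"
  have "(N ^^ k) ` {x. (N ^^ Suc k) x = 0} = {x. N x = 0} \<inter> range (N ^^ k)"
    by (auto simp: image_iff)
  moreover have "{x \<in> {x. (N ^^ Suc k) x = 0}. (N ^^ k) x = 0} = {x. (N ^^ k) x = 0}"
    using linear_0[OF linear_N] by auto
  ultimately have "dim (kernel_above k) + dim {x. (N ^^ k) x = 0} = dim {x. (N ^^ Suc k) x = 0}"
    using dim_image_plus_kernel[OF lin[of k] linear_subspace_kernel[OF lin[of "Suc k"]]]
    by (simp only: kernel_Int_range)
  moreover have "(\<Sum>i = Suc (Suc k)..m. (int i - int (Suc k)) * ?d i) = (\<Sum>i = Suc k..m. (int i - int (Suc k)) * ?d i)"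
    using step by (subst (2) sum.atLeast_Suc_atMost) auto
  moreover have "int (dim (kernel_above k)) = (\<Sum>i = Suc k..m. ?d i)"
    using dim_kernel_above[of k] step by simp
  moreover have "(\<Sum>i = Suc k..m. (int i - int k) * ?d i) = (\<Sum>i = Suc k..m. (int i - int (Suc k)) * ?d i) + (\<Sum>i = Suc k..m. ?d i)"
    by (simp add: algebra_simps flip: sum.distrib)
  ultimately show ?case using step.IH by linarith
qed

text \<open>
  Grouping the blocks by size gives a decomposition that is again unique, so the definite description
  picks out the sums of the components of equal size.
\<close>

lemma graded_component:
  assumes J: "\<And>i. i \<in> {1..m} \<Longrightarrow> J i = stratum i" and i: "i \<in> {1..m}"
  shows "(THE y. y \<in> (\<Pi>\<^sub>E i\<in>{1..m}. J i) \<and> x = (\<Sum>i = 1..m. y i)) i = 0 \<longleftrightarrow>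
    (\<forall>U\<in>\<D>. sz U = i \<longrightarrow> component U x = 0)"
proof -
  define g where "g i = (\<Sum>U\<in>{U \<in> \<D>. sz U = i}. component U x)" for i
  have comp_g: "component U (g i) = (if sz U = i then component U x else 0)" if "U \<in> \<D>" for U i
    using that finite_summands
    by (intro component_unique)
       (auto simp: g_def component_in subspace_0 subspace_summand sum.inter_filter)
  have "(THE y. y \<in> (\<Pi>\<^sub>E i\<in>{1..m}. J i) \<and> x = (\<Sum>i = 1..m. y i)) = restrict g {1..m}"
  proof (rule the_equality)
    have "x = (\<Sum>i = 1..m. g i)"
      by (rule component_eqI)
         (use sz in \<open>auto simp: linear_sum[OF linear_component] comp_g\<close>)
    then show "restrict g {1..m} \<in> (\<Pi>\<^sub>E i\<in>{1..m}. J i) \<and> x = (\<Sum>i = 1..m. restrict g {1..m} i)"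
      by (auto simp: J stratum_def comp_g)
  next
    fix y assume y: "y \<in> (\<Pi>\<^sub>E i\<in>{1..m}. J i) \<and> x = (\<Sum>i = 1..m. y i)"
    show "y = restrict g {1..m}"
    proof (rule PiE_ext)
      show "y \<in> (\<Pi>\<^sub>E i\<in>{1..m}. J i)" using y by simp
      show "restrict g {1..m} \<in> (\<Pi>\<^sub>E i\<in>{1..m}. J i)" by (auto simp: J stratum_def comp_g)
      fix i assume i: "i \<in> {1..m}"
      have yJ: "component U (y j) = 0" if "U \<in> \<D>" "j \<in> {1..m}" "sz U \<noteq> j" for U j
        using y that J by (auto simp: stratum_def PiE_def Pi_def)
      have "component U (y i) = component U (g i)" if U: "U \<in> \<D>" for U
      proof (cases "sz U = i")
        case True
        have "component U x = (\<Sum>j = 1..m. component U (y j))"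
          using y by (simp add: linear_sum[OF linear_component[OF U]])
        also have "\<dots> = (\<Sum>j\<in>{i}. component U (y j))"
          using i True U by (intro sum.mono_neutral_right) (auto simp: yJ)
        finally show ?thesis using True U by (simp add: comp_g)
      next
        case False
        then show ?thesis using yJ[OF U i] U by (simp add: comp_g)
      qed
      then show "y i = restrict g {1..m} i" using i by (simp add: component_eqI)
    qed
  qed
  moreover have "g i = 0 \<longleftrightarrow> (\<forall>U\<in>\<D>. sz U = i \<longrightarrow> component U x = 0)"
  proof
    assume "g i = 0"
    then show "\<forall>U\<in>\<D>. sz U = i \<longrightarrow> component U x = 0"
      using component_0 by (metis comp_g)
  qed (simp add: g_def)
  ultimately show ?thesis using i by simp
qed

end


section \<open>The dimension of stable manifolds\<close>

theorem lemma4p17: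
  fixes A :: "'a::euclidean_space \<Rightarrow> 'a"
    and n :: nat
    and \<D> :: "'a set set"
    and d :: "'a set \<Rightarrow> 'a set \<Rightarrow> real"
  assumes "DIM('a) = n + 1"
    and "linear A"
    and "\<And>\<mu>. is_eigenvalue A \<mu> \<Longrightarrow> Re \<mu> = 0"
    and "real_jordan_decomposition A \<D>"
    and "Metric_space (proj_set UNIV) d"
    and "Metric_space.mtopology (proj_set UNIV) d = proj_topology"
  shows "\<forall>s\<in>{1..s_max A}.
    \<forall>p \<in> recurrent_points proj_topology (proj_flow A) \<inter>
          (recurrent_stratum A \<D> s - recurrent_stratum A \<D> (s + 1)).
      has_dimension
        (subtopology proj_topology (stable_manifold (proj_set UNIV) d (proj_flow A) p))
        (int (n + 1) - (\<Sum>i = s..s_max A. (int i + 1 - int s) * int (eigen_dim A \<D> i)))"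
proof (intro ballI)
  have fin: "finite \<D>" and jordan: "\<And>U. U \<in> \<D> \<Longrightarrow> \<exists>\<mu>. real_jordan_subspace A \<mu> U"
    and decomp: "\<And>x. \<exists>!f. f \<in> (\<Pi>\<^sub>E U\<in>\<D>. U) \<and> x = (\<Sum>U\<in>\<D>. f U)"
    using assms(4) by (auto simp: real_jordan_decomposition_def)
  define kind where "kind U i \<longleftrightarrow> (real_jordan_subspace A 0 U \<and> dim U = i) \<or>
      (\<exists>\<alpha>>0. real_jordan_subspace A (\<i> * complex_of_real \<alpha>) U \<and> dim U = 2 * i)" for U i
  define Q where "Q U NU s \<longleftrightarrow> jordan_block A NU s U \<and> 1 \<le> s \<and> s \<le> s_max A \<and> (\<forall>i. kind U i \<longleftrightarrow> i = s)" for U NU s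
  have "\<exists>NU s. Q U NU s" if "U \<in> \<D>" for U
    using jordan[OF that] real_jordan_subspace_block[OF assms(2,3)] unfolding Q_def kind_def by blast
  then obtain NU sz where "\<And>U. U \<in> \<D> \<Longrightarrow> Q U (NU U) (sz U)" by metis
  then have blocks: "\<And>U. U \<in> \<D> \<Longrightarrow> jordan_block A (NU U) (sz U) U"
      and sizes: "\<And>U. U \<in> \<D> \<Longrightarrow> 1 \<le> sz U" "\<And>U. U \<in> \<D> \<Longrightarrow> sz U \<le> s_max A"
      and types: "\<And>U i. U \<in> \<D> \<Longrightarrow> kind U i \<longleftrightarrow> i = sz U"
    unfolding Q_def by blast+
  interpret jordan_decomposed \<D> A NU sz "s_max A"
    by (intro jordan_decomposed.intro internal_direct_sum.intro jordan_decomposed_axioms.intro)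
       (use fin decomp blocks sizes assms(2) in \<open>auto simp: jordan_block_def\<close>)
  have J: "jordan_sum A \<D> i = stratum i" for i
  proof -
    have "{U \<in> \<D>. kind U i} = {U \<in> \<D>. sz U = i}" using types by auto
    then show ?thesis unfolding jordan_sum_def by (simp only: span_summands flip: kind_def)
  qed
  have comp: "jordan_component A \<D> x i = 0 \<longleftrightarrow> (\<forall>U\<in>\<D>. sz U = i \<longrightarrow> component U x = 0)"
    if "i \<in> {1..s_max A}" for x i
    unfolding jordan_component_def using that J by (rule graded_component[rotated])
  have stratum_eq: "recurrent_stratum A \<D> t = proj_set ({x. N x = 0} \<inter> range (N ^^ (t - 1)))"
    if t: "1 \<le> t" "t \<le> s_max A" for t
  proof -
    have "(\<forall>i\<in>{1..<t}. jordan_component A \<D> x i = 0) \<longleftrightarrow> (\<forall>U\<in>\<D>. sz U \<le> t - 1 \<longrightarrow> component U x = 0)" for x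
      using t sizes by (auto simp: comp)
    then have "{x \<in> real_eigenspace_sum A. \<forall>i\<in>{1..<t}. jordan_component A \<D> x i = 0} = kernel_above (t - 1)"
      by (auto simp: real_eigenspace_sum_eq kernel_above_def)
    then show ?thesis using t by (simp only: recurrent_stratum_def kernel_Int_range if_True)
  qed
  fix s p
  assume s: "s \<in> {1..s_max A}"
    and p: "p \<in> recurrent_points proj_topology (proj_flow A) \<inter> (recurrent_stratum A \<D> s - recurrent_stratum A \<D> (s + 1))"
  then obtain x where x: "x \<noteq> 0" "N x = 0" "x \<in> range (N ^^ (s - 1))" "p = proj x"
    by (auto simp: stratum_eq proj_set_def)
  have "x \<notin> range (N ^^ Suc (s - 1))"
  proof (cases "s + 1 \<le> s_max A")
    case True
    then show ?thesis using p x stratum_eq[of "s + 1"] s by (auto simp: proj_set_def)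
  next
    case False
    then show ?thesis using N_nilpotent[of s] x(1) s by auto
  qed
  from stable_manifold_has_dimension[OF assms(5,6) lin_A linear_N N_A N_nilpotent span_rotates x(1-3) this, of "s_max A"]
  have "has_dimension (subtopology proj_topology (stable_manifold (proj_set UNIV) d (proj_flow A) p))
      (int (dim {y. (N ^^ (s - 1)) y = 0}))"
    unfolding x(4) by simp
  also have "int (dim {y. (N ^^ (s - 1)) y = 0}) =
      int (n + 1) - (\<Sum>i = s..s_max A. (int i + 1 - int s) * int (eigen_dim A \<D> i))"
    using dim_kernel_funpow[OF le_trans[OF diff_le_self], of s 1] s assms(1)
    by (simp add: eigen_dim_def J real_eigenspace_sum_eq of_nat_diff algebra_simps)
  finally show "has_dimension
      (subtopology proj_topology (stable_manifold (proj_set UNIV) d (proj_flow A) p))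
      (int (n + 1) - (\<Sum>i = s..s_max A. (int i + 1 - int s) * int (eigen_dim A \<D> i)))" .
qed

end
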